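(* Let $n\ge2$ and $0<q<n$. Let $f:B\to\mathbb{R}^n\setminus\{0\}$ be a $K$-quasiregular mapping in the Miniowitz class (with exponent $\alpha$) satisfying the multiplicity condition (M) with $0\le a<n-1$. Then the measure $\mu$ on $B$ given by $$d\mu=\frac{|Df(x)|^q}{|f(x)|^q}(1-|x|)^{q-1}\,dx$$ is a Carleson measure in $B$. Furthermore, the Carleson constant of $\mu$ depends only on $n,q$ and $K,\alpha,a$.
   Context: $B=B(0,1)$ is the open unit ball of $\mathbb{R}^n$, $\mathbb{S}^{n-1}=\partial B$. $K$-quasiregular ($K\ge1$): a continuous $f:B\to\mathbb{R}^n$ in $W^{1,n}_{loc}(B,\mathbb{R}^n)$ with $|Df(x)|^n\le K J_f(x)$ for a.e. $x\in B$, where $|Df|$ is the operator norm and $J_f=\det Df$. Möbius maps: for $x\in B\setminus\{0\}$, $$T_x(y)=\frac{(1-|x|^2)(y-x)-|y-x|^2x}{|x|^2\,\bigl|y-\frac{x}{|x|^2}\bigr|^2},\quad y\in B,$$ is a conformal self-map of $B$ with $T_x(x)=0$; $T_0=\mathrm{Id}$. Multiplicity condition (M): there exist a constant $C>0$ and an exponent $a\in[0,n-1)$ such that $\sup_{x\in B}N(f\circ T_x^{-1},B(0,r))\le C(1-r)^{-a}$ for all $0<r<1$, where $N(g,E)=\sup_{y\in\mathbb{R}^n}\#\{x\in E: g(x)=y\}$. Miniowitz class: all $K$-quasiregular $f:B\to\mathbb{R}^n\setminus\{0\}$ such that for every $x\in B$ the map $g_x=f\circ T_x^{-1}$ satisfies,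 with some positive constants $C_0$ and $\alpha$ depending only on $n$ and $K$, $$\frac1{C_0}\left(\frac{1-|y|}{1+|y|}\right)^{\alpha}\le\frac{|g_x(y)|}{|g_x(0)|}\le C_0\left(\frac{1+|y|}{1-|y|}\right)^{\alpha},\quad y\in B.$$ A positive Borel measure $\mu$ on $B$ is a Carleson measure if there is $C>0$ with $\mu(B\cap B(\omega,r))\le Cr^{n-1}$ for all $\omega\in\partial B$ and $r>0$; the infimum of such $C$ is the Carleson constant of $\mu$.
   Formalization: The Carleson constant is bounded in terms of n, q, K, α, a and also the constant C of condition (M) (and C_0 of the Miniowitz class); independence of C is false, e.g. for f_N = exp(Σ_{k≤N} z^{2^k}) with n=2, K=q=1, a=0. *)

theory Defs
  imports "HOL-Analysis.Analysis"
begin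

(* The open unit ball B of R^n is ball 0 1 :: (real^'n) set, with n = CARD('n). *)

section \<open>Local Sobolev spaces\<close>

primrec Ck :: "nat \<Rightarrow> (real^'n \<Rightarrow> real) \<Rightarrow> bool" where
  "Ck 0 \<phi> \<longleftrightarrow> continuous_on UNIV \<phi>"
| "Ck (Suc k) \<phi> \<longleftrightarrow>
     \<phi> differentiable_on UNIV \<and> (\<forall>v. Ck k (\<lambda>x. frechet_derivative \<phi> (at x) v))"

definition test_functions :: "(real^'n) set \<Rightarrow> (real^'n \<Rightarrow> real) set" where
  "test_functions U =
     {\<phi>. (\<forall>k. Ck k \<phi>) \<and> compact (closure {x. \<phi> x \<noteq> 0}) \<and> closure {x. \<phi> x \<noteq> 0} \<subseteq> U}"

definition Lp_loc :: "real \<Rightarrow> (real^'n) set \<Rightarrow> (real^'n \<Rightarrow> 'b::euclidean_space) \<Rightarrow> bool" where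
  "Lp_loc p U g \<longleftrightarrow>
     g \<in> borel_measurable (lebesgue_on U) \<and>
     (\<forall>S. compact S \<and> S \<subseteq> U \<longrightarrow> integrable (lebesgue_on S) (\<lambda>x. norm (g x) powr p))"

(* The matrix G x has the weak partial derivative of f_i in direction j as its (i, j) entry. *)
definition has_weak_derivative_on ::
    "(real^'n \<Rightarrow> real^'n) \<Rightarrow> (real^'n \<Rightarrow> real^'n^'n) \<Rightarrow> (real^'n) set \<Rightarrow> bool" where
  "has_weak_derivative_on f G U \<longleftrightarrow>
     Lp_loc 1 U f \<and> Lp_loc 1 U G \<and>
     (\<forall>\<phi>\<in>test_functions U. \<forall>i j.
        (\<integral>x. f x $ i * frechet_derivative \<phi> (at x) (axis j 1) \<partial>lebesgue_on U) =
        - (\<integral>x. G x $ i $ j * \<phi> x \<partial>lebesgue_on U))"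

(* The weak derivative is unique only up to null sets; this picks one representative. *)
definition weak_derivative :: "(real^'n) set \<Rightarrow> (real^'n \<Rightarrow> real^'n) \<Rightarrow> real^'n \<Rightarrow> real^'n^'n" where
  "weak_derivative U f = (SOME G. has_weak_derivative_on f G U)"

definition W1p_loc :: "real \<Rightarrow> (real^'n) set \<Rightarrow> (real^'n \<Rightarrow> real^'n) \<Rightarrow> bool" where
  "W1p_loc p U f \<longleftrightarrow>
     (\<exists>G. has_weak_derivative_on f G U) \<and> Lp_loc p U f \<and> Lp_loc p U (weak_derivative U f)"

section \<open>Quasiregular mappings of the unit ball\<close>

(* norm on real^'n^'n is the Frobenius norm, so the operator norm is written with onorm. *)
definition opnorm :: "real^'n^'n \<Rightarrow> real" where
  "opnorm A = onorm (\<lambda>v. A *v v)"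

definition quasiregular :: "real \<Rightarrow> (real^'n \<Rightarrow> real^'n) \<Rightarrow> bool" where
  "quasiregular K f \<longleftrightarrow>
     continuous_on (ball 0 1) f \<and>
     W1p_loc (real CARD('n)) (ball 0 1) f \<and>
     (AE x in lebesgue_on (ball 0 1).
        opnorm (weak_derivative (ball 0 1) f x) ^ CARD('n)
          \<le> K * det (weak_derivative (ball 0 1) f x))"

definition moebius :: "real^'n \<Rightarrow> real^'n \<Rightarrow> real^'n" where
  "moebius x y =
     (if x = 0 then y
      else ((1 - (norm x)\<^sup>2) *\<^sub>R (y - x) - (norm (y - x))\<^sup>2 *\<^sub>R x)
             /\<^sub>R ((norm x)\<^sup>2 * (norm (y - x /\<^sub>R (norm x)\<^sup>2))\<^sup>2))"

(* The inverse of moebius x as a self-map of the ball; meaningful on ball 0 1 only. *)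
definition moebius_inv :: "real^'n \<Rightarrow> real^'n \<Rightarrow> real^'n" where
  "moebius_inv x = inv_into (ball 0 1) (moebius x)"

(* Counting measure rather than card, so that infinite fibres have multiplicity infinity. *)
definition multiplicity_on :: "(real^'n \<Rightarrow> real^'n) \<Rightarrow> (real^'n) set \<Rightarrow> ennreal" where
  "multiplicity_on g E = (SUP y. emeasure (count_space UNIV) {x \<in> E. g x = y})"

definition multiplicity_condition :: "real \<Rightarrow> real \<Rightarrow> (real^'n \<Rightarrow> real^'n) \<Rightarrow> bool" where
  "multiplicity_condition C a f \<longleftrightarrow>
     (\<forall>r. 0 < r \<and> r < 1 \<longrightarrow>
        (SUP x\<in>ball 0 1. multiplicity_on (f \<circ> moebius_inv x) (ball 0 r))
          \<le> ennreal (C * (1 - r) powr (- a)))"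

definition miniowitz_class :: "real \<Rightarrow> real \<Rightarrow> real \<Rightarrow> (real^'n \<Rightarrow> real^'n) set" where
  "miniowitz_class K C0 \<alpha> =
     {f. quasiregular K f \<and> (\<forall>x\<in>ball 0 1. f x \<noteq> 0) \<and>
         (\<forall>x\<in>ball 0 1. \<forall>y\<in>ball 0 1.
            let g = f \<circ> moebius_inv x in
              1 / C0 * ((1 - norm y) / (1 + norm y)) powr \<alpha> \<le> norm (g y) / norm (g 0) \<and>
              norm (g y) / norm (g 0) \<le> C0 * ((1 + norm y) / (1 - norm y)) powr \<alpha>)}"

section \<open>Carleson measures on the unit ball\<close>

definition carleson_bound :: "(real^'n) measure \<Rightarrow> real \<Rightarrow> bool" where
  "carleson_bound \<mu> C \<longleftrightarrow>
     (\<forall>\<omega>\<in>sphere 0 1. \<forall>r>0.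
        emeasure \<mu> (ball 0 1 \<inter> ball \<omega> r) \<le> ennreal (C * r ^ (CARD('n) - 1)))"

definition carleson_measure :: "(real^'n) measure \<Rightarrow> bool" where
  "carleson_measure \<mu> \<longleftrightarrow>
     sets \<mu> = sets (restrict_space borel (ball 0 1)) \<and> (\<exists>C>0. carleson_bound \<mu> C)"

definition carleson_constant :: "(real^'n) measure \<Rightarrow> real" where
  "carleson_constant \<mu> = Inf {C. 0 < C \<and> carleson_bound \<mu> C}"

(* The weak derivative is only Lebesgue measurable: distr along the identity restricts the
   weighted Lebesgue measure to the Borel sets of the ball. *)
definition log_derivative_measure :: "real \<Rightarrow> (real^'n \<Rightarrow> real^'n) \<Rightarrow> (real^'n) measure" where
  "log_derivative_measure q f =
     distr
       (density (lebesgue_on (ball 0 1))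
          (\<lambda>x. ennreal (opnorm (weak_derivative (ball 0 1) f x) powr q / norm (f x) powr q
                          * (1 - norm x) powr (q - 1))))
       (restrict_space borel (ball 0 1)) (\<lambda>x. x)"

end

theory Submission imports Defs
begin

text \<open>Write \<open>D = |Df| / |f|\<close> and let \<open>N\<close> be the multiplicity of \<open>f\<close> on a set \<open>E\<close>. Quasiregularity
and the area inequality give \<open>\<integral>\<^sub>E D^n \<le> K \<integral>\<^sub>E det Df / |f|^n \<le> K N \<integral> |w|^(-n) dw\<close>, the last
integral over \<open>f(E)\<close>. If \<open>E\<close> is a Moebius ball \<open>{y. |T_x y| < 1 - t}\<close>, condition (M) bounds
\<open>N\<close> by \<open>C t^(-a)\<close>, and the Miniowitz inequality confines \<open>f(E)\<close> to a ring around the origin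
whose radii have a quotient of order \<open>t^(-2 \<alpha>)\<close>; such a ring has logarithmic volume of order
\<open>1 + log (1/t)\<close>. Hence \<open>\<integral>\<^sub>E D^n\<close> grows no faster than \<open>t^(-a) (1 + log (1/t))\<close>.

Let \<open>\<rho> = min r 1\<close> and cut the Carleson box at \<open>\<omega>\<close> of radius \<open>r\<close> into the layers where
\<open>1 - |y|\<close> is comparable to \<open>\<rho> / 2^j\<close>. The layer with number \<open>j\<close> has volume at most a
constant times \<open>\<rho>^n / 2^j\<close> and lies in the Moebius ball with centre \<open>x = (1 - \<rho>) \<omega>\<close> and \<open>t\<close>
comparable to \<open>2^(-j)\<close>. The inequality \<open>D^q \<le> s^q + s^(q-n) D^n\<close>, with \<open>s\<close> chosen to balance
the two terms, then bounds the \<open>\<mu>\<close>-measure of the layer by a constant times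
\<open>\<rho>^(n-1) (j + 1) \<theta>^j\<close> with \<open>\<theta> = 2^(-(q/n)(n - 1 - a))\<close>. The hypothesis \<open>a < n - 1\<close> says
exactly that \<open>\<theta> < 1\<close>, so the layers can be summed. The steps are \<open>layer_log_derivative_le\<close>,
\<open>layer_density_le\<close> and \<open>box_density_le\<close>.

The area inequality (\<open>weak_derivative_area_inequality\<close>) is applied to \<open>f\<close> itself, on the
layers; it holds for any continuous map with a locally integrable weak derivative \<open>G\<close>. Such
a map may fail to be differentiable, but a smaller ball is exhausted, up to a null set, by
sets \<open>S\<^sub>k\<close> on which the restriction of \<open>f\<close> has derivative \<open>G\<close>
(\<open>weak_gradient_differentiable_pieces\<close>): mollifications \<open>w\<^sub>j\<close> of a component \<open>u\<close> converge to
\<open>u\<close> with gradients converging quickly in the mean, and where the maximal function of the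
gradient errors is bounded, \<open>u - w\<^sub>j\<close> is Lipschitz with a constant that tends to 0. On \<open>S\<^sub>k\<close>
the change of variables formula applies to countably many pieces on which \<open>f\<close> is injective,
and counting how many pieces hit a point gives the multiplicity.\<close>

section \<open>Reindexing Euclidean space by a well-ordered index type\<close>

text \<open>The change of variables formula concerns \<open>real^'m\<close> for a finite well-ordered index type.
Every finite type is in bijection with an initial segment of the natural numbers; this turns
that segment into a type, along which the formula is transported to an arbitrary finite
index type.\<close>

typedef ('n::finite) index = "{..<CARD('n)}"
  by (rule exI[of _ 0]) simp

instance index :: (finite) finite
proof
  have "inj (Rep_index :: 'a index \<Rightarrow> nat)"
    by (simp add: inj_on_def Rep_index_inject)
  moreover have "range (Rep_index :: 'a index \<Rightarrow> nat) \<subseteq> {..<CARD('a)}"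
    using Rep_index by blast
  ultimately show "finite (UNIV :: 'a index set)"
    using finite_imageD finite_subset finite_lessThan by blast
qed

instantiation index :: (finite) wellorder
begin

definition less_eq_index :: "'a index \<Rightarrow> 'a index \<Rightarrow> bool" where
  "less_eq_index i j \<longleftrightarrow> Rep_index i \<le> Rep_index j"

definition less_index :: "'a index \<Rightarrow> 'a index \<Rightarrow> bool" where
  "less_index i j \<longleftrightarrow> Rep_index i < Rep_index j"

instance
proof
  fix P :: "'a index \<Rightarrow> bool" and a
  assume "\<And>x. (\<And>y. y < x \<Longrightarrow> P y) \<Longrightarrow> P x"
  then show "P a"
    unfolding less_index_def by (induction a rule: measure_induct_rule[where f=Rep_index]) blast
qed (auto simp: less_eq_index_def less_index_def Rep_index_inject)

end

lemma card_index: "CARD('n::finite index) = CARD('n)"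
  using type_definition.card[OF type_definition_index] by simp

lemma index_bij_exists: "\<exists>b. bij (b :: 'n::finite index \<Rightarrow> 'n)"
  using finite_same_card_bij[of "UNIV :: 'n index set" "UNIV :: 'n set"] card_index by auto

definition reindex :: "('m \<Rightarrow> 'n) \<Rightarrow> real^'n \<Rightarrow> real^'m" where
  "reindex b x = (\<chi> i. x $ b i)"

lemma reindex_inverse:
  assumes "bij b"
  shows "reindex (inv b) (reindex b x) = x" "reindex b (reindex (inv b) y) = y"
  using assms by (simp_all add: reindex_def vec_eq_iff bij_is_surj surj_f_inv_f bij_is_inj inv_f_f)

lemma linear_reindex: "linear (reindex b)"
  by (rule linearI) (simp_all add: reindex_def vec_eq_iff)

lemma borel_measurable_reindex [measurable]:
  "reindex (b :: 'm::finite \<Rightarrow> 'n::finite) \<in> borel \<rightarrow>\<^sub>M borel"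
  by (intro borel_measurable_continuous_onI linear_continuous_on linear_conv_bounded_linear[THEN iffD1]
      linear_reindex)

lemma lborel_reindex:
  fixes b :: "'m::finite \<Rightarrow> 'n::finite"
  assumes "bij b"
  shows "distr lborel borel (reindex b) = lborel"
proof (rule lborel_eqI[symmetric])
  fix l u :: "real^'m"
  assume le: "\<And>c. c \<in> Basis \<Longrightarrow> l \<bullet> c \<le> u \<bullet> c"
  have lu: "l $ i \<le> u $ i" for i
    using le[of "axis i 1"] by (simp add: axis_in_Basis_iff inner_axis)
  have prod_cart: "(\<Prod>c\<in>Basis. v \<bullet> c) = (\<Prod>i\<in>UNIV. v $ i)" for v :: "real^'k"
    unfolding Basis_vec_def
    by (subst UN_singleton[symmetric]) (auto simp: inner_axis axis_eq_axis inj_on_def prod.reindex UNION_singleton_eq_range)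
  have "reindex b -` box l u = box (reindex (inv b) l) (reindex (inv b) u)"
    using assms by (auto simp: mem_box_cart reindex_def) (metis bij_inv_eq_iff)+
  then have "emeasure (distr lborel borel (reindex b)) (box l u)
      = emeasure lborel (box (reindex (inv b) l) (reindex (inv b) u))"
    by (simp add: emeasure_distr)
  also have "\<dots> = (\<Prod>c\<in>Basis. (reindex (inv b) u - reindex (inv b) l) \<bullet> c)"
    by (rule emeasure_lborel_box) (auto simp: Basis_vec_def inner_axis reindex_def lu)
  also have "(\<Prod>c\<in>Basis. (reindex (inv b) u - reindex (inv b) l) \<bullet> c)
      = (\<Prod>i\<in>UNIV. (u - l) $ (inv b i))"
    by (simp add: prod_cart reindex_def)
  also have "\<dots> = (\<Prod>i\<in>UNIV. (u - l) $ i)"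
    using assms by (intro prod.reindex_bij_betw) (auto simp: bij_imp_bij_inv)
  finally show "emeasure (distr lborel borel (reindex b)) (box l u) = (\<Prod>c\<in>Basis. (u - l) \<bullet> c)"
    by (simp add: prod_cart)
qed simp

lemma
  fixes b :: "'m::finite \<Rightarrow> 'n::finite"
  assumes "bij b"
  shows measurable_lebesgue_reindex: "reindex b \<in> lebesgue \<rightarrow>\<^sub>M lebesgue"
    and lebesgue_reindex: "distr lebesgue lebesgue (reindex b) = lebesgue"
proof -
  have "distr lebesgue lborel (reindex b) = distr lborel lborel (reindex b)"
    by (subst distr_completion) auto
  also have "\<dots> = lborel"
    using lborel_reindex[OF assms] by (metis distr_cong sets_lborel)
  finally have eq: "distr lebesgue lborel (reindex b) = lborel" .
  show "reindex b \<in> lebesgue \<rightarrow>\<^sub>M lebesgue"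
    by (simp add: completion.measurable_completion2 eq measurable_completion)
  show "distr lebesgue lebesgue (reindex b) = lebesgue"
    by (subst completion.completion_distr_eq[symmetric]) (auto simp: eq measurable_completion)
qed

lemma image_reindex: 
  assumes "bij b"
  shows "reindex b ` S = reindex (inv b) -` S"
proof -
  have "x \<in> reindex b ` S" if "reindex (inv b) x \<in> S" for x
    using that reindex_inverse(2)[OF assms, of x] by (metis imageI)
  then show ?thesis
    by (auto simp: reindex_inverse(1)[OF assms])
qed

lemma
  fixes b :: "'m::finite \<Rightarrow> 'n::finite"
  assumes "bij b" "S \<in> sets lebesgue"
  shows sets_lebesgue_reindex: "reindex b ` S \<in> sets lebesgue"
    and emeasure_lebesgue_reindex: "emeasure lebesgue (reindex b ` S) = emeasure lebesgue S"
proof -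
  have inv: "bij (inv b)"
    using assms(1) by (rule bij_imp_bij_inv)
  show "reindex b ` S \<in> sets lebesgue"
    using measurable_sets[OF measurable_lebesgue_reindex[OF inv] assms(2)]
    by (simp add: image_reindex[OF assms(1)])
  show "emeasure lebesgue (reindex b ` S) = emeasure lebesgue S"
    using emeasure_distr[OF measurable_lebesgue_reindex[OF inv] assms(2)]
    by (simp add: image_reindex[OF assms(1)] lebesgue_reindex[OF inv])
qed

lemma det_reindex:
  fixes A :: "real^'n^'n" and b :: "'m::finite \<Rightarrow> 'n::finite"
  assumes "bij b"
  shows "det (\<chi> i j. A $ b i $ b j) = det A"
proof -
  let ?h = "\<lambda>p. map_permutation UNIV b p"
  have h: "?h p = b \<circ> p \<circ> inv b" for p
    using assms by (simp add: map_permutation_def restrict_id_def fun_eq_iff bij_is_surj)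
  have inv: "bij (inv b)"
    using assms by (rule bij_imp_bij_inv)
  have "bij_betw ?h {p. p permutes UNIV} {p. p permutes UNIV}"
  proof (rule bij_betwI[where g = "\<lambda>q. map_permutation UNIV (inv b) q"])
    show "?h \<in> {p. p permutes UNIV} \<rightarrow> {p. p permutes UNIV}"
      using map_permutation_permutes[of b UNIV UNIV] assms by auto
    show "map_permutation UNIV (inv b) \<in> {p. p permutes UNIV} \<rightarrow> {p. p permutes UNIV}"
      using map_permutation_permutes[of "inv b" UNIV UNIV] inv by auto
  qed (use assms inv in \<open>auto simp: map_permutation_def restrict_id_def fun_eq_iff bij_is_surj
      inv_inv_eq bij_is_inj inv_f_f surj_f_inv_f\<close>)
  then have "det A = (\<Sum>p | p permutes UNIV. of_int (sign (?h p)) * (\<Prod>i\<in>UNIV. A $ i $ ?h p i))"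
    unfolding det_def by (rule sum.reindex_bij_betw[symmetric])
  also have "\<dots> = (\<Sum>p | p permutes UNIV. of_int (sign p) * (\<Prod>i\<in>UNIV. A $ b i $ b (p i)))"
  proof (rule sum.cong)
    fix p :: "'m \<Rightarrow> 'm" assume "p \<in> {p. p permutes UNIV}"
    then have "sign (?h p) = sign p"
      using assms by (intro sign_map_permutation) (auto simp: bij_is_inj)
    moreover have "(\<Prod>i\<in>UNIV. A $ i $ ?h p i) = (\<Prod>i\<in>UNIV. A $ b i $ ?h p (b i))"
      using assms by (intro prod.reindex_bij_betw[symmetric]) auto
    ultimately show "of_int (sign (?h p)) * (\<Prod>i\<in>UNIV. A $ i $ ?h p i)
        = of_int (sign p) * (\<Prod>i\<in>UNIV. A $ b i $ b (p i))"
      using assms by (simp add: h bij_is_inj)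
  qed simp
  finally show ?thesis
    by (simp add: det_def)
qed

section \<open>The area inequality for restrictedly differentiable maps\<close>

text \<open>Conjugating \<open>f\<close> with a permutation of coordinates changes neither the measures of sets nor
the determinant of the derivative, so the formula for well-ordered index types carries over.\<close>

lemma emeasure_image_eq_nn_integral_det:
  fixes f :: "real^'n \<Rightarrow> real^'n" and G :: "real^'n \<Rightarrow> real^'n^'n"
  assumes S: "S \<in> sets lebesgue"
    and der: "\<And>x. x \<in> S \<Longrightarrow> (f has_derivative (\<lambda>v. G x *v v)) (at x within S)"
    and inj: "inj_on f S" and meas: "f ` S \<in> lmeasurable"
  shows "(\<integral>\<^sup>+x\<in>S. ennreal \<bar>det (G x)\<bar> \<partial>lebesgue) = emeasure lebesgue (f ` S)"
proof -
  obtain b :: "'n index \<Rightarrow> 'n" where b: "bij b"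
    using index_bij_exists by blast
  define \<rho> \<rho>' where "\<rho> = reindex b" and "\<rho>' = reindex (inv b)"
  have inv [simp]: "\<rho>' (\<rho> x) = x" "\<rho> (\<rho>' y) = y" for x y
    using reindex_inverse[OF b] by (simp_all add: \<rho>_def \<rho>'_def)
  define F where "F y = \<rho> (f (\<rho>' y))" for y
  define F' where "F' y v = \<rho> (G (\<rho>' y) *v \<rho>' v)" for y v
  have F_image: "F ` (\<rho> ` S) = \<rho> ` (f ` S)"
    by (simp add: F_def image_image)
  have F'_matrix: "matrix (F' y) = (\<chi> i j. G (\<rho>' y) $ b i $ b j)" for y
  proof -
    have ax: "\<rho>' (axis j 1) = axis (b j) 1" for j
      using b by (auto simp: \<rho>'_def reindex_def vec_eq_iff axis_def) (metis bij_inv_eq_iff)+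
    have "matrix (F' y) $ i $ j = G (\<rho>' y) $ b i $ b j" for i j
      by (simp add: matrix_def F'_def ax \<rho>_def reindex_def matrix_vector_mult_basis column_def)
    then show ?thesis
      by (simp add: vec_eq_iff)
  qed
  have "bounded_linear \<rho>" "bounded_linear \<rho>'"
    unfolding \<rho>_def \<rho>'_def by (simp_all add: linear_reindex linear_conv_bounded_linear[symmetric])
  then have "(F has_derivative F' y) (at y within \<rho> ` S)" if "y \<in> \<rho> ` S" for y
  proof -
    have [simp]: "\<rho>' ` \<rho> ` S = S"
      by (simp add: image_image)
    have "(\<rho>' has_derivative \<rho>') (at y within \<rho> ` S)"
      using \<open>bounded_linear \<rho>'\<close> by (rule bounded_linear_imp_has_derivative)
    moreover have "(f has_derivative (\<lambda>v. G (\<rho>' y) *v v)) (at (\<rho>' y) within \<rho>' ` \<rho> ` S)"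
      using der that by auto
    ultimately have "(f \<circ> \<rho>' has_derivative (\<lambda>v. G (\<rho>' y) *v v) \<circ> \<rho>') (at y within \<rho> ` S)"
      by (rule diff_chain_within)
    from bounded_linear.has_derivative[OF \<open>bounded_linear \<rho>\<close> this]
    show ?thesis
      by (simp add: F_def[abs_def] F'_def[abs_def] o_def)
  qed
  moreover have S': "\<rho> ` S \<in> sets lebesgue"
    unfolding \<rho>_def by (rule sets_lebesgue_reindex[OF b S])
  moreover have "inj_on F (\<rho> ` S)"
    unfolding F_def inj_on_def by clarsimp (metis inj inj_onD inv(1))
  moreover have m: "F ` (\<rho> ` S) \<in> lmeasurable"
    "emeasure lebesgue (F ` (\<rho> ` S)) = emeasure lebesgue (f ` S)"
  proof -
    have fS: "f ` S \<in> sets lebesgue"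
      using meas by (rule fmeasurableD)
    show em: "emeasure lebesgue (F ` (\<rho> ` S)) = emeasure lebesgue (f ` S)"
      unfolding F_image unfolding \<rho>_def by (rule emeasure_lebesgue_reindex[OF b fS])
    have "F ` (\<rho> ` S) \<in> sets lebesgue"
      unfolding F_image unfolding \<rho>_def by (rule sets_lebesgue_reindex[OF b fS])
    then show "F ` (\<rho> ` S) \<in> lmeasurable"
      using em fmeasurableD2[OF meas] by (intro fmeasurableI) (auto simp: top.not_eq_extremum)
  qed
  ultimately have "((\<lambda>y. \<bar>det (matrix (F' y))\<bar>) has_integral measure lebesgue (F ` (\<rho> ` S))) (\<rho> ` S)"
    using has_measure_differentiable_image[of "\<rho> ` S" F F'] by blast
  then have int: "((\<lambda>y. \<bar>det (G (\<rho>' y))\<bar>) has_integral measure lebesgue (F ` (\<rho> ` S))) (\<rho> ` S)"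
    by (simp add: F'_matrix det_reindex[OF b])
  have "emeasure lebesgue (F ` (\<rho> ` S)) = ennreal (measure lebesgue (F ` (\<rho> ` S)))"
    using fmeasurableD2[OF m(1)] by (simp add: emeasure_eq_ennreal_measure)
  also have "\<dots> = (\<integral>\<^sup>+y. ennreal (indicator (\<rho> ` S) y * \<bar>det (G (\<rho>' y))\<bar>) \<partial>lebesgue)"
    using nn_integral_has_integral_lebesgue[OF _ int] by (simp add: nn_integral_completion)
  also have "\<dots> = (\<integral>\<^sup>+y. ennreal (indicator (\<rho> ` S) y * \<bar>det (G (\<rho>' y))\<bar>) \<partial>distr lebesgue lebesgue \<rho>)"
    unfolding \<rho>_def lebesgue_reindex[OF b] ..
  also have "\<dots> = (\<integral>\<^sup>+x. ennreal (indicator (\<rho> ` S) (\<rho> x) * \<bar>det (G (\<rho>' (\<rho> x)))\<bar>) \<partial>lebesgue)"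
  proof -
    have "(\<lambda>y. \<bar>det (G (\<rho>' y))\<bar>) \<in> borel_measurable (lebesgue_on (\<rho> ` S))"
      using has_integral_integrable[OF int] by (rule integrable_imp_measurable)
    then have meas_det: "(\<lambda>y. ennreal (indicator (\<rho> ` S) y * \<bar>det (G (\<rho>' y))\<bar>)) \<in> borel_measurable lebesgue"
      using S' by (simp add: borel_measurable_restrict_space_iff)
    have "\<rho> \<in> lebesgue \<rightarrow>\<^sub>M lebesgue"
      unfolding \<rho>_def by (rule measurable_lebesgue_reindex[OF b])
    then show ?thesis
      using meas_det by (intro nn_integral_distr) simp_all
  qed
  also have "\<dots> = (\<integral>\<^sup>+x\<in>S. ennreal \<bar>det (G x)\<bar> \<partial>lebesgue)"
  proof (rule nn_integral_cong)
    fix x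
    have "\<rho> x \<in> \<rho> ` S \<longleftrightarrow> x \<in> S"
      by (metis imageE imageI inv(1))
    then show "ennreal (indicator (\<rho> ` S) (\<rho> x) * \<bar>det (G (\<rho>' (\<rho> x)))\<bar>) = ennreal \<bar>det (G x)\<bar> * indicator S x"
      by (auto simp: indicator_def)
  qed
  finally show ?thesis
    using m(2) by simp
qed

text \<open>Where the derivative is invertible, \<open>f\<close> expands small distances:
\<open>|f y - f x| \<ge> |y - x| / (m + 1)\<close> for all \<open>y\<close> in \<open>S\<close> near \<open>x\<close>. For fixed \<open>m\<close> the points with
this property at scale \<open>1 / (m + 1)\<close> form a relatively closed set \<open>E m\<close>, and \<open>f\<close> is
injective on every part of \<open>E m\<close> that lies in a ball of diameter \<open>1 / (m + 1)\<close>.\<close>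

lemma countable_injective_cover:
  fixes f :: "real^'n \<Rightarrow> real^'n" and G :: "real^'n \<Rightarrow> real^'n^'n"
  assumes S: "S \<in> sets lebesgue"
    and der: "\<And>x. x \<in> S \<Longrightarrow> (f has_derivative (\<lambda>v. G x *v v)) (at x within S)"
    and nz: "\<And>x. x \<in> S \<Longrightarrow> det (G x) \<noteq> 0"
  obtains P :: "nat \<Rightarrow> (real^'n) set"
    where "\<And>i. P i \<in> sets lebesgue" "\<And>i. inj_on f (P i)" "(\<Union>i. P i) = S"
proof -
  define E where "E m = {x \<in> S. \<forall>y\<in>S. norm (y - x) < 1 / Suc m \<longrightarrow> norm (y - x) / Suc m \<le> norm (f y - f x)}" for m
  have contf: "continuous_on S f"
    using der by (rule has_derivative_continuous_on)
  have E_sub: "E m \<subseteq> S" for m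
    by (auto simp: E_def)
  have E_meas: "E m \<in> sets lebesgue" for m
  proof -
    have "E m = S \<inter> closure (E m)"
    proof (intro equalityI subsetI)
      fix x assume x: "x \<in> S \<inter> closure (E m)"
      then obtain s where s: "\<And>k. s k \<in> E m" "s \<longlonglongrightarrow> x"
        by (metis IntD2 closure_sequential)
      then have sS: "\<And>k. s k \<in> S"
        by (auto simp: E_def)
      have fs: "(\<lambda>k. f (s k)) \<longlonglongrightarrow> f x"
        using contf s sS x by (auto simp: continuous_on_sequentially o_def)
      have "norm (y - x) / Suc m \<le> norm (f y - f x)" if y: "y \<in> S" "norm (y - x) < 1 / Suc m" for y
      proof -
        have l: "(\<lambda>k. norm (y - s k)) \<longlonglongrightarrow> norm (y - x)"
          by (intro tendsto_intros s)
        then have "\<forall>\<^sub>F k in sequentially. norm (y - s k) < 1 / Suc m"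
          using y(2) by (rule order_tendstoD)
        then have "\<forall>\<^sub>F k in sequentially. norm (y - s k) / Suc m \<le> norm (f y - f (s k))"
          by eventually_elim (use s(1) y in \<open>auto simp: E_def\<close>)
        moreover have "(\<lambda>k. norm (f y - f (s k))) \<longlonglongrightarrow> norm (f y - f x)"
          by (intro tendsto_intros fs)
        moreover have "(\<lambda>k. norm (y - s k) / Suc m) \<longlonglongrightarrow> norm (y - x) / Suc m"
          by (intro tendsto_intros l) simp
        ultimately show ?thesis
          by (intro tendsto_le[OF sequentially_bot]) 
      qed
      then show "x \<in> E m"
        using x by (simp add: E_def)
    next
      fix x assume "x \<in> E m"
      then show "x \<in> S \<inter> closure (E m)"
        using closure_subset[of "E m"] E_sub[of m] by blast
    qed
    moreover have "S \<inter> closure (E m) \<in> sets lebesgue"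
      using S by (intro sets.Int) auto
    ultimately show ?thesis
      by simp
  qed
  have E_cover: "\<exists>m. x \<in> E m" if x: "x \<in> S" for x
  proof -
    have "inj ((*v) (G x))"
      using nz[OF x] by (simp add: inj_matrix_vector_mult invertible_det_nz)
    then obtain B where B: "B > 0" "\<And>v. B * norm v \<le> norm (G x *v v)"
      using linear_inj_bounded_below_pos[of "(*v) (G x)"] by auto
    obtain d where d: "d > 0" "\<And>y. y \<in> S \<Longrightarrow> norm (y - x) < d \<Longrightarrow>
        norm (f y - f x - G x *v (y - x)) \<le> B / 2 * norm (y - x)"
      using der[OF x] B(1) unfolding has_derivative_within_alt by (metis half_gt_zero)
    obtain m :: nat where m: "1 / Suc m < min d (B / 2)"
      using nat_approx_posE[of "min d (B / 2)"] d(1) B(1) by auto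
    have "norm (y - x) / Suc m \<le> norm (f y - f x)" if y: "y \<in> S" "norm (y - x) < 1 / Suc m" for y
    proof -
      have "norm (y - x) / Suc m = 1 / Suc m * norm (y - x)"
        by simp
      also have "\<dots> \<le> B / 2 * norm (y - x)"
        using m by (intro mult_right_mono) auto
      also have "\<dots> \<le> norm (G x *v (y - x)) - norm (f y - f x - G x *v (y - x))"
        using d(2)[of y] y m B(2)[of "y - x"] by simp
      also have "\<dots> \<le> norm (f y - f x)"
        using norm_triangle_ineq2[of "G x *v (y - x)" "f y - f x"]
        by (smt (verit) norm_minus_commute norm_triangle_ineq3)
      finally show ?thesis .
    qed
    then show ?thesis
      using x by (auto simp: E_def)
  qed
  obtain D :: "(real^'n) set" where D: "countable D" "\<And>X. open X \<Longrightarrow> X \<noteq> {} \<Longrightarrow> \<exists>d\<in>D. d \<in> X"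
    using countable_dense_setE by metis
  define I where "I = (UNIV :: nat set) \<times> D"
  have I: "countable I" "I \<noteq> {}"
    using D(1) D(2)[of UNIV] by (auto simp: I_def)
  define Q where "Q = (\<lambda>(m, c). E m \<inter> ball c (1 / (2 * Suc m)))"
  define P where "P i = Q (from_nat_into I i)" for i
  show thesis
  proof
    show "P i \<in> sets lebesgue" for i
      using E_meas by (auto simp: P_def Q_def split: prod.splits)
    show "inj_on f (P i)" for i
    proof -
      obtain m c where mc: "from_nat_into I i = (m, c)"
        by fastforce
      have "x = y" if "x \<in> P i" "y \<in> P i" "f x = f y" for x y
      proof -
        have *: "x \<in> E m" "y \<in> S" "dist c x < 1 / (2 * Suc m)" "dist c y < 1 / (2 * Suc m)"
          using that by (auto simp: P_def Q_def mc E_def)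
        have "dist y x \<le> dist c y + dist c x"
          by (rule dist_triangle3)
        also have "\<dots> < 1 / Suc m"
          using *(3,4) by (simp add: field_simps)
        finally have "norm (y - x) / Suc m \<le> norm (f y - f x)"
          using * by (simp add: E_def dist_norm)
        then show ?thesis
          using that(3) by (simp add: field_simps)
      qed
      then show ?thesis
        by (auto simp: inj_on_def)
    qed
    have "x \<in> (\<Union>i. P i)" if x: "x \<in> S" for x
    proof -
      obtain m where m: "x \<in> E m"
        using E_cover[OF x] by blast
      obtain c where c: "c \<in> D" "c \<in> ball x (1 / (2 * Suc m))"
        using D(2)[of "ball x (1 / (2 * Suc m))"] by (metis centre_in_ball divide_pos_pos empty_iff mult_pos_pos of_nat_0_less_iff open_ball zero_less_Suc zero_less_numeral zero_less_one)
      then have "(m, c) \<in> I" "x \<in> Q (m, c)"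
        using m by (auto simp: I_def Q_def dist_commute)
      then show ?thesis
        unfolding P_def using I by (metis UN_I UNIV_I from_nat_into_surj)
    qed
    moreover have "P i \<subseteq> S" for i
      by (auto simp: P_def Q_def E_def split: prod.splits)
    ultimately show "(\<Union>i. P i) = S"
      by blast
  qed
qed


lemma borel_measurable_indicator_lebesgue:
  fixes h :: "'a::euclidean_space \<Rightarrow> real"
  assumes "h \<in> borel_measurable (lebesgue_on S)" "S \<in> sets lebesgue"
  shows "(\<lambda>x. ennreal (h x) * indicator S x) \<in> borel_measurable lebesgue"
proof -
  have "(\<lambda>x. ennreal (h x)) \<in> borel_measurable (lebesgue_on S)"
    using assms(1) by measurable
  then show ?thesis
    using assms(2) by (subst (asm) borel_measurable_restrict_space_iff_ennreal) auto
qed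

text \<open>Critical points do not contribute to the integral. The rest of \<open>S\<close> splits into countably
many disjoint pieces on which \<open>f\<close> is injective; the integral over a piece is the measure of
its image, and a point of \<open>Y\<close> lies in at most as many images as it has preimages.\<close>

lemma nn_integral_det_le_multiplicity:
  fixes f :: "real^'n \<Rightarrow> real^'n" and G :: "real^'n \<Rightarrow> real^'n^'n"
  assumes S: "S \<in> sets lebesgue"
    and der: "\<And>x. x \<in> S \<Longrightarrow> (f has_derivative (\<lambda>v. G x *v v)) (at x within S)"
    and G: "(\<lambda>x. det (G x)) \<in> borel_measurable (lebesgue_on S)"
    and img: "f ` S \<subseteq> Y" and Y: "Y \<in> lmeasurable"
    and mult: "\<And>y. emeasure (count_space UNIV) {x \<in> S. f x = y} \<le> N"
  shows "(\<integral>\<^sup>+x\<in>S. ennreal \<bar>det (G x)\<bar> \<partial>lebesgue) \<le> N * emeasure lebesgue Y"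
proof -
  define T where "T = {x \<in> S. det (G x) \<noteq> 0}"
  have T: "T \<in> sets lebesgue"
  proof -
    have "{x \<in> space (lebesgue_on S). det (G x) \<noteq> 0} \<in> sets (lebesgue_on S)"
      using G by measurable
    then show ?thesis
      using S by (simp add: T_def sets_restrict_space_iff)
  qed
  have derT: "(f has_derivative (\<lambda>v. G x *v v)) (at x within T)" if "x \<in> T" for x
    using der that by (auto simp: T_def intro: has_derivative_subset)
  have nzT: "det (G x) \<noteq> 0" if "x \<in> T" for x
    using that by (simp add: T_def)
  obtain P where P: "\<And>i::nat. P i \<in> sets lebesgue" "\<And>i. inj_on f (P i)" "(\<Union>i. P i) = T"
    by (rule countable_injective_cover[OF T derT nzT]) (assumption, assumption, rule that)
  define Q where "Q = disjointed P"
  have Q_meas: "Q i \<in> sets lebesgue" for i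
  proof -
    have "range (disjointed P) \<subseteq> sets lebesgue"
      using P(1) by (intro sets.range_disjointed_sets) (rule image_subsetI)
    then show ?thesis
      unfolding Q_def by (rule subsetD) (rule rangeI)
  qed
  have Q_disj: "disjoint_family Q" and Q_UN: "(\<Union>i. Q i) = T"
    using P(3) by (simp_all add: Q_def disjoint_family_disjointed UN_disjointed_eq)
  have Q_inj: "inj_on f (Q i)" for i
    using P(2) disjointed_subset[of P i] by (auto simp: Q_def intro: inj_on_subset)
  have QT: "Q i \<subseteq> T" for i
    using Q_UN by auto
  have derQ: "(f has_derivative (\<lambda>v. G x *v v)) (at x within Q i)" if "x \<in> Q i" for x i
    using derT QT that by (blast intro: has_derivative_subset)
  have fQ: "f ` Q i \<in> lmeasurable" for i
  proof (rule fmeasurableI2[OF Y])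
    show "f ` Q i \<subseteq> Y"
      using img QT[of i] by (auto simp: T_def)
    show "f ` Q i \<in> sets lebesgue"
      using derQ by (intro differentiable_image_in_sets_lebesgue Q_meas)
        (auto simp: differentiable_on_def differentiable_def)
  qed
  have detm: "(\<lambda>x. ennreal \<bar>det (G x)\<bar> * indicator (Q i) x) \<in> borel_measurable lebesgue" for i
  proof -
    have "Q i \<subseteq> S"
      using QT[of i] by (auto simp: T_def)
    then have "(\<lambda>x. det (G x)) \<in> borel_measurable (lebesgue_on (Q i))"
      using G by (rule measurable_restrict_mono[rotated])
    then show ?thesis
      by (intro borel_measurable_indicator_lebesgue borel_measurable_abs Q_meas)
  qed
  have "(\<integral>\<^sup>+x\<in>S. ennreal \<bar>det (G x)\<bar> \<partial>lebesgue) = (\<integral>\<^sup>+x. (\<Sum>i. ennreal \<bar>det (G x)\<bar> * indicator (Q i) x) \<partial>lebesgue)"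
  proof (rule nn_integral_cong)
    fix x
    have "(\<Sum>i. ennreal \<bar>det (G x)\<bar> * indicator (Q i) x) = ennreal \<bar>det (G x)\<bar> * (\<Sum>i. indicator (Q i) x)"
      by (simp add: ennreal_suminf_cmult)
    also have "(\<Sum>i. indicator (Q i) x) = (indicator T x :: ennreal)"
      using suminf_indicator[OF Q_disj, of x] Q_UN by simp
    finally show "ennreal \<bar>det (G x)\<bar> * indicator S x = (\<Sum>i. ennreal \<bar>det (G x)\<bar> * indicator (Q i) x)"
      by (auto simp: T_def indicator_def)
  qed
  also have "\<dots> = (\<Sum>i. \<integral>\<^sup>+x\<in>Q i. ennreal \<bar>det (G x)\<bar> \<partial>lebesgue)"
    by (rule nn_integral_suminf) (rule detm)
  also have "\<dots> = (\<Sum>i. emeasure lebesgue (f ` Q i))"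
    by (intro suminf_cong emeasure_image_eq_nn_integral_det Q_meas derQ Q_inj fQ)
  also have "\<dots> = (\<Sum>i. \<integral>\<^sup>+y. indicator (f ` Q i) y \<partial>lebesgue)"
    using fQ by (simp add: fmeasurable_def)
  also have "\<dots> = (\<integral>\<^sup>+y. (\<Sum>i. indicator (f ` Q i) y) \<partial>lebesgue)"
    by (intro nn_integral_suminf[symmetric] borel_measurable_indicator fmeasurableD fQ)
  also have "\<dots> \<le> (\<integral>\<^sup>+y. N * indicator Y y \<partial>lebesgue)"
  proof (rule nn_integral_mono)
    fix y
    let ?F = "{x \<in> S. f x = y}"
    have "(\<Sum>i. indicator (f ` Q i) y) \<le> (\<Sum>i. emeasure (count_space UNIV) (?F \<inter> Q i))"
    proof (intro suminf_le summableI)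
      fix i
      show "(indicator (f ` Q i) y :: ennreal) \<le> emeasure (count_space UNIV) (?F \<inter> Q i)"
      proof (cases "y \<in> f ` Q i")
        case True
        then obtain x where "x \<in> ?F \<inter> Q i"
          using QT[of i] by (auto simp: T_def)
        then have "emeasure (count_space UNIV) {x} \<le> emeasure (count_space UNIV) (?F \<inter> Q i)"
          by (intro emeasure_mono) auto
        then show ?thesis
          using True by simp
      qed simp
    qed
    also have "\<dots> = emeasure (count_space UNIV) (\<Union>i. ?F \<inter> Q i)"
      using Q_disj by (intro suminf_emeasure) (auto simp: disjoint_family_on_def)
    also have "\<dots> \<le> emeasure (count_space UNIV) ?F"
      by (intro emeasure_mono) auto
    also have "\<dots> \<le> N"
      by (rule mult)
    finally have le: "(\<Sum>i. indicator (f ` Q i) y) \<le> N" .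
    show "(\<Sum>i. indicator (f ` Q i) y) \<le> N * indicator Y y"
    proof (cases "y \<in> Y")
      case False
      then have "indicator (f ` Q i) y = (0::ennreal)" for i
        using img QT[of i] by (auto simp: T_def indicator_def)
      then show ?thesis by simp
    qed (use le in simp)
  qed
  also have "\<dots> = N * emeasure lebesgue Y"
    using Y by (simp add: nn_integral_cmult_indicator fmeasurable_def)
  finally show ?thesis .
qed

section \<open>Smooth bump functions\<close>

text \<open>The functions \<open>t^(-k) exp (-1/t)\<close>, extended by 0. The derivatives of the flat function
\<open>k = 0\<close> stay in the span of this family, which makes smoothness provable by structural
induction.\<close>

definition flat_exp :: "nat \<Rightarrow> real \<Rightarrow> real" where
  "flat_exp k t = (if t \<le> 0 then 0 else exp (- 1 / t) / t ^ k)"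

lemma flat_exp_tendsto_0: "((\<lambda>t. exp (- 1 / t) / t ^ k) \<longlongrightarrow> (0::real)) (at_right 0)"
proof -
  have "((\<lambda>t. inverse t ^ k / exp (inverse t)) \<longlongrightarrow> (0::real)) (at_right 0)"
    using filterlim_compose[OF tendsto_power_div_exp_0 filterlim_inverse_at_top_right] .
  then show ?thesis
    by (simp add: exp_minus field_simps)
qed

lemma DERIV_flat_exp:
  "(flat_exp k has_real_derivative flat_exp (k + 2) t - k * flat_exp (k + 1) t) (at t)"
proof -
  consider "t > 0" | "t < 0" | "t = 0" by linarith
  then show ?thesis
  proof cases
    case 1
    have "((\<lambda>t. exp (- 1 / t) / t ^ k) has_real_derivative flat_exp (k + 2) t - k * flat_exp (k + 1) t) (at t)"
    proof -
      have "((\<lambda>t. t ^ k) has_real_derivative k * t ^ k / t) (at t)"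
        by (rule DERIV_cong[OF DERIV_pow]) (use 1 in \<open>cases k, auto\<close>)
      moreover have "((\<lambda>t. exp (- 1 / t)) has_real_derivative exp (- 1 / t) / t\<^sup>2) (at t)"
        using 1 by (auto intro!: derivative_eq_intros simp: power2_eq_square)
      ultimately have "((\<lambda>t. exp (- 1 / t) / t ^ k) has_real_derivative
          (exp (- 1 / t) / t\<^sup>2 * t ^ k - exp (- 1 / t) * (k * t ^ k / t)) / (t ^ k * t ^ k)) (at t)"
        using 1 by (intro DERIV_divide) auto
      moreover have "(exp (- 1 / t) / t\<^sup>2 * t ^ k - exp (- 1 / t) * (k * t ^ k / t)) / (t ^ k * t ^ k)
          = flat_exp (k + 2) t - k * flat_exp (k + 1) t"
        using 1 by (simp add: flat_exp_def power_add power2_eq_square field_simps)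
      ultimately show ?thesis
        by simp
    qed
    moreover have "\<forall>\<^sub>F s in nhds t. flat_exp k s = exp (- 1 / s) / s ^ k"
      using eventually_nhds_in_open[of "{0<..}" t] 1
      by (auto elim!: eventually_mono simp: flat_exp_def)
    ultimately show ?thesis
      by (subst DERIV_cong_ev) auto
  next
    case 2
    have "\<forall>\<^sub>F s in nhds t. flat_exp k s = 0"
      using eventually_nhds_in_open[of "{..<0}" t] 2
      by (auto elim!: eventually_mono simp: flat_exp_def)
    moreover have "((\<lambda>_. 0) has_real_derivative 0) (at t)"
      by simp
    ultimately have "(flat_exp k has_real_derivative 0) (at t)"
      by (subst DERIV_cong_ev) auto
    then show ?thesis using 2 by (simp add: flat_exp_def)
  next
    case 3
    have "((\<lambda>h. flat_exp k h / h) \<longlongrightarrow> 0) (at_right 0)"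
      by (rule Lim_transform_eventually[OF flat_exp_tendsto_0[of "Suc k"]])
        (auto simp: eventually_at_filter flat_exp_def intro!: always_eventually)
    moreover have "((\<lambda>h. flat_exp k h / h) \<longlongrightarrow> 0) (at_left 0)"
      by (rule Lim_transform_eventually[OF tendsto_const])
        (auto simp: eventually_at_filter flat_exp_def intro!: always_eventually)
    ultimately have "((\<lambda>h. flat_exp k h / h) \<longlongrightarrow> 0) (at 0)"
      by (rule filterlim_split_at[rotated])
    then show ?thesis
      using 3 by (simp add: DERIV_def flat_exp_def)
  qed
qed

lemma continuous_on_flat_exp: "continuous_on S (flat_exp k)"
  using DERIV_flat_exp by (blast intro: DERIV_isCont continuous_at_imp_continuous_on)

text \<open>A syntactic class of functions that is closed under directional derivatives and contains
the bumps below. It serves to verify all orders of differentiability in \<open>Ck\<close> at once.\<close>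

inductive elementary_smooth :: "(real^'n \<Rightarrow> real) \<Rightarrow> bool" where
  elementary_smooth_const: "elementary_smooth (\<lambda>x. c)"
| elementary_smooth_inner: "elementary_smooth (\<lambda>x. x \<bullet> v)"
| elementary_smooth_square: "elementary_smooth (\<lambda>x. x \<bullet> x)"
| elementary_smooth_add: "elementary_smooth f \<Longrightarrow> elementary_smooth g \<Longrightarrow> elementary_smooth (\<lambda>x. f x + g x)"
| elementary_smooth_mult: "elementary_smooth f \<Longrightarrow> elementary_smooth g \<Longrightarrow> elementary_smooth (\<lambda>x. f x * g x)"
| elementary_smooth_flat_exp: "elementary_smooth f \<Longrightarrow> elementary_smooth (\<lambda>x. flat_exp k (f x))"

lemma elementary_smooth_derivative:
  assumes "elementary_smooth f"
  shows "\<exists>f'. (\<forall>x. (f has_derivative (\<lambda>v. f' v x)) (at x)) \<and> (\<forall>v. elementary_smooth (f' v))"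
  using assms
proof induction
    case (elementary_smooth_const c)
    show ?case
      by (rule exI[of _ "\<lambda>v x. 0"]) (auto intro: elementary_smooth.intros)
  next
    case (elementary_smooth_inner w)
    show ?case
      by (rule exI[of _ "\<lambda>v x. v \<bullet> w"]) (auto intro!: elementary_smooth.intros derivative_eq_intros)
  next
    case elementary_smooth_square
    have "elementary_smooth (\<lambda>x::real^'a. 2 * (x \<bullet> v))" for v
      by (intro elementary_smooth.intros)
    then show ?case
      by (intro exI[of _ "\<lambda>v x. 2 * (x \<bullet> v)"]) (auto intro!: derivative_eq_intros simp: inner_commute)
  next
    case (elementary_smooth_add f g)
    then obtain f' g' where "\<And>x. (f has_derivative (\<lambda>v. f' v x)) (at x)" "\<And>v. elementary_smooth (f' v)"
      "\<And>x. (g has_derivative (\<lambda>v. g' v x)) (at x)" "\<And>v. elementary_smooth (g' v)" by blast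
    then show ?case
      by (intro exI[of _ "\<lambda>v x. f' v x + g' v x"]) (auto intro!: elementary_smooth.intros derivative_eq_intros)
  next
    case (elementary_smooth_mult f g)
    then obtain f' g' where "\<And>x. (f has_derivative (\<lambda>v. f' v x)) (at x)" "\<And>v. elementary_smooth (f' v)"
      "\<And>x. (g has_derivative (\<lambda>v. g' v x)) (at x)" "\<And>v. elementary_smooth (g' v)" by blast
    then show ?case using elementary_smooth_mult.hyps
      by (intro exI[of _ "\<lambda>v x. f x * g' v x + f' v x * g x"]) (auto intro!: elementary_smooth.intros derivative_eq_intros)
  next
    case (elementary_smooth_flat_exp f k)
    then obtain f' where f': "\<And>x. (f has_derivative (\<lambda>v. f' v x)) (at x)" "\<And>v. elementary_smooth (f' v)" by blast
    define g' where "g' v x = (flat_exp (k + 2) (f x) + (- real k) * flat_exp (k + 1) (f x)) * f' v x" for v x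
    have "((\<lambda>x. flat_exp k (f x)) has_derivative (\<lambda>v. g' v x)) (at x)" for x
    proof -
      have "(flat_exp k has_derivative (*) (flat_exp (k + 2) (f x) - k * flat_exp (k + 1) (f x))) (at (f x))"
        using DERIV_flat_exp[of k "f x"] by (simp add: has_field_derivative_def)
      from has_derivative_compose[OF f'(1) this] show ?thesis
        by (simp add: g'_def)
    qed
    moreover have "elementary_smooth (g' v)" for v
      unfolding g'_def by (intro elementary_smooth.intros elementary_smooth_flat_exp.hyps f')
    ultimately show ?case by blast
qed

lemma elementary_smooth_imp_Ck: "elementary_smooth f \<Longrightarrow> Ck k f"
proof (induction k arbitrary: f)
  case 0
  then obtain f' where f': "\<And>x. (f has_derivative (\<lambda>v. f' v x)) (at x)"
    using elementary_smooth_derivative by blast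
  then show ?case
    by (auto intro!: continuous_at_imp_continuous_on has_derivative_continuous)
next
  case (Suc k)
  from Suc.prems obtain f' where f': "\<And>x. (f has_derivative (\<lambda>v. f' v x)) (at x)" "\<And>v. elementary_smooth (f' v)"
    using elementary_smooth_derivative by blast
  have "(\<lambda>x. frechet_derivative f (at x) v) = f' v" for v
  proof
    fix x
    have "(\<lambda>v. f' v x) = frechet_derivative f (at x)"
      using f' by (intro frechet_derivative_at) blast
    then show "frechet_derivative f (at x) v = f' v x"
      by (rule fun_cong[symmetric])
  qed
  then show ?case
    using f' Suc.IH by (auto simp: differentiable_on_def differentiable_def)
qed

definition bump :: "real \<Rightarrow> real^'n \<Rightarrow> real" where
  "bump e z = flat_exp 0 (e\<^sup>2 - z \<bullet> z)"

definition bump_gradient :: "real \<Rightarrow> real^'n \<Rightarrow> real^'n" where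
  "bump_gradient e z = (- 2 * flat_exp 2 (e\<^sup>2 - z \<bullet> z)) *\<^sub>R z"

text \<open>The gradient is recorded explicitly, since mollification differentiates under the integral
sign and needs it as a jointly continuous function.\<close>

lemma bump_has_derivative:
  "(bump e has_derivative (\<lambda>v. bump_gradient e z \<bullet> v)) (at z within S)"
proof -
  have "(flat_exp 0 has_derivative (*) (flat_exp 2 (e\<^sup>2 - z \<bullet> z))) (at (e\<^sup>2 - z \<bullet> z))"
    using DERIV_flat_exp[of 0 "e\<^sup>2 - z \<bullet> z"] by (simp add: has_field_derivative_def numeral_2_eq_2)
  moreover have "((\<lambda>z. e\<^sup>2 - z \<bullet> z) has_derivative (\<lambda>v. - 2 * (z \<bullet> v))) (at z within S)"
    by (auto intro!: derivative_eq_intros simp: inner_commute)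
  ultimately have "((\<lambda>z. flat_exp 0 (e\<^sup>2 - z \<bullet> z)) has_derivative
      (\<lambda>v. flat_exp 2 (e\<^sup>2 - z \<bullet> z) * (- 2 * (z \<bullet> v)))) (at z within S)"
    by (rule has_derivative_compose[rotated])
  then show ?thesis
    by (simp add: bump_def[abs_def] bump_gradient_def mult_ac)
qed

lemma continuous_on_bump [continuous_intros]:
  "continuous_on S f \<Longrightarrow> continuous_on S (\<lambda>x. bump e (f x))"
  unfolding bump_def
  by (intro continuous_on_compose2[OF continuous_on_flat_exp[of UNIV 0]] continuous_intros) auto

lemma continuous_on_bump_gradient [continuous_intros]:
  "continuous_on S f \<Longrightarrow> continuous_on S (\<lambda>x. bump_gradient e (f x))"
  unfolding bump_gradient_def
  by (intro continuous_intros continuous_on_compose2[OF continuous_on_flat_exp[of UNIV 2]]) auto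

lemma bump_nonneg: "0 \<le> bump e z"
  by (simp add: bump_def flat_exp_def)

lemma bump_le_1: "bump e z \<le> 1"
  by (simp add: bump_def flat_exp_def)

lemma bump_eq_0: "0 < e \<Longrightarrow> e \<le> norm z \<Longrightarrow> bump e z = 0"
  using power_mono[of e "norm z" 2] by (simp add: bump_def flat_exp_def power2_norm_eq_inner)

lemma bump_gradient_eq_0: "0 < e \<Longrightarrow> e \<le> norm z \<Longrightarrow> bump_gradient e z = 0"
  using power_mono[of e "norm z" 2] by (simp add: bump_gradient_def flat_exp_def power2_norm_eq_inner)

lemma bump_pos: "norm z < e \<Longrightarrow> 0 < bump e z"
  using power_strict_mono[of "norm z" e 2] by (simp add: bump_def flat_exp_def power2_norm_eq_inner)

lemma reflected_bump_test_function:
  assumes "0 < e" "cball x e \<subseteq> U"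
  shows "(\<lambda>y. bump e (x - y)) \<in> test_functions U"
proof -
  have "elementary_smooth (\<lambda>y. flat_exp 0 ((e\<^sup>2 - x \<bullet> x) + (2 * (y \<bullet> x) + (-1) * (y \<bullet> y))))"
    by (intro elementary_smooth.intros)
  also have "(\<lambda>y. flat_exp 0 ((e\<^sup>2 - x \<bullet> x) + (2 * (y \<bullet> x) + (-1) * (y \<bullet> y)))) = (\<lambda>y. bump e (x - y))"
    by (simp add: bump_def inner_diff_left inner_diff_right inner_commute algebra_simps)
  finally have "\<forall>k. Ck k (\<lambda>y. bump e (x - y))"
    by (simp add: elementary_smooth_imp_Ck)
  moreover have sub: "closure {y. bump e (x - y) \<noteq> 0} \<subseteq> cball x e"
    using bump_eq_0[OF assms(1)] by (intro closure_minimal) (force simp: dist_norm)+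
  then have "compact (closure {y. bump e (x - y) \<noteq> 0})"
    by (metis closed_closure compact_cball compact_Int_closed inf.absorb_iff2)
  ultimately show ?thesis
    using assms(2) sub by (auto simp: test_functions_def)
qed

section \<open>Continuity of translations in the mean\<close>

lemma nn_integral_lborel_translate:
  fixes f :: "'a::euclidean_space \<Rightarrow> ennreal"
  assumes [measurable]: "f \<in> borel_measurable borel"
  shows "(\<integral>\<^sup>+x. f (x - h) \<partial>lborel) = (\<integral>\<^sup>+x. f x \<partial>lborel)"
proof -
  have "(\<integral>\<^sup>+x. f x \<partial>lborel) = (\<integral>\<^sup>+x. f x \<partial>distr lborel borel ((+) (- h)))"
    by (simp add: lborel_distr_plus)
  also have "\<dots> = (\<integral>\<^sup>+x. f (- h + x) \<partial>lborel)"
    by (rule nn_integral_distr) auto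
  finally show ?thesis
    by simp
qed

text \<open>Squeeze \<open>A\<close> between a compact \<open>K\<close> and an open \<open>V\<close> with \<open>V - K\<close> small. A translation by less
than the distance from \<open>K\<close> to the complement of \<open>V\<close> keeps \<open>K\<close> inside \<open>V\<close>, so \<open>A\<close> and its
translate can only differ on \<open>V - K\<close> and the translate of \<open>V - K\<close>.\<close>

lemma translation_continuous_indicator:
  fixes A :: "'a::euclidean_space set"
  assumes A: "A \<in> sets borel" "emeasure lborel A < \<infinity>" and e: "(e::real) > 0"
  shows "\<exists>d>0. \<forall>h. norm h < d \<longrightarrow>
    (\<integral>\<^sup>+x. norm (indicator A (x - h) - indicator A x :: real) \<partial>lborel) \<le> ennreal e"
proof -
  have AL: "A \<in> sets lebesgue"
    using A by simp
  obtain V where V: "open V" "A \<subseteq> V" "emeasure lebesgue (V - A) < ennreal (e/8)"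
    using sets_lebesgue_outer_open[OF AL, of "e/8"] e by (metis divide_pos_pos zero_less_numeral)
  obtain F where F: "closed F" "F \<subseteq> A" "emeasure lebesgue (A - F) < ennreal (e/8)"
    using sets_lebesgue_inner_closed[OF AL, of "e/8"] e by (metis divide_pos_pos zero_less_numeral)
  define B where "B n = F - cball 0 (real n)" for n
  have "(\<lambda>n. emeasure lborel (B n)) \<longlonglongrightarrow> emeasure lborel (\<Inter>n. B n)"
  proof (rule Lim_emeasure_decseq)
    show "range B \<subseteq> sets lborel"
      using F by (auto simp: B_def)
    show "decseq B"
      by (auto simp: decseq_def B_def)
    show "emeasure lborel (B i) \<noteq> \<infinity>" for i
    proof -
      have "emeasure lborel (B i) \<le> emeasure lborel A"
        using F(2) A(1) by (intro emeasure_mono) (auto simp: B_def)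
      also have "\<dots> < \<infinity>"
        by (rule A(2))
      finally show ?thesis
        by simp
    qed
  qed
  moreover have "(\<Inter>n. B n) = {}"
  proof -
    have "\<exists>n. x \<notin> B n" for x
      using real_arch_simple[of "norm x"] by (auto simp: B_def)
    then show ?thesis
      by blast
  qed
  ultimately have "(\<lambda>n. emeasure lborel (B n)) \<longlonglongrightarrow> 0"
    by simp
  then have "\<forall>\<^sub>F n in sequentially. emeasure lborel (B n) < ennreal (e/8)"
    using e by (intro order_tendstoD(2)) auto
  then obtain n where n: "emeasure lborel (B n) < ennreal (e/8)"
    using eventually_happens'[OF sequentially_bot] by blast
  define K where "K = F \<inter> cball 0 (real n)"
  have K: "compact K" "K \<subseteq> A"
    using F by (auto simp: K_def closed_Int_compact)
  have VAF: "V - A \<in> sets lborel" "A - F \<in> sets lborel" "B n \<in> sets lborel"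
    using V(1) F(1) A(1) by (auto simp: B_def)
  have "emeasure lborel (V - K) \<le> emeasure lborel ((V - A) \<union> ((A - F) \<union> B n))"
  proof (rule emeasure_mono)
    show "V - K \<subseteq> (V - A) \<union> ((A - F) \<union> B n)"
      by (auto simp: K_def B_def)
  qed (use VAF in blast)
  also have "\<dots> \<le> emeasure lborel (V - A) + emeasure lborel ((A - F) \<union> B n)"
    using VAF by (intro emeasure_subadditive) blast+
  also have "\<dots> \<le> emeasure lborel (V - A) + (emeasure lborel (A - F) + emeasure lborel (B n))"
    using VAF by (intro add_left_mono emeasure_subadditive)
  also have "\<dots> \<le> ennreal (e/8) + (ennreal (e/8) + ennreal (e/8))"
    using V(3) F(3) n VAF by (intro add_mono) (simp_all add: less_imp_le)
  also have "\<dots> \<le> ennreal (e/2)"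
    using e by (simp add: ennreal_plus[symmetric] ennreal_leI del: ennreal_plus)
  finally have VK: "emeasure lborel (V - K) \<le> ennreal (e/2)" .
  obtain d where d: "d > 0" "(\<Union>x\<in>K. ball x d) \<subseteq> V"
    using compact_subset_open_imp_ball_epsilon_subset[OF K(1) V(1)] K(2) V(2) by blast
  have [measurable]: "V - K \<in> sets borel"
    using V K by (auto simp: borel_compact)
  have "(\<integral>\<^sup>+x. norm (indicator A (x - h) - indicator A x :: real) \<partial>lborel) \<le> ennreal e" if h: "norm h < d" for h
  proof -
    have "(\<integral>\<^sup>+x. norm (indicator A (x - h) - indicator A x :: real) \<partial>lborel)
        \<le> (\<integral>\<^sup>+x. indicator (V - K) (x - h) + indicator (V - K) x \<partial>lborel)"
    proof (rule nn_integral_mono)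
      fix x
      have 1: "y + k \<in> V" if "y \<in> K" "norm k < d" for y k
      proof -
        have "y + k \<in> ball y d"
          using that by (simp add: dist_norm)
        then show ?thesis
          using d(2) that(1) by blast
      qed
      have *: "x - h \<in> K \<Longrightarrow> x \<in> V" "x \<in> K \<Longrightarrow> x - h \<in> V"
        using 1[of "x - h" h] 1[of x "- h"] h by auto
      show "ennreal (norm (indicator A (x - h) - indicator A x :: real))
          \<le> indicator (V - K) (x - h) + indicator (V - K) x"
      proof (cases "x \<in> A \<longleftrightarrow> x - h \<in> A")
        case True
        then show ?thesis
          by (simp add: indicator_def)
      next
        case False
        then have "x \<in> V - K \<or> x - h \<in> V - K"
          using * V(2) K(2) by blast
        moreover have "norm (indicator A (x - h) - indicator A x :: real) = 1"
          using False by (auto simp: indicator_def)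
        ultimately show ?thesis
          by (auto simp: indicator_def)
      qed
    qed
    also have "\<dots> = 2 * emeasure lborel (V - K)"
      using nn_integral_lborel_translate[of "indicator (V - K)" h]
      by (subst nn_integral_add) (auto simp: mult_2)
    also have "\<dots> \<le> 2 * ennreal (e/2)"
      using VK by (intro mult_left_mono) auto
    also have "\<dots> = ennreal e"
      using e by (subst ennreal_numeral[symmetric], subst ennreal_mult[symmetric]) auto
    finally show ?thesis .
  qed
  then show ?thesis
    using d(1) by blast
qed

lemma translation_continuous_L1:
  fixes H :: "'a::euclidean_space \<Rightarrow> 'b::{banach, second_countable_topology}"
  assumes "integrable lborel H" "(e::real) > 0"
  shows "\<exists>d>0. \<forall>h. norm h < d \<longrightarrow> (\<integral>\<^sup>+x. norm (H (x - h) - H x) \<partial>lborel) \<le> ennreal e"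
  using assms
proof (induction arbitrary: e rule: integrable_induct)
  case (base A c)
  have "e / (norm c + 1) > 0"
    using base by (simp add: add_nonneg_pos)
  then obtain d where d: "d > 0" "\<And>h. norm h < d \<Longrightarrow>
      (\<integral>\<^sup>+x. norm (indicator A (x - h) - indicator A x :: real) \<partial>lborel) \<le> ennreal (e / (norm c + 1))"
    using translation_continuous_indicator[of A "e / (norm c + 1)"] base by auto
  have [measurable]: "A \<in> sets borel"
    using base by simp
  have "(\<integral>\<^sup>+x. norm (indicator A (x - h) *\<^sub>R c - indicator A x *\<^sub>R c) \<partial>lborel) \<le> ennreal e" if h: "norm h < d" for h
  proof -
    have "(\<integral>\<^sup>+x. norm (indicator A (x - h) *\<^sub>R c - indicator A x *\<^sub>R c) \<partial>lborel)
        = (\<integral>\<^sup>+x. ennreal (norm c) * norm (indicator A (x - h) - indicator A x :: real) \<partial>lborel)"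
      by (intro nn_integral_cong) (simp add: scaleR_left_diff_distrib[symmetric] ennreal_mult'[symmetric] mult.commute)
    also have "\<dots> = ennreal (norm c) * (\<integral>\<^sup>+x. norm (indicator A (x - h) - indicator A x :: real) \<partial>lborel)"
      by (rule nn_integral_cmult) measurable
    also have "\<dots> \<le> ennreal (norm c) * ennreal (e / (norm c + 1))"
      using d(2)[OF h] by (intro mult_left_mono) auto
    also have "\<dots> \<le> ennreal e"
      using base(3) add_nonneg_pos[of "norm c" 1]
      by (simp add: ennreal_mult'[symmetric] ennreal_leI field_simps)
    finally show ?thesis .
  qed
  then show ?case using d(1) by blast
next
  case (add f g)
  have [measurable]: "f \<in> borel_measurable borel" "g \<in> borel_measurable borel"
    using add.hyps by auto
  obtain d1 where d1: "d1 > 0" "\<And>h. norm h < d1 \<Longrightarrow> (\<integral>\<^sup>+x. norm (f (x - h) - f x) \<partial>lborel) \<le> ennreal (e/2)"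
    using add.IH(1)[of "e/2"] add.prems by auto
  obtain d2 where d2: "d2 > 0" "\<And>h. norm h < d2 \<Longrightarrow> (\<integral>\<^sup>+x. norm (g (x - h) - g x) \<partial>lborel) \<le> ennreal (e/2)"
    using add.IH(2)[of "e/2"] add.prems by auto
  have "(\<integral>\<^sup>+x. norm (f (x - h) + g (x - h) - (f x + g x)) \<partial>lborel) \<le> ennreal e" if h: "norm h < min d1 d2" for h
  proof -
    have "(\<integral>\<^sup>+x. norm (f (x - h) + g (x - h) - (f x + g x)) \<partial>lborel)
        \<le> (\<integral>\<^sup>+x. ennreal (norm (f (x - h) - f x)) + norm (g (x - h) - g x) \<partial>lborel)"
      by (intro nn_integral_mono) (simp add: ennreal_plus[symmetric] norm_diff_triangle_ineq del: ennreal_plus)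
    also have "\<dots> \<le> ennreal (e/2) + ennreal (e/2)"
      using d1(2)[of h] d2(2)[of h] h by (subst nn_integral_add) (auto intro: add_mono)
    also have "\<dots> = ennreal e"
      using add.prems by (simp add: ennreal_plus[symmetric] del: ennreal_plus)
    finally show ?thesis .
  qed
  then show ?case using d1(1) d2(1) by (intro exI[of _ "min d1 d2"]) auto
next
  case (lim f s)
  have [measurable]: "f \<in> borel_measurable borel" "\<And>i. s i \<in> borel_measurable borel"
    using lim.hyps by auto
  have "(\<lambda>i. \<integral>\<^sup>+x. norm (f x - s i x) \<partial>lborel) \<longlonglongrightarrow> 0"
  proof (rule nn_integral_dominated_convergence_norm[where w = "\<lambda>x. 2 * norm (f x)"])
    show "(\<integral>\<^sup>+x. ennreal (2 * norm (f x)) \<partial>lborel) < \<infinity>"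
      using lim.hyps(4) by (simp add: integrable_iff_bounded ennreal_mult nn_integral_cmult ennreal_mult_less_top)
  qed (use lim.hyps in auto)
  then have "\<forall>\<^sub>F i in sequentially. (\<integral>\<^sup>+x. norm (f x - s i x) \<partial>lborel) < ennreal (e/3)"
    using lim.prems by (intro order_tendstoD(2)) auto
  then obtain i where i: "(\<integral>\<^sup>+x. norm (f x - s i x) \<partial>lborel) \<le> ennreal (e/3)"
    using eventually_happens'[OF sequentially_bot] less_imp_le by blast
  obtain d where d: "d > 0" "\<And>h. norm h < d \<Longrightarrow> (\<integral>\<^sup>+x. norm (s i (x - h) - s i x) \<partial>lborel) \<le> ennreal (e/3)"
    using lim.IH[of "e/3" i] lim.prems by auto
  have "(\<integral>\<^sup>+x. norm (f (x - h) - f x) \<partial>lborel) \<le> ennreal e" if h: "norm h < d" for h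
  proof -
    have "(\<integral>\<^sup>+x. norm (f (x - h) - f x) \<partial>lborel)
        \<le> (\<integral>\<^sup>+x. ennreal (norm (f (x - h) - s i (x - h)))
            + (ennreal (norm (s i (x - h) - s i x)) + ennreal (norm (f x - s i x))) \<partial>lborel)"
    proof (rule nn_integral_mono)
      fix x
      have "norm (f (x - h) - f x)
          \<le> norm (f (x - h) - s i (x - h)) + (norm (s i (x - h) - s i x) + norm (f x - s i x))"
        by norm
      then show "ennreal (norm (f (x - h) - f x)) \<le> ennreal (norm (f (x - h) - s i (x - h)))
            + (ennreal (norm (s i (x - h) - s i x)) + ennreal (norm (f x - s i x)))"
        by (simp add: ennreal_plus[symmetric] ennreal_leI del: ennreal_plus)
    qed
    also have "\<dots> = (\<integral>\<^sup>+x. norm (f (x - h) - s i (x - h)) \<partial>lborel)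
        + ((\<integral>\<^sup>+x. norm (s i (x - h) - s i x) \<partial>lborel) + (\<integral>\<^sup>+x. norm (f x - s i x) \<partial>lborel))"
      by (subst nn_integral_add, measurable)+
    also have "\<dots> \<le> ennreal (e/3) + (ennreal (e/3) + ennreal (e/3))"
      using i d(2)[OF h] nn_integral_lborel_translate[of "\<lambda>x. ennreal (norm (f x - s i x))" h]
      by (intro add_mono) auto
    also have "\<dots> = ennreal e"
      using lim.prems by (simp add: ennreal_plus[symmetric] del: ennreal_plus)
    finally show ?thesis .
  qed
  then show ?case
    using d(1) by blast
qed

section \<open>Mollification of weakly differentiable functions\<close>

lemma nn_integral_lborel_reflect:
  fixes f :: "'a::euclidean_space \<Rightarrow> ennreal"
  assumes [measurable]: "f \<in> borel_measurable borel"
  shows "(\<integral>\<^sup>+y. f (x - y) \<partial>lborel) = (\<integral>\<^sup>+y. f y \<partial>lborel)"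
proof -
  have eq: "lborel = distr lborel borel (\<lambda>y. x - y :: 'a)"
    using lborel_affine[of "-1" x] by (simp add: density_1)
  have "(\<integral>\<^sup>+y. f y \<partial>lborel) = (\<integral>\<^sup>+y. f y \<partial>distr lborel borel (\<lambda>y. x - y))"
    by (subst eq) simp
  also have "\<dots> = (\<integral>\<^sup>+y. f (x - y) \<partial>lborel)"
    by (rule nn_integral_distr) auto
  finally show ?thesis
    by simp
qed

text \<open>Weak derivatives are only Lebesgue measurable, whereas Tonelli's theorem on the product of
two copies of \<open>lborel\<close> requires Borel functions; this supplies the Borel version.\<close>

lemma lebesgue_on_borel_representative:
  fixes \<gamma> :: "real^'n \<Rightarrow> real^'m"
  assumes \<gamma>: "\<gamma> \<in> borel_measurable (lebesgue_on S)" and S: "S \<in> sets lebesgue"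
  obtains H where "H \<in> borel_measurable borel"
    "AE x in lebesgue. H x = indicator S x *\<^sub>R \<gamma> x"
proof -
  have "\<exists>h. h \<in> borel_measurable borel \<and> (AE x in lborel. indicator S x * \<gamma> x $ i = h x)" for i
  proof -
    have "(\<lambda>x. \<gamma> x $ i) \<in> borel_measurable (lebesgue_on S)"
      using \<gamma> by (rule measurable_compose) (simp add: borel_measurable_continuous_onI continuous_on_component)
    then have "(\<lambda>x. indicator S x * \<gamma> x $ i) \<in> borel_measurable lebesgue"
      using S by (simp add: borel_measurable_restrict_space_iff)
    then obtain h where "h \<in> borel_measurable lborel" "AE x in lborel. indicator S x * \<gamma> x $ i = h x"
      using completion_ex_borel_measurable_real by blast
    then show ?thesis
      by auto
  qed
  then obtain h where h: "\<And>i. h i \<in> borel_measurable borel"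
    "\<And>i. AE x in lborel. indicator S x * \<gamma> x $ i = h i x"
    by metis
  show thesis
  proof
    show "(\<lambda>x. \<chi> i. h i x) \<in> borel_measurable borel"
      using h(1) by (intro borel_measurable_euclidean_space[THEN iffD2]) (auto simp: Basis_vec_def inner_axis)
    have "AE x in lborel. \<forall>i. indicator S x * \<gamma> x $ i = h i x"
      using h(2) by (simp add: AE_all_countable)
    then have "AE x in lborel. (\<chi> i. h i x) = indicator S x *\<^sub>R \<gamma> x"
      by eventually_elim (simp add: vec_eq_iff)
    then show "AE x in lebesgue. (\<chi> i. h i x) = indicator S x *\<^sub>R \<gamma> x"
      by (rule AE_completion)
  qed
qed

lemma borel_measurable_bump [measurable]: "bump e \<in> borel_measurable borel"
  by (rule borel_measurable_continuous_onI) (intro continuous_intros)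

lemma nn_integral_bump:
  assumes "0 < e"
  obtains c where "0 < c" "(\<integral>\<^sup>+y. ennreal (bump e (y :: real^'n)) \<partial>lborel) = ennreal c"
proof -
  let ?I = "\<integral>\<^sup>+y. ennreal (bump e (y :: real^'n)) \<partial>lborel"
  have "integrable lborel (\<lambda>y. indicator (cball 0 e) y *\<^sub>R bump e (y :: real^'n))"
    by (intro borel_integrable_compact continuous_intros) simp
  also have "(\<lambda>y. indicator (cball 0 e) y *\<^sub>R bump e (y :: real^'n)) = bump e"
    using bump_eq_0[OF assms] by (force simp: indicator_def)
  finally have "?I < \<infinity>"
    by (simp add: integrable_iff_bounded bump_nonneg)
  moreover have "?I \<noteq> 0"
  proof
    assume "?I = 0"
    then have "AE y in lborel. ennreal (bump e (y :: real^'n)) = 0"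
      by (subst (asm) nn_integral_0_iff_AE) auto
    then have "AE y in lborel. y \<notin> ball (0 :: real^'n) e"
      by eventually_elim (metis bump_pos dist_0_norm ennreal_eq_0_iff leD mem_ball)
    then have "emeasure lborel (ball (0 :: real^'n) e) = 0"
      by (subst (asm) AE_iff_measurable) auto
    then show False
      using assms content_ball_pos[of e "0 :: real^'n"] by (simp add: measure_def)
  qed
  ultimately show thesis
    by (intro that[of "enn2real ?I"]) (auto simp: enn2real_positive_iff top.not_eq_extremum zero_less_iff_neq_zero)
qed


text \<open>For \<open>w = u * \<phi>\<close>, with \<open>\<phi>\<close> a normalised bump of small radius \<open>e\<close>, testing the weak
derivative against reflected bumps gives \<open>Dw = \<gamma> * \<phi>\<close>. So \<open>Dw - \<gamma>\<close> is an average of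
\<open>\<gamma>(x - h) - \<gamma>(x)\<close> over \<open>|h| < e\<close>, which is small in the mean by continuity of translations.\<close>

lemma mollify:
  fixes u :: "real^'n \<Rightarrow> real" and \<gamma> :: "real^'n \<Rightarrow> real^'n"
  assumes cont: "continuous_on (ball 0 1) u"
    and \<gamma>_meas: "\<gamma> \<in> borel_measurable (lebesgue_on (ball 0 1))"
    and \<gamma>_int: "\<And>S. compact S \<Longrightarrow> S \<subseteq> ball 0 1 \<Longrightarrow> integrable (lebesgue_on S) (\<lambda>x. norm (\<gamma> x))"
    and weak: "\<And>\<phi> j. \<phi> \<in> test_functions (ball 0 1) \<Longrightarrow>
        (\<integral>x. u x * frechet_derivative \<phi> (at x) (axis j 1) \<partial>lebesgue_on (ball 0 1)) =
        - (\<integral>x. \<gamma> x $ j * \<phi> x \<partial>lebesgue_on (ball 0 1))"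
    and \<rho>: "0 < \<rho>" "\<rho> < 1" and \<eta>: "0 < \<eta>"
  shows "\<exists>w Dw. (\<forall>x. (w has_derivative (\<lambda>v. Dw x \<bullet> v)) (at x)) \<and> continuous_on UNIV Dw \<and>
      (\<forall>x\<in>ball 0 \<rho>. \<bar>w x - u x\<bar> \<le> \<eta>) \<and>
      (\<integral>\<^sup>+x\<in>ball 0 \<rho>. ennreal (norm (Dw x - \<gamma> x)) \<partial>lebesgue) \<le> ennreal \<eta>"
proof -
  define \<rho>2 where "\<rho>2 = (1 + \<rho>) / 2"
  have \<rho>2: "\<rho> < \<rho>2" "\<rho>2 < 1" "0 < \<rho>2"
    using \<rho> by (auto simp: \<rho>2_def)
  let ?C = "cball (0 :: real^'n) \<rho>2" and ?U = "ball (0 :: real^'n) 1"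
  have CU: "?C \<subseteq> ?U"
    using \<rho>2 by auto
  \<comment> \<open>A continuous extension of \<open>u\<close> from a smaller closed ball, so that the convolution is
    defined on the whole space and the parametric integral over a fixed box can be
    differentiated.\<close>
  define F where "F = u \<circ> closest_point ?C"
  have contF: "continuous_on S F" for S
  proof -
    have "continuous_on S (closest_point ?C)"
      using \<rho>2 by (intro continuous_on_closest_point) auto
    moreover have "closest_point ?C ` S \<subseteq> ?C"
      using \<rho>2 closest_point_in_set[of ?C] by auto
    ultimately show ?thesis
      unfolding F_def using cont CU
      by (intro continuous_on_compose) (auto intro: continuous_on_subset)
  qed
  have F_eq: "F x = u x" if "x \<in> ?C" for x
    using that by (simp add: F_def closest_point_self)
  obtain H where H_meas [measurable]: "H \<in> borel_measurable borel"
    and H_ae: "AE x in lebesgue. H x = indicator ?C x *\<^sub>R \<gamma> x"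
  proof (rule lebesgue_on_borel_representative)
    show "\<gamma> \<in> borel_measurable (lebesgue_on ?C)"
      using \<gamma>_meas CU by (rule measurable_restrict_mono)
  qed auto
  have H_int: "integrable lborel H"
  proof -
    have "integrable (lebesgue_on ?C) (\<lambda>x. norm (\<gamma> x))"
      using CU by (intro \<gamma>_int) auto
    then have "integrable lebesgue (\<lambda>x. indicator ?C x *\<^sub>R norm (\<gamma> x))"
      by (subst (asm) integrable_restrict_space) auto
    then have "integrable lebesgue (\<lambda>x. norm (H x))"
    proof (rule integrable_cong_AE_imp)
      show "AE x in lebesgue. indicator ?C x *\<^sub>R norm (\<gamma> x) = norm (H x)"
        using H_ae by eventually_elim (simp add: indicator_def)
    qed (auto intro!: measurable_completion)
    then have "integrable lebesgue H"
      by (subst (asm) integrable_norm_iff) (auto intro!: measurable_completion)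
    then show ?thesis
      by (simp add: integrable_completion)
  qed
  obtain d1 where d1: "d1 > 0"
    "\<And>h. norm h < d1 \<Longrightarrow> (\<integral>\<^sup>+x. norm (H (x - h) - H x) \<partial>lborel) \<le> ennreal \<eta>"
    using translation_continuous_L1[OF H_int \<eta>] by blast
  obtain d2 where d2: "d2 > 0"
    "\<And>x y. x \<in> ?C \<Longrightarrow> y \<in> ?C \<Longrightarrow> dist y x < d2 \<Longrightarrow> dist (F y) (F x) < \<eta>"
    using compact_uniformly_continuous[OF contF, of ?C] \<eta> unfolding uniformly_continuous_on_def
    by (metis compact_cball)
  \<comment> \<open>The radius of the mollifier: \<open>d1\<close> controls the gradients, \<open>d2\<close> the values, and \<open>\<rho>2 - \<rho>\<close>
    keeps the supports inside the closed ball.\<close>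
  define e where "e = min d1 (min d2 (\<rho>2 - \<rho>))"
  have e: "0 < e" "e \<le> d1" "e \<le> d2" "e \<le> \<rho>2 - \<rho>"
    using d1(1) d2(1) \<rho>2 by (auto simp: e_def)
  have ball_e: "cball x e \<subseteq> ?C" if "x \<in> ball 0 \<rho>" for x
    using that e(4) by (auto simp: cball_subset_cball_iff)
  obtain c where c: "0 < c" "(\<integral>\<^sup>+y. ennreal (bump e (y :: real^'n)) \<partial>lborel) = ennreal c"
    using nn_integral_bump[OF e(1)] by metis
  obtain b where b: "?C \<subseteq> cbox (- b) b"
    using bounded_subset_cbox_symmetric[of ?C] by auto
  define w where "w x = (1 / c) * integral (cbox (- b) b) (\<lambda>t. F t * bump e (x - t))" for x
  define Dw where "Dw x = (1 / c) *\<^sub>R integral (cbox (- b) b) (\<lambda>t. F t *\<^sub>R bump_gradient e (x - t))" for x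
  have cont_g: "continuous_on (UNIV \<times> cbox (- b) b) (\<lambda>(x, t). F t *\<^sub>R bump_gradient e (x - t))"
    unfolding split_def
    by (intro continuous_intros continuous_on_compose2[OF contF[of UNIV]]) auto
  have cont_g1: "continuous_on S (\<lambda>t. F t *\<^sub>R bump_gradient e (x - t))" for S x
    by (intro continuous_intros contF)
  have "(w has_derivative (\<lambda>v. Dw x \<bullet> v)) (at x)" for x
  proof -
    let ?g = "\<lambda>x t. blinfun_inner_right (F t *\<^sub>R bump_gradient e (x - t))"
    have "((\<lambda>x. integral (cbox (- b) b) (\<lambda>t. F t * bump e (x - t))) has_derivative
        blinfun_apply (integral (cbox (- b) b) (?g x))) (at x within UNIV)"
    proof (rule leibniz_rule)
      fix y t :: "real^'n"
      have "((\<lambda>y. bump e (y - t)) has_derivative (\<lambda>v. bump_gradient e (y - t) \<bullet> v)) (at y)"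
        by (rule has_derivative_compose[OF _ bump_has_derivative]) (auto intro!: derivative_eq_intros)
      then have "((\<lambda>y. F t * bump e (y - t)) has_derivative (\<lambda>v. F t * (bump_gradient e (y - t) \<bullet> v))) (at y)"
        by (rule has_derivative_mult_right)
      moreover have "blinfun_apply (?g y t) = (\<lambda>v. F t * (bump_gradient e (y - t) \<bullet> v))"
        by (simp add: fun_eq_iff)
      ultimately show "((\<lambda>y. F t * bump e (y - t)) has_derivative blinfun_apply (?g y t)) (at y within UNIV)"
        by simp
    next
      show "(\<lambda>t. F t * bump e (y - t)) integrable_on cbox (- b) b" for y
        by (intro integrable_continuous continuous_intros contF)
      show "continuous_on (UNIV \<times> cbox (- b) b) (\<lambda>(x, t). ?g x t)"
        using continuous_on_compose2[OF linear_continuous_on[OF bounded_linear_blinfun_inner_right, of UNIV] cont_g]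
        by (simp add: split_def)
    qed auto
    moreover have "integral (cbox (- b) b) (?g x)
        = blinfun_inner_right (integral (cbox (- b) b) (\<lambda>t. F t *\<^sub>R bump_gradient e (x - t)))"
      using integral_linear[OF integrable_continuous[OF cont_g1] bounded_linear_blinfun_inner_right]
      by (simp add: o_def)
    ultimately have "((\<lambda>x. integral (cbox (- b) b) (\<lambda>t. F t * bump e (x - t))) has_derivative
        (\<lambda>v. integral (cbox (- b) b) (\<lambda>t. F t *\<^sub>R bump_gradient e (x - t)) \<bullet> v)) (at x)"
      by simp
    from has_derivative_mult_right[OF this, of "1 / c"] show ?thesis
      by (simp add: w_def[abs_def] Dw_def)
  qed
  moreover have "continuous_on UNIV Dw"
    unfolding Dw_def by (intro continuous_intros integral_continuous_on_param cont_g)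
  moreover have "\<bar>w x - u x\<bar> \<le> \<eta>" if x: "x \<in> ball 0 \<rho>" for x
  proof -
    have xC: "x \<in> ?C"
      using x \<rho>2 by auto
    have bump_int: "(\<lambda>t. k * bump e (x - t)) integrable_on cbox (- b) b" for k
      by (intro integrable_continuous continuous_intros)
    have "integral (cbox (- b) b) (\<lambda>t. bump e (x - t)) = c"
    proof -
      have supp: "bump e (x - t) = 0" if "t \<notin> cbox (- b) b" for t
      proof (rule bump_eq_0[OF e(1)])
        have "t \<notin> cball x e"
          using that b ball_e[OF x] by blast
        then show "e \<le> norm (x - t)"
          by (simp add: dist_norm)
      qed
      have "((\<lambda>t. bump e (x - t)) has_integral integral (cbox (- b) b) (\<lambda>t. bump e (x - t))) UNIV"
        using bump_int[of 1] supp
        by (intro has_integral_on_superset[OF integrable_integral]) simp_all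
      moreover have "(\<lambda>t. bump e (x - t)) \<in> borel_measurable borel"
        by measurable
      ultimately have "ennreal (integral (cbox (- b) b) (\<lambda>t. bump e (x - t))) = (\<integral>\<^sup>+t. ennreal (bump e (x - t)) \<partial>lborel)"
        by (intro nn_integral_has_integral_lborel[symmetric] bump_nonneg)
      also have "\<dots> = ennreal c"
        using nn_integral_lborel_reflect[of "\<lambda>y. ennreal (bump e y)" x] c(2) by simp
      finally show ?thesis
        using c(1) Henstock_Kurzweil_Integration.integral_nonneg[OF bump_int[of 1, simplified]]
        by (subst (asm) ennreal_inj) (auto simp: bump_nonneg)
    qed
    then have "w x - u x = (1 / c) * (integral (cbox (- b) b) (\<lambda>t. F t * bump e (x - t))
        - integral (cbox (- b) b) (\<lambda>t. F x * bump e (x - t)))"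
      using c(1) F_eq[OF xC] by (simp add: w_def field_simps)
    also have "\<dots> = (1 / c) * integral (cbox (- b) b) (\<lambda>t. F t * bump e (x - t) - F x * bump e (x - t))"
      by (subst Henstock_Kurzweil_Integration.integral_diff)
        (auto intro!: integrable_continuous continuous_intros contF)
    finally have "\<bar>w x - u x\<bar> = (1 / c) * norm (integral (cbox (- b) b) (\<lambda>t. F t * bump e (x - t) - F x * bump e (x - t)))"
      using c(1) by (simp add: abs_mult)
    also have "\<dots> \<le> (1 / c) * integral (cbox (- b) b) (\<lambda>t. \<eta> * bump e (x - t))"
    proof (intro mult_left_mono Henstock_Kurzweil_Integration.integral_norm_bound_integral bump_int)
      show "(\<lambda>t. F t * bump e (x - t) - F x * bump e (x - t)) integrable_on cbox (- b) b"
        by (intro integrable_continuous continuous_intros contF)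
      fix t
      show "norm (F t * bump e (x - t) - F x * bump e (x - t)) \<le> \<eta> * bump e (x - t)"
      proof (cases "norm (x - t) < e")
        case True
        then have "t \<in> cball x e"
          by (simp add: dist_norm)
        then have "t \<in> ?C"
          using ball_e[OF x] by blast
        moreover have "dist t x < d2"
          using True e(3) by (simp add: dist_norm norm_minus_commute)
        ultimately have "\<bar>F t - F x\<bar> \<le> \<eta>"
          using d2(2)[OF xC] by (simp add: dist_norm less_imp_le)
        then show ?thesis
          by (simp add: left_diff_distrib[symmetric] abs_mult bump_nonneg mult_right_mono)
      qed (use bump_eq_0[OF e(1), of "x - t"] in auto)
    qed (use c(1) in auto)
    also have "\<dots> = \<eta>"
      using \<open>integral (cbox (- b) b) (\<lambda>t. bump e (x - t)) = c\<close> c(1) by simp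
    finally show ?thesis .
  qed
  moreover have "(\<integral>\<^sup>+x\<in>ball 0 \<rho>. ennreal (norm (Dw x - \<gamma> x)) \<partial>lebesgue) \<le> ennreal \<eta>"
  proof -
    have bump_H_int: "integrable lborel (\<lambda>t. bump e (x - t) *\<^sub>R H t)" for x
    proof (rule Bochner_Integration.integrable_bound[OF H_int])
      show "AE t in lborel. norm (bump e (x - t) *\<^sub>R H t) \<le> norm (H t)"
        by (intro AE_I2) (simp add: bump_nonneg bump_le_1 mult_left_le_one_le)
    qed measurable
    have Dw_eq: "Dw x = (1 / c) *\<^sub>R (\<integral>t. bump e (x - t) *\<^sub>R H t \<partial>lborel)" if x: "x \<in> ball 0 \<rho>" for x
    proof -
      have "integral (cbox (- b) b) (\<lambda>t. F t *\<^sub>R bump_gradient e (x - t)) $ j = (\<integral>t. bump e (x - t) *\<^sub>R H t \<partial>lborel) $ j" for j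
      proof -
        have mj: "(\<lambda>t. (bump e (x - t) *\<^sub>R H t) $ j) \<in> borel_measurable lborel"
          using borel_measurable_integrable[OF bump_H_int[of x]]
          by (rule measurable_compose) (simp add: borel_measurable_continuous_onI continuous_on_component)
        define \<phi> where "\<phi> t = bump e (x - t)" for t
        have test: "\<phi> \<in> test_functions ?U"
          unfolding \<phi>_def using ball_e[OF x] CU by (intro reflected_bump_test_function e(1)) auto
        have d\<phi>: "frechet_derivative \<phi> (at t) (axis j 1) = - bump_gradient e (x - t) $ j" for t
        proof -
          have "(\<phi> has_derivative (\<lambda>v. bump_gradient e (x - t) \<bullet> (- v))) (at t)"
            unfolding \<phi>_def
            by (rule has_derivative_compose[OF _ bump_has_derivative]) (auto intro!: derivative_eq_intros)
          from fun_cong[OF frechet_derivative_at[OF this], of "axis j 1"] show ?thesis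
            by (simp add: inner_axis)
        qed
        have supp: "t \<in> ?C" if "bump e (x - t) \<noteq> 0 \<or> bump_gradient e (x - t) \<noteq> 0" for t
        proof -
          have "\<not> e \<le> norm (x - t)"
            using that bump_eq_0[OF e(1), of "x - t"] bump_gradient_eq_0[OF e(1), of "x - t"] by blast
          then have "t \<in> cball x e"
            by (simp add: dist_norm)
          then show ?thesis
            using ball_e[OF x] by blast
        qed
        have "integral (cbox (- b) b) (\<lambda>t. F t *\<^sub>R bump_gradient e (x - t)) $ j
            = integral (cbox (- b) b) (\<lambda>t. F t * bump_gradient e (x - t) $ j)"
          using integral_linear[OF integrable_continuous[OF cont_g1] bounded_linear_vec_nth]
          by (simp add: o_def)
        also have "\<dots> = (\<integral>t. F t * bump_gradient e (x - t) $ j \<partial>lebesgue_on (cbox (- b) b))"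
          by (rule lebesgue_integral_eq_integral[symmetric])
            (auto intro!: continuous_imp_integrable continuous_intros contF)
        also have "\<dots> = (\<integral>t. u t * bump_gradient e (x - t) $ j \<partial>lebesgue_on ?U)"
        proof -
          have "indicator (cbox (- b) b) t *\<^sub>R (F t * bump_gradient e (x - t) $ j)
              = indicator ?U t *\<^sub>R (u t * bump_gradient e (x - t) $ j)" for t
            using supp[of t] b CU F_eq[of t] by (cases "bump_gradient e (x - t) = 0") (auto simp: indicator_def subset_iff)
          then have "(\<integral>t. indicator (cbox (- b) b) t *\<^sub>R (F t * bump_gradient e (x - t) $ j) \<partial>lebesgue)
              = (\<integral>t. indicator ?U t *\<^sub>R (u t * bump_gradient e (x - t) $ j) \<partial>lebesgue)"
            by (simp only:)
          then show ?thesis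
            by (subst (1 2) integral_restrict_space) (simp, simp, simp only:)
        qed
        also have "\<dots> = - (\<integral>t. u t * frechet_derivative \<phi> (at t) (axis j 1) \<partial>lebesgue_on ?U)"
          by (simp add: d\<phi>)
        also have "\<dots> = (\<integral>t. \<gamma> t $ j * \<phi> t \<partial>lebesgue_on ?U)"
          using weak[OF test, of j] by simp
        also have "\<dots> = (\<integral>t. indicator ?U t *\<^sub>R (\<gamma> t $ j * \<phi> t) \<partial>lebesgue)"
          by (rule integral_restrict_space) simp
        also have "\<dots> = (\<integral>t. (bump e (x - t) *\<^sub>R H t) $ j \<partial>lebesgue)"
        proof (rule integral_cong_AE)
          have "(\<lambda>t. \<gamma> t $ j) \<in> borel_measurable (lebesgue_on ?U)"
            using \<gamma>_meas by (rule measurable_compose) (simp add: borel_measurable_continuous_onI continuous_on_component)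
          moreover have "\<phi> \<in> borel_measurable (lebesgue_on ?U)"
            unfolding \<phi>_def by (intro measurable_restrict_space1 measurable_completion) simp
          ultimately have "(\<lambda>t. \<gamma> t $ j * \<phi> t) \<in> borel_measurable (lebesgue_on ?U)"
            by (rule borel_measurable_times)
          then show "(\<lambda>t. indicator ?U t *\<^sub>R (\<gamma> t $ j * \<phi> t)) \<in> borel_measurable lebesgue"
            by (simp add: borel_measurable_restrict_space_iff)
          show "(\<lambda>t. (bump e (x - t) *\<^sub>R H t) $ j) \<in> borel_measurable lebesgue"
            by (rule measurable_completion[OF mj])
          show "AE t in lebesgue. indicator ?U t *\<^sub>R (\<gamma> t $ j * \<phi> t) = (bump e (x - t) *\<^sub>R H t) $ j"
            using H_ae
          proof eventually_elim
            fix t assume "H t = indicator ?C t *\<^sub>R \<gamma> t"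
            then show "indicator ?U t *\<^sub>R (\<gamma> t $ j * \<phi> t) = (bump e (x - t) *\<^sub>R H t) $ j"
              using supp[of t] CU by (cases "bump e (x - t) = 0") (auto simp: \<phi>_def indicator_def)
          qed
        qed
        also have "\<dots> = (\<integral>t. (bump e (x - t) *\<^sub>R H t) $ j \<partial>lborel)"
          by (rule integral_completion[OF mj])
        also have "\<dots> = (\<integral>t. bump e (x - t) *\<^sub>R H t \<partial>lborel) $ j"
          using integral_bounded_linear[OF bounded_linear_vec_nth bump_H_int] .
        finally show ?thesis .
      qed
      then show ?thesis
        by (simp add: Dw_def vec_eq_iff)
    qed
    have ptw: "ennreal (norm (Dw x - H x)) \<le> ennreal (1 / c) * (\<integral>\<^sup>+h. ennreal (bump e h) * ennreal (norm (H (x - h) - H x)) \<partial>lborel)"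
      if x: "x \<in> ball 0 \<rho>" for x
    proof -
      have bump_int: "integrable lborel (\<lambda>t. bump e (x - t))"
        using nn_integral_lborel_reflect[of "\<lambda>y. ennreal (bump e y)" x] c(2)
        by (intro integrableI_bounded) (auto simp: bump_nonneg)
      have int1: "(\<integral>t. bump e (x - t) \<partial>lborel) = c"
        using nn_integral_lborel_reflect[of "\<lambda>y. ennreal (bump e y)" x] c
        by (subst integral_eq_nn_integral) (auto simp: bump_nonneg)
      have "(\<integral>t. bump e (x - t) *\<^sub>R (H t - H x) \<partial>lborel) = (\<integral>t. bump e (x - t) *\<^sub>R H t \<partial>lborel) - c *\<^sub>R H x"
        using bump_H_int[of x] bump_int by (simp add: scaleR_diff_right int1)
      then have "Dw x - H x = (1 / c) *\<^sub>R (\<integral>t. bump e (x - t) *\<^sub>R (H t - H x) \<partial>lborel)"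
        using c(1) by (simp add: Dw_eq[OF x] scaleR_diff_right)
      then have "ennreal (norm (Dw x - H x)) = ennreal (1 / c) * ennreal (norm (\<integral>t. bump e (x - t) *\<^sub>R (H t - H x) \<partial>lborel))"
        using c(1) by (simp add: ennreal_mult[symmetric])
      also have "\<dots> \<le> ennreal (1 / c) * (\<integral>\<^sup>+t. norm (bump e (x - t) *\<^sub>R (H t - H x)) \<partial>lborel)"
        using bump_H_int[of x] bump_int
        by (intro mult_left_mono integral_norm_bound_ennreal) (auto simp: scaleR_diff_right)
      also have "(\<integral>\<^sup>+t. norm (bump e (x - t) *\<^sub>R (H t - H x)) \<partial>lborel)
          = (\<integral>\<^sup>+h. norm (bump e h *\<^sub>R (H (x - h) - H x)) \<partial>lborel)"
        using nn_integral_lborel_reflect[of "\<lambda>h. ennreal (norm (bump e h *\<^sub>R (H (x - h) - H x)))" x] by simp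
      also have "\<dots> = (\<integral>\<^sup>+h. ennreal (bump e h) * ennreal (norm (H (x - h) - H x)) \<partial>lborel)"
        by (simp add: bump_nonneg ennreal_mult)
      finally show ?thesis .
    qed
    have "(\<integral>\<^sup>+x\<in>ball 0 \<rho>. ennreal (norm (Dw x - \<gamma> x)) \<partial>lebesgue)
        = (\<integral>\<^sup>+x\<in>ball 0 \<rho>. ennreal (norm (Dw x - H x)) \<partial>lebesgue)"
    proof (rule nn_integral_cong_AE)
      show "AE x in lebesgue. ennreal (norm (Dw x - \<gamma> x)) * indicator (ball 0 \<rho>) x
          = ennreal (norm (Dw x - H x)) * indicator (ball 0 \<rho>) x"
        using H_ae
      proof eventually_elim
        fix x assume "H x = indicator ?C x *\<^sub>R \<gamma> x"
        then show "ennreal (norm (Dw x - \<gamma> x)) * indicator (ball 0 \<rho>) x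
          = ennreal (norm (Dw x - H x)) * indicator (ball 0 \<rho>) x"
          using \<rho>2(1) by (auto simp: indicator_def)
      qed
    qed
    also have "\<dots> = (\<integral>\<^sup>+x\<in>ball 0 \<rho>. ennreal (norm (Dw x - H x)) \<partial>lborel)"
      by (rule nn_integral_completion)
    also have "\<dots> \<le> (\<integral>\<^sup>+x. ennreal (1 / c) * (\<integral>\<^sup>+h. ennreal (bump e h) * ennreal (norm (H (x - h) - H x)) \<partial>lborel) \<partial>lborel)"
      using ptw by (intro nn_integral_mono) (auto simp: indicator_def)
    also have "\<dots> = ennreal (1 / c) * (\<integral>\<^sup>+x. (\<integral>\<^sup>+h. ennreal (bump e h) * ennreal (norm (H (x - h) - H x)) \<partial>lborel) \<partial>lborel)"
      by (rule nn_integral_cmult) measurable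
    also have "(\<integral>\<^sup>+x. (\<integral>\<^sup>+h. ennreal (bump e h) * ennreal (norm (H (x - h) - H x)) \<partial>lborel) \<partial>lborel)
        = (\<integral>\<^sup>+h. (\<integral>\<^sup>+x. ennreal (bump e h) * ennreal (norm (H (x - h) - H x)) \<partial>lborel) \<partial>lborel)"
      by (rule lborel_pair.Fubini') measurable
    also have "\<dots> \<le> (\<integral>\<^sup>+h. ennreal (bump e (h :: real^'n)) * ennreal \<eta> \<partial>lborel)"
    proof (rule nn_integral_mono)
      fix h :: "real^'n"
      have "(\<integral>\<^sup>+x. ennreal (bump e h) * ennreal (norm (H (x - h) - H x)) \<partial>lborel)
          = ennreal (bump e h) * (\<integral>\<^sup>+x. ennreal (norm (H (x - h) - H x)) \<partial>lborel)"
        by (rule nn_integral_cmult) measurable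
      also have "\<dots> \<le> ennreal (bump e h) * ennreal \<eta>"
      proof (cases "norm h < e")
        case True
        then show ?thesis
          using d1(2)[of h] e(2) by (intro mult_left_mono) auto
      qed (use bump_eq_0[OF e(1), of h] in auto)
      finally show "(\<integral>\<^sup>+x. ennreal (bump e h) * ennreal (norm (H (x - h) - H x)) \<partial>lborel)
          \<le> ennreal (bump e h) * ennreal \<eta>" .
    qed
    also have "\<dots> = ennreal c * ennreal \<eta>"
      by (simp add: nn_integral_multc c(2))
    finally show ?thesis
      using c(1) \<eta> by (simp add: ennreal_mult'[symmetric] mult_left_mono)
  qed
  ultimately show ?thesis
    by blast
qed

section \<open>Pointwise oscillation and the maximal function\<close>

lemma nn_integral_lborel_dilate:
  fixes f :: "'a::euclidean_space \<Rightarrow> ennreal"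
  assumes [measurable]: "f \<in> borel_measurable borel" and t: "0 < t"
  shows "ennreal (t ^ DIM('a)) * (\<integral>\<^sup>+z. f (a + t *\<^sub>R z) \<partial>lborel) = (\<integral>\<^sup>+y. f y \<partial>lborel)"
proof -
  have "(\<integral>\<^sup>+y. f y \<partial>lborel) = (\<integral>\<^sup>+y. f y \<partial>density (distr lborel borel (\<lambda>z. a + t *\<^sub>R z)) (\<lambda>_. ennreal (t ^ DIM('a))))"
    using lborel_affine[of t a] t by simp
  also have "\<dots> = (\<integral>\<^sup>+y. ennreal (t ^ DIM('a)) * f y \<partial>distr lborel borel (\<lambda>z. a + t *\<^sub>R z))"
    by (rule nn_integral_density) auto
  also have "\<dots> = (\<integral>\<^sup>+z. ennreal (t ^ DIM('a)) * f (a + t *\<^sub>R z) \<partial>lborel)"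
    by (rule nn_integral_distr) auto
  also have "\<dots> = ennreal (t ^ DIM('a)) * (\<integral>\<^sup>+z. f (a + t *\<^sub>R z) \<partial>lborel)"
    by (rule nn_integral_cmult) measurable
  finally show ?thesis ..
qed

lemma increment_le_nn_integral_gradient:
  fixes w :: "'a::euclidean_space \<Rightarrow> real"
  assumes der: "\<And>x. (w has_derivative (\<lambda>v. Dw x \<bullet> v)) (at x)" and cont: "continuous_on UNIV Dw"
  shows "ennreal \<bar>w x - w z\<bar> \<le> (\<integral>\<^sup>+t\<in>{0<..1}. ennreal (norm (Dw (x + t *\<^sub>R (z - x))) * norm (z - x)) \<partial>lborel)"
proof -
  let ?g = "\<lambda>t. Dw (x + t *\<^sub>R (z - x)) \<bullet> (z - x)"
  let ?n = "\<lambda>t. norm (Dw (x + t *\<^sub>R (z - x))) * norm (z - x)"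
  have cont_n: "continuous_on {0..1} ?n"
    by (intro continuous_intros continuous_on_compose2[OF cont]) auto
  have "(?g has_integral w (x + 1 *\<^sub>R (z - x)) - w (x + 0 *\<^sub>R (z - x))) {0..1}"
  proof (rule fundamental_theorem_of_calculus)
    fix t :: real
    have "((\<lambda>t. x + t *\<^sub>R (z - x)) has_derivative (\<lambda>s. s *\<^sub>R (z - x))) (at t within {0..1})"
      by (auto intro!: derivative_eq_intros)
    from has_derivative_compose[OF this der]
    show "((\<lambda>t. w (x + t *\<^sub>R (z - x))) has_vector_derivative ?g t) (at t within {0..1})"
      by (simp add: has_vector_derivative_def)
  qed simp
  then have "\<bar>w x - w z\<bar> = norm (integral {0..1} ?g)" and int_g: "?g integrable_on {0..1}"
    by (simp_all add: has_integral_iff abs_minus_commute)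
  moreover have "norm (integral {0..1} ?g) \<le> integral {0..1} ?n"
  proof (rule Henstock_Kurzweil_Integration.integral_norm_bound_integral[OF int_g])
    show "?n integrable_on {0..1}"
      using cont_n by (rule integrable_continuous_real)
    show "norm (?g t) \<le> ?n t" for t
      unfolding real_norm_def by (rule Cauchy_Schwarz_ineq2)
  qed
  ultimately have "\<bar>w x - w z\<bar> \<le> integral {0..1} ?n"
    by simp
  then have "ennreal \<bar>w x - w z\<bar> \<le> ennreal (integral {0..1} ?n)"
    by (rule ennreal_leI)
  also have "\<dots> = (\<integral>\<^sup>+t. ennreal (indicator {0..1} t * ?n t) \<partial>lborel)"
    using nn_integral_has_integral_lebesgue[OF _ integrable_integral[OF integrable_continuous_real[OF cont_n]]]
    by simp
  also have "\<dots> = (\<integral>\<^sup>+t\<in>{0<..1}. ennreal (?n t) \<partial>lborel)"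
  proof (rule nn_integral_cong_AE)
    show "AE t in lborel. ennreal (indicator {0..1} t * ?n t) = ennreal (?n t) * indicator {0<..1} t"
      using AE_lborel_singleton[of "0::real"] by eventually_elim (auto simp: indicator_def)
  qed
  finally show ?thesis .
qed

text \<open>Integrate the gradient along the segments from \<open>x\<close>. Exchanging the integrals and scaling by
\<open>t\<close> about \<open>x\<close> turns the slice at parameter \<open>t\<close> into a mean of \<open>|Dw|\<close> over the ball of radius
\<open>t r\<close>, which the hypothesis controls uniformly in \<open>t\<close>.\<close>

lemma nn_integral_oscillation_le:
  fixes w :: "'a::euclidean_space \<Rightarrow> real"
  assumes der: "\<And>x. (w has_derivative (\<lambda>v. Dw x \<bullet> v)) (at x)" and cont: "continuous_on UNIV Dw"
    and r: "0 < r" and m: "0 \<le> m"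
    and bound: "\<And>s. 0 < s \<Longrightarrow> s \<le> r \<Longrightarrow> (\<integral>\<^sup>+z\<in>ball x s. ennreal (norm (Dw z)) \<partial>lborel) \<le> ennreal (m * s ^ DIM('a))"
  shows "(\<integral>\<^sup>+z\<in>ball x r. ennreal \<bar>w x - w z\<bar> \<partial>lborel) \<le> ennreal (m * r ^ DIM('a) * r)"
proof -
  have [measurable]: "Dw \<in> borel_measurable borel"
    using cont by (rule borel_measurable_continuous_onI)
  have [measurable]: "ball x r \<in> sets borel"
    by simp
  let ?f = "\<lambda>z t. indicator (ball x r) z * (ennreal r * (ennreal (norm (Dw (x + t *\<^sub>R (z - x)))) * indicator {0<..1} t))"
  have "(\<integral>\<^sup>+z\<in>ball x r. ennreal \<bar>w x - w z\<bar> \<partial>lborel) \<le> (\<integral>\<^sup>+z. (\<integral>\<^sup>+t. ?f z t \<partial>lborel) \<partial>lborel)"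
  proof (rule nn_integral_mono)
    fix z
    show "ennreal \<bar>w x - w z\<bar> * indicator (ball x r) z \<le> (\<integral>\<^sup>+t. ?f z t \<partial>lborel)"
    proof (cases "z \<in> ball x r")
      case True
      then have "norm (z - x) \<le> r"
        by (simp add: dist_norm norm_minus_commute)
      then have "(\<integral>\<^sup>+t\<in>{0<..1}. ennreal (norm (Dw (x + t *\<^sub>R (z - x))) * norm (z - x)) \<partial>lborel) \<le> (\<integral>\<^sup>+t. ?f z t \<partial>lborel)"
      proof (intro nn_integral_mono)
        fix t :: real
        have "ennreal (norm (Dw (x + t *\<^sub>R (z - x))) * norm (z - x)) \<le> ennreal (r * norm (Dw (x + t *\<^sub>R (z - x))))"
          using \<open>norm (z - x) \<le> r\<close> by (intro ennreal_leI) (simp add: mult.commute[of _ "norm (z - x)"] mult_right_mono)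
        then show "ennreal (norm (Dw (x + t *\<^sub>R (z - x))) * norm (z - x)) * indicator {0<..1} t \<le> ?f z t"
          using True r by (simp add: ennreal_mult indicator_def)
      qed
      with increment_le_nn_integral_gradient[OF der cont, of x z] show ?thesis
        using True by (simp only: indicator_simps mult_1_right)
    qed simp
  qed
  also have "\<dots> = (\<integral>\<^sup>+t. (\<integral>\<^sup>+z. ?f z t \<partial>lborel) \<partial>lborel)"
    by (rule lborel_pair.Fubini') measurable
  also have "\<dots> \<le> (\<integral>\<^sup>+t. ennreal (m * r ^ DIM('a) * r) * indicator {0<..1::real} t \<partial>lborel)"
  proof (rule nn_integral_mono)
    fix t :: real
    show "(\<integral>\<^sup>+z. ?f z t \<partial>lborel) \<le> ennreal (m * r ^ DIM('a) * r) * indicator {0<..1} t"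
    proof (cases "t \<in> {0<..1}")
      case True
      define I where "I = (\<integral>\<^sup>+z. indicator (ball x r) z * ennreal (norm (Dw (x + t *\<^sub>R (z - x)))) \<partial>lborel)"
      have ind: "indicator (ball x (t * r)) (x + t *\<^sub>R (z - x)) = (indicator (ball x r) z :: ennreal)" for z
        using True by (simp add: indicator_def dist_norm norm_minus_commute)
      have "ball x (t * r) \<in> sets borel"
        by simp
      then have "(\<lambda>z. ennreal (norm (Dw z)) * indicator (ball x (t * r)) z) \<in> borel_measurable borel"
        by measurable
      then have "ennreal (t ^ DIM('a)) * I = (\<integral>\<^sup>+z\<in>ball x (t * r). ennreal (norm (Dw z)) \<partial>lborel)"
        using nn_integral_lborel_dilate[of "\<lambda>z. ennreal (norm (Dw z)) * indicator (ball x (t * r)) z" t "x - t *\<^sub>R x"] True ind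
        by (simp add: I_def algebra_simps)
      also have "\<dots> \<le> ennreal (m * (t * r) ^ DIM('a))"
        using True r by (intro bound) (auto simp: mult_left_le_one_le)
      also have "\<dots> = ennreal (t ^ DIM('a)) * ennreal (m * r ^ DIM('a))"
        using True m r by (simp add: ennreal_mult[symmetric] power_mult_distrib mult_ac)
      finally have "I \<le> ennreal (m * r ^ DIM('a))"
        using True by (subst (asm) ennreal_mult_le_mult_iff) auto
      then have I_le: "ennreal r * I \<le> ennreal r * ennreal (m * r ^ DIM('a))"
        by (rule mult_left_mono) simp
      have "(\<integral>\<^sup>+z. ?f z t \<partial>lborel) = ennreal r * I"
        unfolding I_def by (subst nn_integral_cmult[symmetric]) (use True in \<open>auto simp: mult_ac intro!: nn_integral_cong\<close>)
      also note I_le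
      also have "ennreal r * ennreal (m * r ^ DIM('a)) = ennreal (m * r ^ DIM('a) * r) * indicator {0<..1} t"
        using True m r by (simp add: ennreal_mult[symmetric] mult_ac)
      finally show ?thesis .
    qed simp
  qed
  also have "\<dots> = ennreal (m * r ^ DIM('a) * r)"
    by (subst nn_integral_cmult_indicator) auto
  finally show ?thesis .
qed

text \<open>Compare both values with those of \<open>w\<close> on the ball of radius \<open>r / 2\<close> around the midpoint;
that ball lies in both balls of radius \<open>r = |x - y|\<close>.\<close>

lemma two_point_oscillation_le:
  fixes w :: "'a::euclidean_space \<Rightarrow> real"
  assumes der: "\<And>x. (w has_derivative (\<lambda>v. Dw x \<bullet> v)) (at x)" and cont: "continuous_on UNIV Dw"
    and xy: "x \<noteq> y" and m: "0 \<le> m"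
    and bound: "\<And>p s. p \<in> {x, y} \<Longrightarrow> 0 < s \<Longrightarrow> s \<le> dist x y \<Longrightarrow>
        (\<integral>\<^sup>+z\<in>ball p s. ennreal (norm (Dw z)) \<partial>lborel) \<le> ennreal (m * s ^ DIM('a))"
  shows "\<bar>w x - w y\<bar> \<le> 2 ^ (DIM('a) + 1) / measure lborel (ball (0::'a) 1) * m * dist x y"
proof -
  define r where "r = dist x y"
  define V where "V = measure lborel (ball (0::'a) 1)"
  have r: "0 < r" and V: "0 < V"
    using xy content_ball_pos[of 1 "0::'a"] by (auto simp: r_def V_def)
  define B where "B = ball (midpoint x y) (r / 2)"
  have B: "B \<subseteq> ball p r" if "p \<in> {x, y}" for p
  proof
    fix z assume "z \<in> B"
    moreover have "dist p (midpoint x y) = r / 2"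
      using that by (auto simp: dist_midpoint r_def)
    ultimately show "z \<in> ball p r"
      using dist_triangle[of p z "midpoint x y"] by (simp add: B_def)
  qed
  have [measurable]: "w \<in> borel_measurable borel"
    using has_derivative_continuous[OF der]
    by (intro borel_measurable_continuous_onI continuous_at_imp_continuous_on) blast
  have mB: "emeasure lborel B = ennreal (V * (r / 2) ^ DIM('a))"
    using r content_ball_conv_unit_ball[of "r / 2" "midpoint x y"] emeasure_lborel_ball_finite[of "midpoint x y" "r / 2"]
    by (simp add: B_def V_def emeasure_eq_ennreal_measure mult.commute)
  have [measurable]: "ball x r \<in> sets borel" "ball y r \<in> sets borel"
    by simp_all
  have int: "(\<integral>\<^sup>+z\<in>ball p r. ennreal \<bar>w p - w z\<bar> \<partial>lborel) \<le> ennreal (m * r ^ DIM('a) * r)" if "p \<in> {x, y}" for p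
    by (rule nn_integral_oscillation_le[OF der cont r m bound[OF that]]) (auto simp: r_def)
  have "ennreal (\<bar>w x - w y\<bar> * (V * (r / 2) ^ DIM('a))) = (\<integral>\<^sup>+z. ennreal \<bar>w x - w y\<bar> * indicator B z \<partial>lborel)"
    using V r by (subst nn_integral_cmult_indicator) (simp_all add: mB ennreal_mult, simp add: B_def)
  also have "\<dots> \<le> (\<integral>\<^sup>+z. ennreal \<bar>w x - w z\<bar> * indicator (ball x r) z + ennreal \<bar>w y - w z\<bar> * indicator (ball y r) z \<partial>lborel)"
  proof (rule nn_integral_mono)
    fix z
    have "ennreal \<bar>w x - w y\<bar> \<le> ennreal \<bar>w x - w z\<bar> + ennreal \<bar>w y - w z\<bar>"
      by (simp add: ennreal_plus[symmetric] ennreal_leI del: ennreal_plus)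
    then show "ennreal \<bar>w x - w y\<bar> * indicator B z
        \<le> ennreal \<bar>w x - w z\<bar> * indicator (ball x r) z + ennreal \<bar>w y - w z\<bar> * indicator (ball y r) z"
      using B[of x] B[of y] by (cases "z \<in> B") (auto simp: subset_iff)
  qed
  also have "\<dots> = (\<integral>\<^sup>+z\<in>ball x r. ennreal \<bar>w x - w z\<bar> \<partial>lborel) + (\<integral>\<^sup>+z\<in>ball y r. ennreal \<bar>w y - w z\<bar> \<partial>lborel)"
    by (rule nn_integral_add) measurable
  also have "\<dots> \<le> ennreal (m * r ^ DIM('a) * r) + ennreal (m * r ^ DIM('a) * r)"
    by (intro add_mono int) auto
  also have "\<dots> = ennreal (2 * (m * r ^ DIM('a) * r))"
    using m r by (simp add: ennreal_plus[symmetric] del: ennreal_plus)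
  finally have "\<bar>w x - w y\<bar> * (V * (r / 2) ^ DIM('a)) \<le> 2 * (m * r ^ DIM('a) * r)"
    using m r by (subst (asm) ennreal_le_iff) auto
  then show ?thesis
    using V r by (simp add: V_def[symmetric] r_def[symmetric] power_divide field_simps)
qed


text \<open>A superlevel set of the maximal function of \<open>g\<close> restricted to radii at most \<open>R\<close>, up to the
volume of the unit ball as a normalising factor.\<close>

definition ball_mean_exceeds :: "('a::euclidean_space \<Rightarrow> ennreal) \<Rightarrow> real \<Rightarrow> real \<Rightarrow> 'a set" where
  "ball_mean_exceeds g R k =
     {x. \<exists>r. 0 < r \<and> r \<le> R \<and> ennreal (k * r ^ DIM('a)) < (\<integral>\<^sup>+z\<in>ball x r. g z \<partial>lebesgue)}"

text \<open>If the integral over \<open>ball x r\<close> is too large, then so is the integral over a slightly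
smaller concentric ball, and the latter lies in \<open>ball y r\<close> for all \<open>y\<close> near \<open>x\<close>.\<close>

lemma open_ball_mean_exceeds:
  fixes g :: "'a::euclidean_space \<Rightarrow> ennreal"
  assumes [measurable]: "g \<in> borel_measurable lebesgue"
  shows "open (ball_mean_exceeds g R k)"
  unfolding open_contains_ball
proof
  fix x assume "x \<in> ball_mean_exceeds g R k"
  then obtain r where r: "0 < r" "r \<le> R" "ennreal (k * r ^ DIM('a)) < (\<integral>\<^sup>+z\<in>ball x r. g z \<partial>lebesgue)"
    unfolding ball_mean_exceeds_def by blast
  define \<nu> where "\<nu> = density lebesgue g"
  have \<nu>: "emeasure \<nu> (ball y s) = (\<integral>\<^sup>+z\<in>ball y s. g z \<partial>lebesgue)" for y s
    by (simp add: \<nu>_def emeasure_density)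
  define s where "s i = r - r / (real i + 1)" for i
  have s: "s i < r" for i
    using r(1) by (simp add: s_def)
  have "(\<Union>i. ball x (s i)) = ball x r"
  proof (intro equalityI subsetI)
    fix z assume "z \<in> ball x r"
    then have "0 < (r - dist x z) / r"
      using r(1) by simp
    then obtain i where "1 / (real i + 1) < (r - dist x z) / r"
      using nat_approx_posE[of "(r - dist x z) / r"] by (metis add.commute of_nat_Suc)
    then have "r / (real i + 1) < r - dist x z"
      using r(1) by (simp add: field_simps)
    then show "z \<in> (\<Union>i. ball x (s i))"
      by (auto simp: s_def intro!: exI[of _ i])
  next
    fix z assume "z \<in> (\<Union>i. ball x (s i))"
    then show "z \<in> ball x r"
      using s less_trans by auto
  qed
  moreover have "(\<lambda>i. emeasure \<nu> (ball x (s i))) \<longlonglongrightarrow> emeasure \<nu> (\<Union>i. ball x (s i))"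
  proof (rule Lim_emeasure_incseq)
    have "s i \<le> s j" if "i \<le> j" for i j
      using that r(1) by (simp add: s_def frac_le)
    then show "incseq (\<lambda>i. ball x (s i))"
      by (intro monoI subset_ball)
  qed (auto simp: \<nu>_def)
  ultimately have "(\<lambda>i. emeasure \<nu> (ball x (s i))) \<longlonglongrightarrow> (\<integral>\<^sup>+z\<in>ball x r. g z \<partial>lebesgue)"
    by (simp only: \<nu>)
  then have "\<forall>\<^sub>F i in sequentially. ennreal (k * r ^ DIM('a)) < emeasure \<nu> (ball x (s i))"
    using r(3) by (rule order_tendstoD(1))
  then obtain i where i: "ennreal (k * r ^ DIM('a)) < emeasure \<nu> (ball x (s i))"
    using eventually_happens'[OF sequentially_bot] by blast
  have "y \<in> ball_mean_exceeds g R k" if y: "y \<in> ball x (r - s i)" for y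
  proof -
    have "ball x (s i) \<subseteq> ball y r"
    proof
      fix z assume "z \<in> ball x (s i)"
      then show "z \<in> ball y r"
        using y dist_triangle3[of y z x] by (simp add: dist_commute)
    qed
    then have "emeasure \<nu> (ball x (s i)) \<le> emeasure \<nu> (ball y r)"
      by (intro emeasure_mono) (auto simp: \<nu>_def)
    then show ?thesis
      using i r by (auto simp: ball_mean_exceeds_def \<nu> intro!: exI[of _ r] elim: less_le_trans)
  qed
  then show "\<exists>e>0. ball x e \<subseteq> ball_mean_exceeds g R k"
    using s[of i] by (intro exI[of _ "r - s i"]) auto
qed

text \<open>The weak type estimate for the maximal function: by Vitali's covering lemma, disjoint balls
with a large integral of \<open>g\<close> cover the set when enlarged five times.\<close>

lemma emeasure_ball_mean_exceeds_le:
  fixes g :: "'a::euclidean_space \<Rightarrow> ennreal"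
  assumes [measurable]: "g \<in> borel_measurable lebesgue" and k: "0 < k"
  shows "emeasure lebesgue (ball_mean_exceeds g R k)
      \<le> ennreal (5 ^ DIM('a) * measure lborel (ball (0::'a) 1) / k) * (\<integral>\<^sup>+z. g z \<partial>lebesgue)"
proof -
  let ?E = "ball_mean_exceeds g R k"
  define V where "V = measure lborel (ball (0::'a) 1)"
  have V: "0 < V"
    using content_ball_pos[of 1 "0::'a"] by (simp add: V_def)
  define \<nu> where "\<nu> = density lebesgue g"
  have \<nu>: "emeasure \<nu> (ball y s) = (\<integral>\<^sup>+z\<in>ball y s. g z \<partial>lebesgue)" for y s
    by (simp add: \<nu>_def emeasure_density)
  have "\<forall>x\<in>?E. \<exists>s. 0 < s \<and> s \<le> R \<and> ennreal (k * s ^ DIM('a)) < emeasure \<nu> (ball x s)"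
    unfolding ball_mean_exceeds_def \<nu> by blast
  then obtain r where r: "\<And>x. x \<in> ?E \<Longrightarrow> 0 < r x \<and> r x \<le> R \<and> ennreal (k * r x ^ DIM('a)) < emeasure \<nu> (ball x (r x))"
    using bchoice[of ?E "\<lambda>x s. 0 < s \<and> s \<le> R \<and> ennreal (k * s ^ DIM('a)) < emeasure \<nu> (ball x s)"] by blast
  have cover: "?E \<subseteq> (\<Union>x\<in>?E. ball x (r x))"
  proof
    fix x assume "x \<in> ?E"
    then show "x \<in> (\<Union>x\<in>?E. ball x (r x))"
      using r by (intro UN_I[of x]) auto
  qed
  have r': "0 < r x \<and> r x \<le> R" if "x \<in> ?E" for x
    using r[OF that] by blast
  obtain C where C: "countable C" "C \<subseteq> ?E" "pairwise (\<lambda>i j. disjnt (ball i (r i)) (ball j (r j))) C"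
      "?E \<subseteq> (\<Union>i\<in>C. ball i (5 * r i))"
    by (rule Vitali_covering_lemma_balls[OF cover r']) (assumption, rule that)
  define A where "A s i = (if i \<in> to_nat_on C ` C then ball (from_nat_into C i) (s * r (from_nat_into C i)) else {})"
    for s :: real and i :: nat
  have A_sets: "A s i \<in> sets lebesgue" for s i
    by (simp add: A_def)
  have to_nat: "to_nat_on C (from_nat_into C i) = i" "from_nat_into C i \<in> C" if "i \<in> to_nat_on C ` C" for i
    using that C(1) by auto
  have le: "emeasure lebesgue (A 5 i) \<le> ennreal (5 ^ DIM('a) * V / k) * emeasure \<nu> (A 1 i)" for i
  proof (cases "i \<in> to_nat_on C ` C")
    case True
    define x where "x = from_nat_into C i"
    have x: "x \<in> ?E"
      using to_nat(2)[OF True] C(2) by (auto simp: x_def)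
    have "emeasure lebesgue (A 5 i) = ennreal (V * (5 * r x) ^ DIM('a))"
      using True r[OF x] content_ball_conv_unit_ball[of "5 * r x" x] emeasure_lborel_ball_finite[of x "5 * r x"]
      by (simp add: A_def x_def[symmetric] V_def emeasure_eq_ennreal_measure mult.commute)
    also have "\<dots> = ennreal (5 ^ DIM('a) * V / k) * ennreal (k * r x ^ DIM('a))"
      using V k r[OF x] by (simp add: ennreal_mult[symmetric] power_mult_distrib)
    also have "\<dots> \<le> ennreal (5 ^ DIM('a) * V / k) * emeasure \<nu> (A 1 i)"
      using True r[OF x] by (intro mult_left_mono) (auto simp: A_def x_def[symmetric])
    finally show ?thesis .
  qed (simp add: A_def)
  have "?E \<subseteq> (\<Union>i. A 5 i)"
  proof
    fix y assume "y \<in> ?E"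
    then obtain x where x: "x \<in> C" "y \<in> ball x (5 * r x)"
      using C(4) by blast
    then have "y \<in> A 5 (to_nat_on C x)"
      using C(1) by (simp add: A_def)
    then show "y \<in> (\<Union>i. A 5 i)"
      by blast
  qed
  then have "emeasure lebesgue ?E \<le> emeasure lebesgue (\<Union>i. A 5 i)"
    using A_sets by (intro emeasure_mono sets.countable_UN) auto
  also have "\<dots> \<le> (\<Sum>i. emeasure lebesgue (A 5 i))"
    using A_sets by (intro emeasure_subadditive_countably) auto
  also have "\<dots> \<le> (\<Sum>i. ennreal (5 ^ DIM('a) * V / k) * emeasure \<nu> (A 1 i))"
    by (intro suminf_le le summableI)
  also have "\<dots> = ennreal (5 ^ DIM('a) * V / k) * (\<Sum>i. emeasure \<nu> (A 1 i))"
    by simp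
  also have "(\<Sum>i. emeasure \<nu> (A 1 i)) = emeasure \<nu> (\<Union>i. A 1 i)"
  proof (rule suminf_emeasure)
    show "range (A 1) \<subseteq> sets \<nu>"
      by (auto simp: A_def \<nu>_def)
    show "disjoint_family (A 1)"
      unfolding disjoint_family_on_def
    proof (intro ballI impI)
      fix i j :: nat assume ij: "i \<noteq> j"
      show "A 1 i \<inter> A 1 j = {}"
      proof (cases "i \<in> to_nat_on C ` C \<and> j \<in> to_nat_on C ` C")
        case True
        then have "from_nat_into C i \<noteq> from_nat_into C j"
          using ij to_nat(1) by metis
        then show ?thesis
          using True to_nat(2) C(3) by (auto simp: A_def pairwise_def disjnt_def)
      qed (auto simp: A_def)
    qed
  qed
  also have "\<dots> \<le> emeasure \<nu> (space \<nu>)"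
    by (rule emeasure_space)
  also have "\<dots> = (\<integral>\<^sup>+z. g z \<partial>lebesgue)"
    by (simp add: \<nu>_def emeasure_density)
  finally show ?thesis
    by (simp add: V_def mult_left_mono)
qed

section \<open>Differentiability of Sobolev functions on large sets\<close>

lemma suminf_ennreal_geometric:
  "(\<Sum>j. ennreal (2 ^ j) * ennreal ((1/4) ^ j)) = 2"
proof -
  have "(\<Sum>j. ennreal (2 ^ j) * ennreal ((1/4) ^ j)) = (\<Sum>j. ennreal ((1/2) ^ j))"
    by (simp add: ennreal_mult[symmetric] power_mult_distrib[symmetric])
  also have "\<dots> = ennreal (\<Sum>j. (1/2) ^ j)"
    by (intro suminf_ennreal2 summable_geometric) auto
  also have "\<dots> = 2"
    by (simp add: suminf_geometric)
  finally show ?thesis .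
qed

text \<open>Choose mollifications with \<open>\<integral> |Dw\<^sub>j - \<gamma>| \<le> 4^(-j)\<close>, so that \<open>g = \<Sum>\<^sub>j 2^j |Dw\<^sub>j - \<gamma>|\<close> is
integrable. On the set where \<open>g\<close> and its maximal function are at most about \<open>k\<close>, the
differences \<open>w\<^sub>i - w\<^sub>j\<close> have Lipschitz constant of order \<open>k (2^(-i) + 2^(-j))\<close>. Letting \<open>i\<close>
tend to infinity, \<open>u - w\<^sub>j\<close> has Lipschitz constant of order \<open>k 2^(-j)\<close> there, while \<open>Dw\<^sub>j x\<close>
tends to \<open>\<gamma> x\<close>; thus \<open>\<gamma> x\<close> is the derivative.\<close>

lemma weak_gradient_differentiable_pieces:
  fixes u :: "real^'n \<Rightarrow> real" and \<gamma> :: "real^'n \<Rightarrow> real^'n"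
  assumes cont: "continuous_on (ball 0 1) u"
    and \<gamma>_meas: "\<gamma> \<in> borel_measurable (lebesgue_on (ball 0 1))"
    and \<gamma>_int: "\<And>S. compact S \<Longrightarrow> S \<subseteq> ball 0 1 \<Longrightarrow> integrable (lebesgue_on S) (\<lambda>x. norm (\<gamma> x))"
    and weak: "\<And>\<phi> j. \<phi> \<in> test_functions (ball 0 1) \<Longrightarrow>
        (\<integral>x. u x * frechet_derivative \<phi> (at x) (axis j 1) \<partial>lebesgue_on (ball 0 1)) =
        - (\<integral>x. \<gamma> x $ j * \<phi> x \<partial>lebesgue_on (ball 0 1))"
    and \<rho>: "0 < \<rho>" "\<rho> < 1"
  shows "\<exists>S :: nat \<Rightarrow> (real^'n) set. incseq S \<and> (\<forall>k. S k \<in> sets lebesgue) \<and> negligible (ball 0 \<rho> - (\<Union>k. S k)) \<and>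
      (\<forall>k. \<forall>x\<in>S k. (u has_derivative (\<lambda>v. \<gamma> x \<bullet> v)) (at x within S k))"
proof -
  define \<rho>1 where "\<rho>1 = (1 + \<rho>) / 2"
  define R where "R = \<rho>1 - \<rho>"
  have \<rho>1: "0 < \<rho>1" "\<rho>1 < 1" "0 < R"
    using \<rho> by (auto simp: \<rho>1_def R_def)
  have sub: "ball x s \<subseteq> ball 0 \<rho>1" if "x \<in> ball 0 \<rho>" "s \<le> R" for x :: "real^'n" and s
  proof
    fix z assume "z \<in> ball x s"
    then show "z \<in> ball 0 \<rho>1"
      using that dist_triangle[of 0 z x] by (simp add: R_def)
  qed
  define V where "V = measure lborel (ball (0 :: real^'n) 1)"
  have V: "0 < V"
    using content_ball_pos[of 1 "0 :: real^'n"] by (simp add: V_def)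
  define P where "P j w Dw \<longleftrightarrow> (\<forall>x. (w has_derivative (\<lambda>v. Dw x \<bullet> v)) (at x)) \<and> continuous_on UNIV Dw \<and>
      (\<forall>x\<in>ball 0 \<rho>1. \<bar>w x - u x\<bar> \<le> (1/4) ^ j) \<and>
      (\<integral>\<^sup>+x\<in>ball 0 \<rho>1. ennreal (norm (Dw x - \<gamma> x)) \<partial>lebesgue) \<le> ennreal ((1/4) ^ j)"
    for j :: nat and w :: "real^'n \<Rightarrow> real" and Dw :: "real^'n \<Rightarrow> real^'n"
  have "\<exists>w Dw. P j w Dw" for j
    unfolding P_def using mollify[OF cont \<gamma>_meas \<gamma>_int weak \<rho>1(1,2)] by simp
  then obtain w Dw where "\<And>j. P j (w j) (Dw j)"
    by metis
  then have w:
      "\<And>j x. (w j has_derivative (\<lambda>v. Dw j x \<bullet> v)) (at x)" "\<And>j. continuous_on UNIV (Dw j)"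
      "\<And>j x. x \<in> ball 0 \<rho>1 \<Longrightarrow> \<bar>w j x - u x\<bar> \<le> (1/4) ^ j"
      "\<And>j. (\<integral>\<^sup>+x\<in>ball 0 \<rho>1. ennreal (norm (Dw j x - \<gamma> x)) \<partial>lebesgue) \<le> ennreal ((1/4) ^ (j::nat))"
    by (simp_all add: P_def)
  have w_lim: "(\<lambda>i. w i x) \<longlonglongrightarrow> u x" if "x \<in> ball 0 \<rho>1" for x
  proof -
    have "(\<lambda>i. (1/4 :: real) ^ i) \<longlonglongrightarrow> 0"
      by (intro LIMSEQ_power_zero) auto
    then have "(\<lambda>i. w i x - u x) \<longlonglongrightarrow> 0"
      by (rule Lim_null_comparison[rotated]) (use w(3)[OF that] in auto)
    then show ?thesis
      by (simp add: LIM_zero_iff)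
  qed
  define h where "h j x = ennreal (norm (Dw j x - \<gamma> x)) * indicator (ball 0 \<rho>1) x" for j x
  have h_meas: "h j \<in> borel_measurable lebesgue" for j
  proof -
    have "ball (0 :: real^'n) \<rho>1 \<subseteq> ball 0 1"
      using \<rho>1 by auto
    then have "\<gamma> \<in> borel_measurable (lebesgue_on (ball 0 \<rho>1))"
      using \<gamma>_meas by (metis measurable_restrict_mono)
    moreover have "Dw j \<in> borel_measurable (lebesgue_on (ball 0 \<rho>1))"
      using borel_measurable_continuous_onI[OF w(2)] by (intro measurable_restrict_space1 measurable_completion) simp
    ultimately have "(\<lambda>x. norm (Dw j x - \<gamma> x)) \<in> borel_measurable (lebesgue_on (ball 0 \<rho>1))"
      by measurable
    then show ?thesis
      unfolding h_def by (rule borel_measurable_indicator_lebesgue) simp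
  qed
  define g where "g x = (\<Sum>j. ennreal (2 ^ j) * h j x)" for x
  have g_meas [measurable]: "g \<in> borel_measurable lebesgue"
    unfolding g_def using h_meas by measurable
  have h_le: "h j x \<le> ennreal ((1/2) ^ j) * g x" for j x
  proof -
    have "ennreal (2 ^ j) * h j x \<le> g x"
      unfolding g_def using sum_le_suminf[of "\<lambda>j. ennreal (2 ^ j) * h j x" "{j}"] by simp
    then have "ennreal ((1/2) ^ j) * (ennreal (2 ^ j) * h j x) \<le> ennreal ((1/2) ^ j) * g x"
      by (rule mult_left_mono) simp
    then show ?thesis
      by (simp add: mult.assoc[symmetric] ennreal_mult[symmetric] power_mult_distrib[symmetric])
  qed
  have g_int: "(\<integral>\<^sup>+x. g x \<partial>lebesgue) \<le> 2"
  proof -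
    have "(\<integral>\<^sup>+x. g x \<partial>lebesgue) = (\<Sum>j. \<integral>\<^sup>+x. ennreal (2 ^ j) * h j x \<partial>lebesgue)"
      unfolding g_def using h_meas by (intro nn_integral_suminf) measurable
    also have "\<dots> = (\<Sum>j. ennreal (2 ^ j) * (\<integral>\<^sup>+x. h j x \<partial>lebesgue))"
      by (intro suminf_cong nn_integral_cmult h_meas)
    also have "\<dots> \<le> (\<Sum>j. ennreal (2 ^ j) * ennreal ((1/4) ^ j))"
      using w(4) unfolding h_def by (intro suminf_le mult_left_mono summableI) auto
    finally show ?thesis
      by (simp only: suminf_ennreal_geometric)
  qed
  \<comment> \<open>The bound on the maximal function is \<open>Suc k\<close> because the weak type estimate needs a
    positive level.\<close>
  define S where "S k = ball 0 \<rho> \<inter> {x. g x \<le> ennreal (real k)} - ball_mean_exceeds g R (real (Suc k))" for k :: nat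
  have S_sets: "S k \<in> sets lebesgue" for k
  proof -
    have "{x \<in> space lebesgue. g x \<le> ennreal (real k)} \<in> sets lebesgue"
      by measurable
    then show ?thesis
      using open_ball_mean_exceeds[OF g_meas, of R "real (Suc k)"]
      unfolding S_def by (intro sets.Diff sets.Int) auto
  qed
  have S_mono: "incseq S"
  proof (rule incseq_SucI)
    fix k
    have "ball_mean_exceeds g R (real (Suc (Suc k))) \<subseteq> ball_mean_exceeds g R (real (Suc k))"
      unfolding ball_mean_exceeds_def
    proof (intro Collect_mono impI, elim exE conjE, intro exI conjI)
      fix x r assume r: "0 < r" "ennreal (real (Suc (Suc k)) * r ^ DIM(real^'n)) < (\<integral>\<^sup>+z\<in>ball x r. g z \<partial>lebesgue)"
      have "ennreal (real (Suc k) * r ^ DIM(real^'n)) \<le> ennreal (real (Suc (Suc k)) * r ^ DIM(real^'n))"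
        using r(1) by (intro ennreal_leI mult_right_mono) auto
      then show "ennreal (real (Suc k) * r ^ DIM(real^'n)) < (\<integral>\<^sup>+z\<in>ball x r. g z \<partial>lebesgue)"
        using r(2) by (rule le_less_trans)
    qed
    moreover have "ennreal (real k) \<le> ennreal (real (Suc k))"
      by (intro ennreal_leI) simp
    ultimately show "S k \<subseteq> S (Suc k)"
      unfolding S_def by (auto elim: order_trans)
  qed
  have S_cover: "negligible (ball 0 \<rho> - (\<Union>k. S k))"
  proof -
    define E where "E = (\<Inter>k. ball_mean_exceeds g R (real (Suc k)))"
    have E_sets: "E \<in> sets lebesgue"
      unfolding E_def using open_ball_mean_exceeds[OF g_meas] by (intro sets.countable_INT) auto
    have E_le: "emeasure lebesgue E \<le> ennreal (5 ^ CARD('n) * V / real (Suc k)) * 2" for k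
    proof -
      have "emeasure lebesgue E \<le> emeasure lebesgue (ball_mean_exceeds g R (real (Suc k)))"
        using open_ball_mean_exceeds[OF g_meas] unfolding E_def by (intro emeasure_mono) auto
      also have "\<dots> \<le> ennreal (5 ^ CARD('n) * V / real (Suc k)) * (\<integral>\<^sup>+z. g z \<partial>lebesgue)"
        using emeasure_ball_mean_exceeds_le[OF g_meas, of "real (Suc k)" R] by (simp add: V_def)
      also have "\<dots> \<le> ennreal (5 ^ CARD('n) * V / real (Suc k)) * 2"
        by (intro mult_left_mono g_int) simp
      finally show ?thesis .
    qed
    have "(\<lambda>k. ennreal (5 ^ CARD('n) * V / real (Suc k)) * 2) \<longlonglongrightarrow> ennreal 0 * 2"
      by (intro tendsto_mult_ennreal tendsto_ennrealI tendsto_const LIMSEQ_Suc[OF lim_const_over_n]) auto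
    then have "emeasure lebesgue E \<le> ennreal 0 * 2"
      by (rule LIMSEQ_le_const) (use E_le in blast)
    then have "E \<in> null_sets lebesgue"
      using E_sets by (intro null_setsI) auto
    moreover have "{x. g x = \<infinity>} \<in> null_sets lebesgue"
    proof -
      have "AE x in lebesgue. g x \<noteq> \<infinity>"
        using g_int by (intro nn_integral_PInf_AE g_meas) (auto simp: top_unique)
      moreover have "{x \<in> space lebesgue. g x = \<infinity>} \<in> sets lebesgue"
        by measurable
      ultimately show ?thesis
        using AE_iff_null_sets[of "{x. g x = \<infinity>}" lebesgue] by simp
    qed
    ultimately have "negligible (E \<union> {x. g x = \<infinity>})"
      unfolding negligible_iff_null_sets by (rule null_sets.Un)
    moreover have "ball 0 \<rho> - (\<Union>k. S k) \<subseteq> E \<union> {x. g x = \<infinity>}"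
    proof
      fix x assume x: "x \<in> ball 0 \<rho> - (\<Union>k. S k)"
      show "x \<in> E \<union> {x. g x = \<infinity>}"
      proof (rule ccontr)
        assume "x \<notin> E \<union> {x. g x = \<infinity>}"
        then obtain k where k: "x \<notin> ball_mean_exceeds g R (real (Suc k))" and fin: "g x \<noteq> \<infinity>"
          by (auto simp: E_def)
        from fin obtain b where b: "g x = ennreal b" "0 \<le> b"
          by (cases "g x") auto
        define m where "m = max k (nat \<lceil>b\<rceil>)"
        have "b \<le> real m"
          by (simp add: m_def) linarith
        then have "g x \<le> ennreal (real m)"
          by (simp add: b(1) ennreal_leI)
        moreover have "x \<notin> ball_mean_exceeds g R (real (Suc m))"
        proof
          assume "x \<in> ball_mean_exceeds g R (real (Suc m))"
          then obtain r where r: "0 < r" "r \<le> R"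
              "ennreal (real (Suc m) * r ^ DIM(real^'n)) < (\<integral>\<^sup>+z\<in>ball x r. g z \<partial>lebesgue)"
            unfolding ball_mean_exceeds_def by blast
          have "ennreal (real (Suc k) * r ^ DIM(real^'n)) \<le> ennreal (real (Suc m) * r ^ DIM(real^'n))"
            using r(1) by (intro ennreal_leI mult_right_mono) (auto simp: m_def)
          also note r(3)
          finally show False
            using k r(1,2) unfolding ball_mean_exceeds_def by blast
        qed
        ultimately have "x \<in> S m"
          using x by (simp add: S_def)
        then show False
          using x by blast
      qed
    qed
    ultimately show ?thesis
      by (rule negligible_subset)
  qed
  have lip: "\<bar>(u x - w j x) - (u y - w j y)\<bar> \<le> 2 ^ (CARD('n) + 1) / V * (real (Suc k) * (1/2) ^ j) * dist x y"
    if x: "x \<in> S k" and y: "y \<in> S k" and xy: "dist x y \<le> R" for x y j k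
  proof (cases "x = y")
    case False
    define c where "c = 2 ^ (CARD('n) + 1) / V"
    have xb: "x \<in> ball 0 \<rho>1" "y \<in> ball 0 \<rho>1"
      using x y \<rho>1(3) by (auto simp: S_def R_def)
    have le: "\<bar>(w i x - w j x) - (w i y - w j y)\<bar> \<le> c * (real (Suc k) * ((1/2) ^ i + (1/2) ^ j)) * dist x y" for i
    proof -
      have "\<bar>(w i x - w j x) - (w i y - w j y)\<bar> \<le> 2 ^ (DIM(real^'n) + 1) / measure lborel (ball (0::real^'n) 1) *
          (real (Suc k) * ((1/2) ^ i + (1/2) ^ j)) * dist x y"
      proof (rule two_point_oscillation_le[where w = "\<lambda>z. w i z - w j z" and Dw = "\<lambda>z. Dw i z - Dw j z"])
        show "((\<lambda>z. w i z - w j z) has_derivative (\<lambda>v. (Dw i z - Dw j z) \<bullet> v)) (at z)" for z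
          using has_derivative_diff[OF w(1)[of i z] w(1)[of j z]] by (simp add: inner_diff_left)
        show "continuous_on UNIV (\<lambda>z. Dw i z - Dw j z)"
          by (intro continuous_intros w(2))
        fix p s assume p: "p \<in> {x, y}" and s: "0 < s" "s \<le> dist x y"
        have pS: "p \<in> S k"
          using p x y by auto
        have sR: "s \<le> R"
          using s xy by simp
        have ps: "ball p s \<subseteq> ball 0 \<rho>1"
          using pS sR by (intro sub) (auto simp: S_def)
        have "(\<integral>\<^sup>+z\<in>ball p s. ennreal (norm (Dw i z - Dw j z)) \<partial>lborel)
            = (\<integral>\<^sup>+z\<in>ball p s. ennreal (norm (Dw i z - Dw j z)) \<partial>lebesgue)"
          by (rule nn_integral_completion[symmetric])
        also have "\<dots> \<le> (\<integral>\<^sup>+z. ennreal ((1/2) ^ i + (1/2) ^ j) * (g z * indicator (ball p s) z) \<partial>lebesgue)"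
        proof (rule nn_integral_mono)
          fix z
          show "ennreal (norm (Dw i z - Dw j z)) * indicator (ball p s) z
              \<le> ennreal ((1/2) ^ i + (1/2) ^ j) * (g z * indicator (ball p s) z)"
          proof (cases "z \<in> ball p s")
            case True
            then have zb: "z \<in> ball 0 \<rho>1"
              using ps by blast
            have "norm (Dw i z - Dw j z) \<le> norm (Dw i z - \<gamma> z) + norm (Dw j z - \<gamma> z)"
              by norm
            then have "ennreal (norm (Dw i z - Dw j z)) \<le> h i z + h j z"
              using zb by (simp add: h_def ennreal_plus[symmetric] ennreal_leI del: ennreal_plus)
            also have "\<dots> \<le> ennreal ((1/2) ^ i) * g z + ennreal ((1/2) ^ j) * g z"
              by (intro add_mono h_le)
            also have "\<dots> = ennreal ((1/2) ^ i + (1/2) ^ j) * g z"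
              by (simp add: distrib_right)
            finally show ?thesis
              using True by simp
          qed simp
        qed
        also have "\<dots> = ennreal ((1/2) ^ i + (1/2) ^ j) * (\<integral>\<^sup>+z\<in>ball p s. g z \<partial>lebesgue)"
          by (intro nn_integral_cmult borel_measurable_times_ennreal g_meas borel_measurable_indicator) simp
        also have "\<dots> \<le> ennreal ((1/2) ^ i + (1/2) ^ j) * ennreal (real (Suc k) * s ^ DIM(real^'n))"
        proof (rule mult_left_mono)
          have "p \<notin> ball_mean_exceeds g R (real (Suc k))"
            using pS by (simp add: S_def)
          then show "(\<integral>\<^sup>+z\<in>ball p s. g z \<partial>lebesgue) \<le> ennreal (real (Suc k) * s ^ DIM(real^'n))"
            using s(1) sR unfolding ball_mean_exceeds_def by (metis (mono_tags, lifting) linorder_not_le mem_Collect_eq)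
        qed simp
        also have "\<dots> = ennreal (real (Suc k) * ((1/2) ^ i + (1/2) ^ j) * s ^ DIM(real^'n))"
          using s by (subst ennreal_mult[symmetric]) (auto simp: mult_ac)
        finally show "(\<integral>\<^sup>+z\<in>ball p s. ennreal (norm (Dw i z - Dw j z)) \<partial>lborel)
            \<le> ennreal (real (Suc k) * ((1/2) ^ i + (1/2) ^ j) * s ^ DIM(real^'n))" .
      qed (use False in auto)
      then show ?thesis
        by (simp add: c_def V_def)
    qed
    have "(\<lambda>i. \<bar>(w i x - w j x) - (w i y - w j y)\<bar>) \<longlonglongrightarrow> \<bar>(u x - w j x) - (u y - w j y)\<bar>"
      by (intro tendsto_intros w_lim xb)
    moreover have "(\<lambda>i. c * (real (Suc k) * ((1/2) ^ i + (1/2) ^ j)) * dist x y)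
        \<longlonglongrightarrow> c * (real (Suc k) * (0 + (1/2) ^ j)) * dist x y"
      by (intro tendsto_intros LIMSEQ_power_zero) auto
    ultimately have "\<bar>(u x - w j x) - (u y - w j y)\<bar> \<le> c * (real (Suc k) * (0 + (1/2) ^ j)) * dist x y"
      by (rule LIMSEQ_le) (use le in blast)
    then show ?thesis
      by (simp add: c_def)
  qed simp
  have S_der: "(u has_derivative (\<lambda>v. \<gamma> x \<bullet> v)) (at x within S k)" if x: "x \<in> S k" for k x
    unfolding has_derivative_within_alt
  proof (intro conjI allI impI)
    show "bounded_linear ((\<bullet>) (\<gamma> x))"
      by (rule bounded_linear_inner_right)
    fix \<epsilon> :: real assume \<epsilon>: "0 < \<epsilon>"
    define c where "c = 2 ^ (CARD('n) + 1) / V * real (Suc k) + real k"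
    have "(\<lambda>j. c * (1/2) ^ j) \<longlonglongrightarrow> c * 0"
      by (intro tendsto_intros LIMSEQ_power_zero) auto
    then have "\<forall>\<^sub>F j in sequentially. c * (1/2) ^ j < \<epsilon> / 2"
      using \<epsilon> by (intro order_tendstoD(2)) auto
    then obtain j where j: "c * (1/2) ^ j < \<epsilon> / 2"
      using eventually_happens'[OF sequentially_bot] by blast
    have xb: "x \<in> ball 0 \<rho>1"
      using x \<rho>1(3) by (auto simp: S_def R_def)
    have "ennreal (norm (Dw j x - \<gamma> x)) = h j x"
      using xb by (simp add: h_def)
    also have "\<dots> \<le> ennreal ((1/2) ^ j) * g x"
      by (rule h_le)
    also have "\<dots> \<le> ennreal ((1/2) ^ j) * ennreal (real k)"
      using x by (intro mult_left_mono) (auto simp: S_def)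
    also have "\<dots> = ennreal ((1/2) ^ j * real k)"
      by (subst ennreal_mult[symmetric]) auto
    finally have grad: "norm (Dw j x - \<gamma> x) \<le> (1/2) ^ j * real k"
      by (subst (asm) ennreal_le_iff) auto
    obtain d where d: "d > 0" "\<And>y. norm (y - x) < d \<Longrightarrow>
        norm (w j y - w j x - Dw j x \<bullet> (y - x)) \<le> \<epsilon> / 2 * norm (y - x)"
      using w(1)[of j x] \<epsilon> unfolding has_derivative_within_alt by (metis UNIV_I half_gt_zero)
    have "norm (u y - u x - \<gamma> x \<bullet> (y - x)) \<le> \<epsilon> * norm (y - x)" if y: "y \<in> S k" "norm (y - x) < min d R" for y
    proof -
      have "u y - u x - \<gamma> x \<bullet> (y - x)
          = ((u y - w j y) - (u x - w j x)) + (w j y - w j x - Dw j x \<bullet> (y - x)) + (Dw j x - \<gamma> x) \<bullet> (y - x)"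
        by (simp add: inner_diff_left)
      then have "norm (u y - u x - \<gamma> x \<bullet> (y - x)) \<le> \<bar>(u y - w j y) - (u x - w j x)\<bar>
          + norm (w j y - w j x - Dw j x \<bullet> (y - x)) + norm (Dw j x - \<gamma> x) * norm (y - x)"
        using Cauchy_Schwarz_ineq2[of "Dw j x - \<gamma> x" "y - x"] by simp
      also have "\<dots> \<le> 2 ^ (CARD('n) + 1) / V * (real (Suc k) * (1/2) ^ j) * norm (y - x)
          + \<epsilon> / 2 * norm (y - x) + (1/2) ^ j * real k * norm (y - x)"
        using lip[OF y(1) x, of j] y(2) d(2)[of y] grad by (intro add_mono mult_right_mono) (auto simp: dist_norm)
      also have "\<dots> = (c * (1/2) ^ j + \<epsilon> / 2) * norm (y - x)"
        by (simp add: c_def algebra_simps add_divide_distrib)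
      also have "\<dots> \<le> \<epsilon> * norm (y - x)"
        using j by (intro mult_right_mono) auto
      finally show ?thesis .
    qed
    then show "\<exists>d>0. \<forall>y\<in>S k. norm (y - x) < d \<longrightarrow> norm (u y - u x - \<gamma> x \<bullet> (y - x)) \<le> \<epsilon> * norm (y - x)"
      using d(1) \<rho>1(3) by (intro exI[of _ "min d R"]) auto
  qed
  show ?thesis
    using S_mono S_sets S_cover S_der by blast
qed

section \<open>The area inequality for Sobolev maps\<close>

lemma borel_measurable_vec_nth [measurable (raw)]:
  fixes f :: "'a \<Rightarrow> 'b::{second_countable_topology, real_normed_vector} ^ 'n"
  assumes "f \<in> borel_measurable M"
  shows "(\<lambda>x. f x $ i) \<in> borel_measurable M"
proof -
  have "(\<lambda>v :: 'b ^ 'n. v $ i) \<in> borel_measurable borel"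
    by (intro borel_measurable_continuous_onI continuous_on_component continuous_on_id)
  with assms show ?thesis
    by (rule measurable_compose)
qed

lemma borel_measurable_det:
  fixes G :: "'a \<Rightarrow> real^'n^'n"
  assumes "G \<in> borel_measurable M"
  shows "(\<lambda>x. det (G x)) \<in> borel_measurable M"
  unfolding det_def using assms
  by (intro borel_measurable_sum borel_measurable_times borel_measurable_const borel_measurable_prod borel_measurable_vec_nth)

lemma has_weak_derivative_on_measurable:
  assumes "has_weak_derivative_on f G U" "A \<subseteq> U"
  shows "G \<in> borel_measurable (lebesgue_on A)"
proof (rule measurable_restrict_mono)
  show "G \<in> borel_measurable (lebesgue_on U)"
    using assms(1) by (simp add: has_weak_derivative_on_def Lp_loc_def)
qed (rule assms(2))

text \<open>The sets for the components are increasing, so their intersections still exhaust the ball: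
a point lying in each component's union lies in all sets with the largest of the finitely
many indices.\<close>

lemma weak_derivative_differentiable_pieces:
  fixes f :: "real^'n \<Rightarrow> real^'n"
  assumes cont: "continuous_on (ball 0 1) f" and G: "has_weak_derivative_on f G (ball 0 1)"
    and \<rho>: "0 < \<rho>" "\<rho> < 1"
  obtains S :: "nat \<Rightarrow> (real^'n) set"
    where "incseq S" "\<And>k. S k \<in> sets lebesgue" "negligible (ball 0 \<rho> - (\<Union>k. S k))"
      "\<And>k x. x \<in> S k \<Longrightarrow> (f has_derivative (\<lambda>v. G x *v v)) (at x within S k)"
proof -
  have "\<forall>i. \<exists>S :: nat \<Rightarrow> (real^'n) set. incseq S \<and> (\<forall>k. S k \<in> sets lebesgue) \<and> negligible (ball 0 \<rho> - (\<Union>k. S k)) \<and>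
      (\<forall>k. \<forall>x\<in>S k. ((\<lambda>x. f x $ i) has_derivative (\<lambda>v. G x $ i \<bullet> v)) (at x within S k))"
  proof (intro allI weak_gradient_differentiable_pieces)
    fix i
    show "continuous_on (ball 0 1) (\<lambda>x. f x $ i)"
      by (intro continuous_intros cont)
    show "(\<lambda>x. G x $ i) \<in> borel_measurable (lebesgue_on (ball 0 1))"
      by (rule borel_measurable_vec_nth has_weak_derivative_on_measurable[OF G order_refl])+
    show "integrable (lebesgue_on S) (\<lambda>x. norm (G x $ i))" if S: "compact S" "S \<subseteq> ball 0 1" for S
    proof (rule Bochner_Integration.integrable_bound)
      show "integrable (lebesgue_on S) (\<lambda>x. norm (G x) powr 1)"
        using G S by (simp add: has_weak_derivative_on_def Lp_loc_def)
      show "(\<lambda>x. norm (G x $ i)) \<in> borel_measurable (lebesgue_on S)"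
        using has_weak_derivative_on_measurable[OF G S(2)] by measurable
      show "AE x in lebesgue_on S. norm (norm (G x $ i)) \<le> norm (norm (G x) powr 1)"
        by (intro AE_I2) (simp add: Finite_Cartesian_Product.norm_nth_le)
    qed
    fix \<phi> :: "real^'n \<Rightarrow> real" and j assume "\<phi> \<in> test_functions (ball 0 1)"
    then show "(\<integral>x. f x $ i * frechet_derivative \<phi> (at x) (axis j 1) \<partial>lebesgue_on (ball 0 1)) =
        - (\<integral>x. G x $ i $ j * \<phi> x \<partial>lebesgue_on (ball 0 1))"
      using G by (simp add: has_weak_derivative_on_def)
  qed (rule \<rho>)+
  from choice[OF this] obtain S where S: "\<And>i. incseq (S i)" "\<And>i k. S i k \<in> sets lebesgue"
      "\<And>i. negligible (ball 0 \<rho> - (\<Union>k. S i k))"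
      "\<And>i k x. x \<in> S i k \<Longrightarrow> ((\<lambda>x. f x $ i) has_derivative (\<lambda>v. G x $ i \<bullet> v)) (at x within S i k)"
    by blast
  define P where "P k = (\<Inter>i. S i k)" for k
  have P_sub: "P k \<subseteq> S i k" for i k
    by (auto simp: P_def)
  show thesis
  proof
    show "incseq P"
    proof (rule incseq_SucI)
      show "P k \<subseteq> P (Suc k)" for k
        unfolding P_def using incseq_SucD[OF S(1)] by blast
    qed
    show "P k \<in> sets lebesgue" for k
      unfolding P_def using S(2) by (intro sets.countable_INT') (auto simp: countable_finite)
    have "ball 0 \<rho> - (\<Union>k. P k) \<subseteq> (\<Union>i. ball 0 \<rho> - (\<Union>k. S i k))"
    proof
      fix x assume x: "x \<in> ball 0 \<rho> - (\<Union>k. P k)"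
      show "x \<in> (\<Union>i. ball 0 \<rho> - (\<Union>k. S i k))"
      proof (rule ccontr)
        assume "x \<notin> (\<Union>i. ball 0 \<rho> - (\<Union>k. S i k))"
        then have "\<forall>i. \<exists>k. x \<in> S i k"
          using x by blast
        then obtain \<kappa> where \<kappa>: "\<And>i. x \<in> S i (\<kappa> i)"
          by metis
        have "x \<in> S i (Max (range \<kappa>))" for i
        proof -
          have "\<kappa> i \<le> Max (range \<kappa>)"
            by (rule Max_ge) auto
          then show ?thesis
            using incseqD[OF S(1)] \<kappa> by blast
        qed
        then have "x \<in> P (Max (range \<kappa>))"
          by (simp add: P_def)
        then show False
          using x by blast
      qed
    qed
    moreover have "negligible (\<Union>i. ball 0 \<rho> - (\<Union>k. S i k))"
      using S(3) by (intro negligible_Union) auto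
    ultimately show "negligible (ball 0 \<rho> - (\<Union>k. P k))"
      by (rule negligible_subset[rotated])
    show "(f has_derivative (\<lambda>v. G x *v v)) (at x within P k)" if x: "x \<in> P k" for k x
    proof (rule has_derivative_componentwise_within[THEN iffD2], rule ballI)
      fix b :: "real^'n" assume "b \<in> Basis"
      then obtain i where b: "b = axis i 1"
        by (auto simp: Basis_vec_def)
      have "((\<lambda>x. f x $ i) has_derivative (\<lambda>v. G x $ i \<bullet> v)) (at x within P k)"
        using S(4)[of x i k] x P_sub by (blast intro: has_derivative_subset)
      then show "((\<lambda>x. f x \<bullet> b) has_derivative (\<lambda>v. (G x *v v) \<bullet> b)) (at x within P k)"
        by (simp add: b inner_axis matrix_vector_mul_component)
    qed
  qed
qed

lemma weak_derivative_area_inequality: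
  fixes f :: "real^'n \<Rightarrow> real^'n"
  assumes cont: "continuous_on (ball 0 1) f" and G: "has_weak_derivative_on f G (ball 0 1)"
    and \<rho>: "0 < \<rho>" "\<rho> < 1" and E: "E \<in> sets lebesgue" "E \<subseteq> ball 0 \<rho>"
    and img: "f ` E \<subseteq> Y" and Y: "Y \<in> lmeasurable"
    and mult: "\<And>y. emeasure (count_space UNIV) {x \<in> E. f x = y} \<le> N"
  shows "(\<integral>\<^sup>+x\<in>E. ennreal \<bar>det (G x)\<bar> \<partial>lebesgue) \<le> N * emeasure lebesgue Y"
proof -
  obtain S :: "nat \<Rightarrow> (real^'n) set" where S: "incseq S" "\<And>k. S k \<in> sets lebesgue" "negligible (ball 0 \<rho> - (\<Union>k. S k))"
      "\<And>k x. x \<in> S k \<Longrightarrow> (f has_derivative (\<lambda>v. G x *v v)) (at x within S k)"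
    using weak_derivative_differentiable_pieces[OF cont G \<rho>] by metis
  have E1: "E \<subseteq> ball 0 1"
    using E(2) \<rho> by (auto simp: subset_iff)
  have ES: "E \<inter> S k \<in> sets lebesgue" for k
    using E(1) S(2) by (rule sets.Int)
  have le: "(\<integral>\<^sup>+x\<in>E \<inter> S k. ennreal \<bar>det (G x)\<bar> \<partial>lebesgue) \<le> N * emeasure lebesgue Y" for k
  proof (rule nn_integral_det_le_multiplicity[OF ES _ _ _ Y])
    show "(f has_derivative (\<lambda>v. G x *v v)) (at x within E \<inter> S k)" if "x \<in> E \<inter> S k" for x
      using S(4)[of x k] that by (blast intro: has_derivative_subset)
    show "(\<lambda>x. det (G x)) \<in> borel_measurable (lebesgue_on (E \<inter> S k))"
      using E1 by (intro borel_measurable_det has_weak_derivative_on_measurable[OF G]) blast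
    show "f ` (E \<inter> S k) \<subseteq> Y"
      using img by blast
    show "emeasure (count_space UNIV) {x \<in> E \<inter> S k. f x = y} \<le> N" for y
      by (rule order_trans[OF emeasure_mono mult[of y]]) auto
  qed
  have "(\<integral>\<^sup>+x\<in>E. ennreal \<bar>det (G x)\<bar> \<partial>lebesgue) = (\<integral>\<^sup>+x. (SUP k. ennreal \<bar>det (G x)\<bar> * indicator (E \<inter> S k) x) \<partial>lebesgue)"
  proof (rule nn_integral_cong_AE)
    have "AE x in lebesgue. x \<notin> ball 0 \<rho> - (\<Union>k. S k)"
      using S(3) by (intro AE_not_in) (simp add: negligible_iff_null_sets)
    then show "AE x in lebesgue. ennreal \<bar>det (G x)\<bar> * indicator E x = (SUP k. ennreal \<bar>det (G x)\<bar> * indicator (E \<inter> S k) x)"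
    proof eventually_elim
      fix x assume x: "x \<notin> ball 0 \<rho> - (\<Union>k. S k)"
      show "ennreal \<bar>det (G x)\<bar> * indicator E x = (SUP k. ennreal \<bar>det (G x)\<bar> * indicator (E \<inter> S k) x)"
      proof (cases "x \<in> E")
        case True
        then obtain k where "x \<in> S k"
          using x E(2) by blast
        then have "ennreal \<bar>det (G x)\<bar> \<le> (SUP k. ennreal \<bar>det (G x)\<bar> * indicator (E \<inter> S k) x)"
          using True by (intro SUP_upper2[of k]) auto
        moreover have "(SUP k. ennreal \<bar>det (G x)\<bar> * indicator (E \<inter> S k) x) \<le> ennreal \<bar>det (G x)\<bar>"
          by (rule SUP_least) (simp add: indicator_def)
        ultimately show ?thesis
          using True by simp
      qed simp
    qed
  qed
  also have "\<dots> = (SUP k. \<integral>\<^sup>+x\<in>E \<inter> S k. ennreal \<bar>det (G x)\<bar> \<partial>lebesgue)"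
  proof (rule nn_integral_monotone_convergence_SUP)
    show "incseq (\<lambda>k x. ennreal \<bar>det (G x)\<bar> * indicator (E \<inter> S k) x)"
      using incseq_SucD[OF S(1)] by (intro incseq_SucI le_funI mult_left_mono) (auto simp: indicator_def)
    fix k
    show "(\<lambda>x. ennreal \<bar>det (G x)\<bar> * indicator (E \<inter> S k) x) \<in> borel_measurable lebesgue"
      using E1 by (intro borel_measurable_indicator_lebesgue borel_measurable_abs borel_measurable_det
          has_weak_derivative_on_measurable[OF G] ES) blast
  qed
  also have "\<dots> \<le> N * emeasure lebesgue Y"
    by (rule SUP_least) (rule le)
  finally show ?thesis .
qed

text \<open>Cut the ring that contains \<open>f ` E\<close> into dyadic shells. In each shell \<open>|f|^n\<close> is constant up
to a factor \<open>2^n\<close>, and the area inequality bounds the integral of the determinant by the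
volume of the outer ball; the powers of the radius cancel, so every shell contributes the
same amount.\<close>

lemma nn_integral_log_det_le:
  fixes f :: "real^'n \<Rightarrow> real^'n"
  assumes cont: "continuous_on (ball 0 1) f" and G: "has_weak_derivative_on f G (ball 0 1)"
    and \<rho>: "0 < \<rho>" "\<rho> < 1" and E: "E \<in> sets lebesgue" "E \<subseteq> ball 0 \<rho>"
    and mult: "\<And>y. emeasure (count_space UNIV) {x \<in> E. f x = y} \<le> N"
    and c: "0 < c" and range: "\<And>x. x \<in> E \<Longrightarrow> c \<le> norm (f x) \<and> norm (f x) < c * 2 ^ m"
  shows "(\<integral>\<^sup>+x\<in>E. ennreal (\<bar>det (G x)\<bar> / norm (f x) ^ CARD('n)) \<partial>lebesgue)
      \<le> of_nat m * (N * ennreal (2 ^ CARD('n) * measure lborel (ball (0 :: real^'n) 1)))"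
proof -
  let ?V = "measure lborel (ball (0 :: real^'n) 1)"
  have E1: "E \<subseteq> ball 0 1"
    using E(2) \<rho> by (auto simp: subset_iff)
  define D where "D i = {x \<in> E. c * 2 ^ i \<le> norm (f x) \<and> norm (f x) < c * 2 ^ Suc i}" for i :: nat
  have f_meas: "f \<in> borel_measurable (lebesgue_on E)"
    using continuous_on_subset[OF cont E1] E(1) by (rule continuous_imp_measurable_on_sets_lebesgue)
  have D_sets: "D i \<in> sets lebesgue" for i
  proof -
    have "{x \<in> space (lebesgue_on E). c * 2 ^ i \<le> norm (f x) \<and> norm (f x) < c * 2 ^ Suc i} \<in> sets (lebesgue_on E)"
      using f_meas by measurable
    then show ?thesis
      using E(1) by (simp add: D_def sets_restrict_space_iff)
  qed
  have "D i \<subseteq> ball 0 1" for i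
    using E1 by (auto simp: D_def)
  then have det_meas: "(\<lambda>x. ennreal \<bar>det (G x)\<bar> * indicator (D i) x) \<in> borel_measurable lebesgue" for i
    by (intro borel_measurable_indicator_lebesgue borel_measurable_abs borel_measurable_det
        has_weak_derivative_on_measurable[OF G] D_sets)
  have "(\<integral>\<^sup>+x\<in>E. ennreal (\<bar>det (G x)\<bar> / norm (f x) ^ CARD('n)) \<partial>lebesgue)
      \<le> (\<integral>\<^sup>+x. (\<Sum>i<m. ennreal (1 / (c * 2 ^ i) ^ CARD('n)) * (ennreal \<bar>det (G x)\<bar> * indicator (D i) x)) \<partial>lebesgue)"
  proof (rule nn_integral_mono)
    fix x
    show "ennreal (\<bar>det (G x)\<bar> / norm (f x) ^ CARD('n)) * indicator E x
        \<le> (\<Sum>i<m. ennreal (1 / (c * 2 ^ i) ^ CARD('n)) * (ennreal \<bar>det (G x)\<bar> * indicator (D i) x))"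
    proof (cases "x \<in> E")
      case True
      define i where "i = (GREATEST i. c * 2 ^ i \<le> norm (f x))"
      have bnd: "i \<le> m" if "c * 2 ^ i \<le> norm (f x)" for i
      proof (rule ccontr)
        assume "\<not> i \<le> m"
        then have "c * 2 ^ m \<le> c * 2 ^ i"
          using c by (intro mult_left_mono power_increasing) auto
        then show False
          using that range[OF True] by simp
      qed
      have i1: "c * 2 ^ i \<le> norm (f x)"
        unfolding i_def by (rule GreatestI_nat[where k = 0 and b = m]) (use range[OF True] bnd in auto)
      have i2: "norm (f x) < c * 2 ^ Suc i"
      proof (rule ccontr)
        assume "\<not> norm (f x) < c * 2 ^ Suc i"
        then have "Suc i \<le> i"
          unfolding i_def by (intro Greatest_le_nat[where b = m]) (use bnd in auto)
        then show False by simp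
      qed
      have im: "i < m"
      proof (rule ccontr)
        assume "\<not> i < m"
        then have "c * 2 ^ m \<le> c * 2 ^ i"
          using c by (intro mult_left_mono power_increasing) auto
        then show False
          using i1 range[OF True] by simp
      qed
      have "ennreal (\<bar>det (G x)\<bar> / norm (f x) ^ CARD('n)) \<le> ennreal (1 / (c * 2 ^ i) ^ CARD('n) * \<bar>det (G x)\<bar>)"
        using c i1 by (intro ennreal_leI) (simp add: frac_le power_mono)
      also have "\<dots> = ennreal (1 / (c * 2 ^ i) ^ CARD('n)) * (ennreal \<bar>det (G x)\<bar> * indicator (D i) x)"
        using True i1 i2 c by (simp add: D_def ennreal_mult[symmetric])
      also have "\<dots> \<le> (\<Sum>i<m. ennreal (1 / (c * 2 ^ i) ^ CARD('n)) * (ennreal \<bar>det (G x)\<bar> * indicator (D i) x))"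
        using im by (intro member_le_sum) auto
      finally show ?thesis
        using True by simp
    qed simp
  qed
  also have "\<dots> = (\<Sum>i<m. \<integral>\<^sup>+x. ennreal (1 / (c * 2 ^ i) ^ CARD('n)) * (ennreal \<bar>det (G x)\<bar> * indicator (D i) x) \<partial>lebesgue)"
    by (intro nn_integral_sum borel_measurable_times_ennreal borel_measurable_const det_meas)
  also have "\<dots> = (\<Sum>i<m. ennreal (1 / (c * 2 ^ i) ^ CARD('n)) * (\<integral>\<^sup>+x\<in>D i. ennreal \<bar>det (G x)\<bar> \<partial>lebesgue))"
    by (intro sum.cong refl nn_integral_cmult det_meas)
  also have "\<dots> \<le> (\<Sum>i<m. N * ennreal (2 ^ CARD('n) * ?V))"
  proof (rule sum_mono)
    fix i
    let ?Y = "ball (0 :: real^'n) (c * 2 ^ Suc i)"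
    have "(\<integral>\<^sup>+x\<in>D i. ennreal \<bar>det (G x)\<bar> \<partial>lebesgue) \<le> N * emeasure lebesgue ?Y"
    proof (rule weak_derivative_area_inequality[OF cont G \<rho> D_sets])
      show "D i \<subseteq> ball 0 \<rho>" "f ` D i \<subseteq> ?Y"
        using E(2) by (auto simp: D_def)
      show "emeasure (count_space UNIV) {x \<in> D i. f x = y} \<le> N" for y
        by (rule order_trans[OF emeasure_mono mult[of y]]) (auto simp: D_def)
    qed simp
    also have "emeasure lebesgue ?Y = ennreal ((c * 2 ^ Suc i) ^ CARD('n) * ?V)"
      using c content_ball_conv_unit_ball[of "c * 2 ^ Suc i" "0 :: real^'n"] emeasure_lborel_ball_finite[of "0 :: real^'n" "c * 2 ^ Suc i"]
      by (simp add: emeasure_eq_ennreal_measure)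
    finally have "ennreal (1 / (c * 2 ^ i) ^ CARD('n)) * (\<integral>\<^sup>+x\<in>D i. ennreal \<bar>det (G x)\<bar> \<partial>lebesgue)
        \<le> ennreal (1 / (c * 2 ^ i) ^ CARD('n)) * (N * ennreal ((c * 2 ^ Suc i) ^ CARD('n) * ?V))"
      by (rule mult_left_mono) simp
    also have "\<dots> = N * (ennreal (1 / (c * 2 ^ i) ^ CARD('n)) * ennreal ((c * 2 ^ Suc i) ^ CARD('n) * ?V))"
      by (simp add: mult_ac)
    also have "ennreal (1 / (c * 2 ^ i) ^ CARD('n)) * ennreal ((c * 2 ^ Suc i) ^ CARD('n) * ?V) = ennreal (2 ^ CARD('n) * ?V)"
      using c by (subst ennreal_mult[symmetric]) (auto simp: power_mult_distrib)
    finally show "ennreal (1 / (c * 2 ^ i) ^ CARD('n)) * (\<integral>\<^sup>+x\<in>D i. ennreal \<bar>det (G x)\<bar> \<partial>lebesgue)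
        \<le> N * ennreal (2 ^ CARD('n) * ?V)" .
  qed
  also have "\<dots> = of_nat m * (N * ennreal (2 ^ CARD('n) * ?V))"
    by simp
  finally show ?thesis .
qed

section \<open>Moebius maps and layers of Carleson boxes\<close>

text \<open>The square of \<open>|x| |y - x / |x|^2|\<close>, in a form that also makes sense for \<open>x = 0\<close>.\<close>

definition moebius_den :: "real^'n \<Rightarrow> real^'n \<Rightarrow> real" where
  "moebius_den x y = 1 - 2 * (x \<bullet> y) + (norm x)\<^sup>2 * (norm y)\<^sup>2"

lemma moebius_den_alt: "moebius_den x y = (norm (y - x))\<^sup>2 + (1 - (norm x)\<^sup>2) * (1 - (norm y)\<^sup>2)"
  unfolding moebius_den_def power2_norm_eq_inner
  by (simp add: inner_diff_left inner_diff_right inner_commute algebra_simps)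

lemma moebius_den_pos: "x \<in> ball 0 1 \<Longrightarrow> y \<in> ball 0 1 \<Longrightarrow> 0 < moebius_den x y"
  unfolding moebius_den_alt by (intro add_nonneg_pos mult_pos_pos) (auto simp: power_less_one_iff abs_square_less_1)

lemma moebius_eq:
  "moebius x y = ((1 - (norm x)\<^sup>2) *\<^sub>R (y - x) - (norm (y - x))\<^sup>2 *\<^sub>R x) /\<^sub>R moebius_den x y"
proof (cases "x = 0")
  case False
  then have x: "norm x \<noteq> 0" "x \<bullet> x \<noteq> 0" by auto
  have "(norm x)\<^sup>2 * (norm (y - x /\<^sub>R (norm x)\<^sup>2))\<^sup>2 = moebius_den x y"
    using x unfolding moebius_den_def power2_norm_eq_inner
    by (simp add: inner_diff_left inner_diff_right inner_commute field_simps power2_eq_square)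
  then show ?thesis
    using False by (simp add: moebius_def)
qed (simp add: moebius_def moebius_den_def)

lemma moebius_self: "moebius x x = 0"
  by (simp add: moebius_eq)

lemma norm_moebius_sq:
  assumes "x \<in> ball 0 1" "y \<in> ball 0 1"
  shows "(norm (moebius x y))\<^sup>2 = (norm (y - x))\<^sup>2 / moebius_den x y"
proof -
  define N where "N = (1 - (norm x)\<^sup>2) *\<^sub>R (y - x) - (norm (y - x))\<^sup>2 *\<^sub>R x"
  have "(norm N)\<^sup>2 = (norm (y - x))\<^sup>2 * moebius_den x y"
    unfolding moebius_den_def power2_norm_eq_inner N_def
    by (simp add: inner_diff_left inner_diff_right inner_commute) algebra
  moreover have "norm (moebius x y) = norm N / moebius_den x y"
    using moebius_den_pos[OF assms] by (simp add: moebius_eq N_def divide_inverse_commute)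
  ultimately show ?thesis
    using moebius_den_pos[OF assms] by (simp add: power_divide power2_eq_square)
qed

lemma one_minus_norm_moebius_sq:
  assumes "x \<in> ball 0 1" "y \<in> ball 0 1"
  shows "1 - (norm (moebius x y))\<^sup>2 = (1 - (norm x)\<^sup>2) * (1 - (norm y)\<^sup>2) / moebius_den x y"
  using moebius_den_pos[OF assms] unfolding norm_moebius_sq[OF assms]
  by (simp add: field_simps) (simp add: moebius_den_alt algebra_simps)

lemma moebius_in_ball:
  assumes "x \<in> ball 0 1" "y \<in> ball 0 1"
  shows "moebius x y \<in> ball 0 1"
proof -
  have "0 < 1 - (norm (moebius x y))\<^sup>2"
    unfolding one_minus_norm_moebius_sq[OF assms]
    using assms moebius_den_pos[OF assms] by (intro divide_pos_pos mult_pos_pos) (auto simp: abs_square_less_1)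
  then show ?thesis
    by (simp add: abs_square_less_1)
qed

definition inversion :: "'a::real_inner \<Rightarrow> 'a" where
  "inversion v = v /\<^sub>R (v \<bullet> v)"

lemma inversion_inversion: "inversion (inversion v) = v"
  by (cases "v = 0") (auto simp: inversion_def field_simps)

text \<open>Up to translations and a dilation, \<open>T\<^sub>x\<close> is a composition of two inversions; injectivity is
immediate from this form.\<close>

lemma moebius_eq_inversion:
  assumes "y \<noteq> x"
  shows "moebius x y = inversion ((1 - (norm x)\<^sup>2) *\<^sub>R inversion (y - x) - x)"
proof -
  define v where "v = y - x"
  define a where "a = 1 - (norm x)\<^sup>2"
  have v: "v \<bullet> v \<noteq> 0"
    using assms by (simp add: v_def)
  define p where "p = a *\<^sub>R inversion v - x"
  have den: "moebius_den x y = (v \<bullet> v) * (p \<bullet> p)"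
  proof -
    have "(v \<bullet> v) * (p \<bullet> p) = a * a - 2 * a * (v \<bullet> x) + (v \<bullet> v) * (x \<bullet> x)"
      using v unfolding p_def inversion_def
      by (simp add: inner_diff_left inner_diff_right inner_commute field_simps)
    moreover have "moebius_den x y = v \<bullet> v + a * (1 - y \<bullet> y)"
      by (simp add: moebius_den_alt v_def a_def power2_norm_eq_inner)
    moreover have "y \<bullet> y = v \<bullet> v + 2 * (v \<bullet> x) + x \<bullet> x"
      by (simp add: v_def inner_diff_left inner_diff_right inner_commute)
    moreover have "a = 1 - x \<bullet> x"
      by (simp add: a_def power2_norm_eq_inner)
    ultimately show ?thesis
      by algebra
  qed
  have "a *\<^sub>R v - (norm v)\<^sup>2 *\<^sub>R x = (v \<bullet> v) *\<^sub>R p"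
    using v by (simp add: p_def inversion_def scaleR_diff_right power2_norm_eq_inner)
  then have "moebius x y = ((v \<bullet> v) *\<^sub>R p) /\<^sub>R ((v \<bullet> v) * (p \<bullet> p))"
    unfolding moebius_eq den by (simp add: v_def a_def)
  also have "\<dots> = inversion p"
    using v by (simp add: inversion_def)
  finally show ?thesis
    by (simp add: p_def v_def a_def)
qed

lemma inj_on_moebius:
  assumes x: "x \<in> ball 0 1"
  shows "inj_on (moebius x) (ball 0 1)"
proof (rule inj_onI)
  fix y z assume y: "y \<in> ball 0 1" and z: "z \<in> ball 0 1" and eq: "moebius x y = moebius x z"
  have zero: "moebius x w = 0 \<longleftrightarrow> w = x" if "w \<in> ball 0 1" for w
    using norm_moebius_sq[OF x that] moebius_den_pos[OF x that] by (auto simp: moebius_self)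
  show "y = z"
  proof (cases "y = x \<or> z = x")
    case True
    then show ?thesis
      using zero[OF y] zero[OF z] eq by auto
  next
    case False
    have "(norm x)\<^sup>2 < 1"
      using x by (simp add: abs_square_less_1)
    then have a: "1 - (norm x)\<^sup>2 \<noteq> 0"
      by simp
    have "(1 - (norm x)\<^sup>2) *\<^sub>R inversion (y - x) - x = (1 - (norm x)\<^sup>2) *\<^sub>R inversion (z - x) - x"
      using eq False moebius_eq_inversion[of y x] moebius_eq_inversion[of z x] by (metis inversion_inversion)
    then have "inversion (y - x) = inversion (z - x)"
      using a by simp
    then have "y - x = z - x"
      by (metis inversion_inversion)
    then show ?thesis by simp
  qed
qed

lemma moebius_inv_moebius:
  assumes "x \<in> ball 0 1" "y \<in> ball 0 1"
  shows "moebius_inv x (moebius x y) = y"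
  unfolding moebius_inv_def by (rule inv_into_f_f[OF inj_on_moebius[OF assms(1)] assms(2)])

lemma moebius_inv_0: "x \<in> ball 0 1 \<Longrightarrow> moebius_inv x 0 = x"
  using moebius_inv_moebius[of x x] by (simp add: moebius_self)

text \<open>This places each layer of a Carleson box in a Moebius ball. Combine
\<open>1 - |T\<^sub>x y|^2 = (1 - |x|^2)(1 - |y|^2) / moebius_den x y\<close> with \<open>moebius_den x y \<le> 8 \<rho>^2\<close>,
which holds since \<open>x\<close> has distance \<open>\<rho>\<close> from \<open>\<omega>\<close>; for \<open>r \<ge> 1\<close> the centre is \<open>x = 0\<close>.\<close>

lemma one_minus_norm_moebius_ge:
  fixes \<omega> :: "real^'n"
  assumes \<omega>: "norm \<omega> = 1" and r: "0 < r" and y: "norm y < 1" "dist \<omega> y < r"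
  defines "\<rho> \<equiv> min r 1"
  shows "(1 - norm y) / (16 * \<rho>) \<le> 1 - norm (moebius ((1 - \<rho>) *\<^sub>R \<omega>) y)"
proof -
  define x where "x = (1 - \<rho>) *\<^sub>R \<omega>"
  have \<rho>: "0 < \<rho>" "\<rho> \<le> 1"
    using r by (auto simp: \<rho>_def)
  have nx: "norm x = 1 - \<rho>"
    using \<rho> \<omega> by (simp add: x_def)
  have x: "x \<in> ball 0 1" and yb: "y \<in> ball 0 1"
    using nx \<rho> y by auto
  have xa: "1 - (norm x)\<^sup>2 = \<rho> * (2 - \<rho>)"
    by (simp add: nx power2_eq_square algebra_simps)
  have ya: "1 - (norm y)\<^sup>2 = (1 - norm y) * (1 + norm y)"
    by (simp add: power2_eq_square algebra_simps)
  have den: "moebius_den x y \<le> 8 * \<rho>\<^sup>2"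
  proof (cases "r \<le> 1")
    case True
    then have \<rho>r: "\<rho> = r"
      by (simp add: \<rho>_def)
    have "1 - norm y \<le> dist \<omega> y"
      using norm_triangle_ineq2[of \<omega> y] \<omega> by (simp add: dist_norm)
    then have y1: "1 - norm y \<le> \<rho>"
      using y \<rho>r by simp
    have "norm (y - x) \<le> dist \<omega> y + norm (\<omega> - x)"
      using dist_triangle3[of y x \<omega>] by (simp add: dist_norm)
    also have "\<omega> - x = \<rho> *\<^sub>R \<omega>"
      by (simp add: x_def algebra_simps)
    finally have "norm (y - x) \<le> 2 * \<rho>"
      using \<omega> \<rho> y \<rho>r by simp
    then have "(norm (y - x))\<^sup>2 \<le> (2 * \<rho>)\<^sup>2"
      by (intro power_mono) auto
    moreover have "(1 - (norm x)\<^sup>2) * (1 - (norm y)\<^sup>2) \<le> (\<rho> * 2) * (\<rho> * 2)"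
      unfolding xa ya using \<rho> y y1 by (intro mult_mono) auto
    ultimately show ?thesis
      unfolding moebius_den_alt by (simp add: power2_eq_square)
  next
    case False
    then have "\<rho> = 1"
      by (simp add: \<rho>_def)
    then show ?thesis
      by (simp add: x_def moebius_den_def)
  qed
  let ?N = "norm (moebius x y)"
  have N: "?N < 1" "0 \<le> ?N"
    using moebius_in_ball[OF x yb] by auto
  have "(1 - norm y) / (8 * \<rho>) = \<rho> * (1 - norm y) / (8 * \<rho>\<^sup>2)"
    using \<rho> by (simp add: power2_eq_square)
  also have "\<dots> \<le> (1 - (norm x)\<^sup>2) * (1 - (norm y)\<^sup>2) / moebius_den x y"
  proof (rule frac_le)
    have "\<rho> * 1 \<le> \<rho> * (2 - \<rho>)" "(1 - norm y) * 1 \<le> (1 - norm y) * (1 + norm y)"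
      using \<rho> y by (intro mult_left_mono; simp)+
    then show "\<rho> * (1 - norm y) \<le> (1 - (norm x)\<^sup>2) * (1 - (norm y)\<^sup>2)"
      unfolding xa ya using \<rho> y by (intro mult_mono) auto
    then show "0 \<le> (1 - (norm x)\<^sup>2) * (1 - (norm y)\<^sup>2)"
      using \<rho> y by (smt (verit, best) mult_nonneg_nonneg)
  qed (use den moebius_den_pos[OF x yb] in auto)
  also have "\<dots> = (1 - ?N) * (1 + ?N)"
    unfolding one_minus_norm_moebius_sq[OF x yb, symmetric] by (simp add: power2_eq_square algebra_simps)
  also have "\<dots> \<le> (1 - ?N) * 2"
    using N by (intro mult_left_mono) auto
  finally show ?thesis
    by (simp add: x_def field_simps)
qed


definition cap_sector :: "real^'n \<Rightarrow> real \<Rightarrow> (real^'n) set" where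
  "cap_sector \<omega> s = {y. norm y < 1 \<and> dist (sgn y) \<omega> < s}"

lemma sets_cap_sector: "cap_sector \<omega> s \<in> sets borel"
proof -
  have "{y. norm y < 1 \<and> dist (y /\<^sub>R norm y) \<omega> < s} \<in> sets borel"
    by measurable
  then show ?thesis
    by (simp add: cap_sector_def sgn_div_norm)
qed

lemma cap_sector_lmeasurable: "cap_sector \<omega> s \<in> lmeasurable"
proof (rule bounded_set_imp_lmeasurable)
  show "bounded (cap_sector \<omega> s)"
    by (rule bounded_subset[of "ball 0 1"]) (auto simp: cap_sector_def)
qed (use sets_cap_sector[of \<omega> s] in simp)

text \<open>A dilation by \<open>t\<close> maps the sector onto its part of norm less than \<open>t\<close>, so the volume of a
shell follows from the scaling of Lebesgue measure.\<close>

lemma measure_cap_sector_shell: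
  fixes \<omega> :: "real^'n"
  assumes t: "0 \<le> t" "t \<le> 1"
  shows "measure lebesgue {y \<in> cap_sector \<omega> s. t \<le> norm y} = (1 - t ^ CARD('n)) * measure lebesgue (cap_sector \<omega> s)"
proof (cases "t = 0")
  case True
  then show ?thesis
    by simp
next
  case False
  then have t0: "0 < t"
    using t by simp
  have scaled: "(\<lambda>y. t *\<^sub>R y + 0) ` cap_sector \<omega> s = {y \<in> cap_sector \<omega> s. norm y < t}"
  proof (intro equalityI subsetI)
    fix y assume "y \<in> {y \<in> cap_sector \<omega> s. norm y < t}"
    then have "y /\<^sub>R t \<in> cap_sector \<omega> s"
      using t0 by (simp add: cap_sector_def sgn_scaleR sgn_div_norm field_simps)
    then show "y \<in> (\<lambda>y. t *\<^sub>R y + 0) ` cap_sector \<omega> s"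
      using t0 by (intro image_eqI[of _ _ "y /\<^sub>R t"]) auto
  next
    fix y assume "y \<in> (\<lambda>y. t *\<^sub>R y + 0) ` cap_sector \<omega> s"
    then obtain z where z: "z \<in> cap_sector \<omega> s" "y = t *\<^sub>R z"
      by auto
    then have "norm y < t" "sgn y = sgn z"
      using t0 by (simp_all add: cap_sector_def sgn_div_norm)
    then show "y \<in> {y \<in> cap_sector \<omega> s. norm y < t}"
      using z t by (auto simp: cap_sector_def)
  qed
  have "measure lebesgue {y \<in> cap_sector \<omega> s. norm y < t} = t ^ CARD('n) * measure lebesgue (cap_sector \<omega> s)"
    using measure_lebesgue_affine[of t 0 "cap_sector \<omega> s"] t unfolding scaled by simp
  moreover have "{y \<in> cap_sector \<omega> s. t \<le> norm y} = cap_sector \<omega> s - {y \<in> cap_sector \<omega> s. norm y < t}"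
    by auto
  moreover have "{y \<in> cap_sector \<omega> s. norm y < t} \<in> lmeasurable"
  proof -
    have "{y \<in> cap_sector \<omega> s. norm y < t} = cap_sector \<omega> s \<inter> ball 0 t"
      by auto
    then show ?thesis
      using cap_sector_lmeasurable[of \<omega> s] by (simp add: fmeasurable.Int)
  qed
  ultimately show ?thesis
    using cap_sector_lmeasurable[of \<omega> s] by (simp add: measurable_measure_Diff fmeasurableD algebra_simps)
qed

text \<open>The outer shell of thickness \<open>\<rho>\<close> carries at least the fraction \<open>\<rho>\<close> of the volume of the
sector, and fits into a ball of radius \<open>4 \<rho>\<close>.\<close>

lemma measure_cap_sector_le:
  fixes \<omega> :: "real^'n"
  assumes \<omega>: "norm \<omega> = 1" and \<rho>: "0 < \<rho>" "\<rho> \<le> 1"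
  shows "measure lebesgue (cap_sector \<omega> (3 * \<rho>)) \<le> 4 ^ CARD('n) * measure lborel (ball (0 :: real^'n) 1) * \<rho> ^ (CARD('n) - 1)"
proof -
  let ?S = "cap_sector \<omega> (3 * \<rho>)"
  have n: "CARD('n) = Suc (CARD('n) - 1)"
    by simp
  have "(1 - \<rho>) ^ CARD('n) \<le> 1 - \<rho>"
    using \<rho> by (subst n, subst power_Suc) (intro mult_left_le power_le_one, auto)
  then have "\<rho> * measure lebesgue ?S \<le> (1 - (1 - \<rho>) ^ CARD('n)) * measure lebesgue ?S"
    by (intro mult_right_mono) auto
  also have "\<dots> = measure lebesgue {y \<in> ?S. 1 - \<rho> \<le> norm y}"
    using \<rho> by (intro measure_cap_sector_shell[symmetric]) auto
  also have "\<dots> \<le> measure lebesgue (ball \<omega> (4 * \<rho>))"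
  proof (rule measure_mono_fmeasurable)
    show "{y \<in> ?S. 1 - \<rho> \<le> norm y} \<subseteq> ball \<omega> (4 * \<rho>)"
    proof
      fix y assume y: "y \<in> {y \<in> ?S. 1 - \<rho> \<le> norm y}"
      have "norm (sgn y - y) \<le> \<rho>"
      proof (cases "y = 0")
        case False
        have "sgn y - y = (1 - norm y) *\<^sub>R sgn y"
          using False by (simp add: sgn_div_norm algebra_simps)
        then have "norm (sgn y - y) = 1 - norm y"
          using False y by (simp add: norm_sgn cap_sector_def)
        then show ?thesis
          using y by simp
      qed (use \<rho> in simp)
      then have "dist \<omega> y < 4 * \<rho>"
        using y dist_triangle[of \<omega> y "sgn y"] by (simp add: cap_sector_def dist_norm norm_minus_commute)
      then show "y \<in> ball \<omega> (4 * \<rho>)"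
        by simp
    qed
    have "{y \<in> ?S. 1 - \<rho> \<le> norm y} = ?S - ball 0 (1 - \<rho>)"
      by auto
    then show "{y \<in> ?S. 1 - \<rho> \<le> norm y} \<in> sets lebesgue"
      using sets_cap_sector[of \<omega> "3 * \<rho>"] by simp
  qed simp
  also have "\<dots> = 4 ^ CARD('n) * measure lborel (ball (0 :: real^'n) 1) * \<rho> ^ CARD('n)"
    using \<rho> content_ball_conv_unit_ball[of "4 * \<rho>" \<omega>] by (simp add: power_mult_distrib)
  also have "\<dots> = \<rho> * (4 ^ CARD('n) * measure lborel (ball (0 :: real^'n) 1) * \<rho> ^ (CARD('n) - 1))"
    by (subst (2) n, subst power_Suc) simp
  finally show ?thesis
    using \<rho> by simp
qed

text \<open>Radial projection moves a point of the box by at most its distance to the sphere, so a box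
of radius \<open>r\<close> lies in the sector of opening \<open>3 \<rho>\<close>, and a shell of thickness \<open>\<delta>\<close> takes at
most the fraction \<open>n \<delta>\<close> of its volume by Bernoulli's inequality.\<close>

lemma emeasure_box_layer_le:
  fixes \<omega> :: "real^'n"
  assumes \<omega>: "norm \<omega> = 1" and r: "0 < r" and \<delta>: "0 < \<delta>" "\<delta> \<le> 1"
  defines "\<rho> \<equiv> min r 1"
  assumes L: "L \<subseteq> {y \<in> ball 0 1 \<inter> ball \<omega> r. 1 - \<delta> \<le> norm y}"
  shows "emeasure lebesgue L \<le>
    ennreal (CARD('n) * 4 ^ CARD('n) * measure lborel (ball (0 :: real^'n) 1) * \<rho> ^ (CARD('n) - 1) * \<delta>)"
proof -
  have \<rho>: "0 < \<rho>" "\<rho> \<le> 1"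
    using r by (auto simp: \<rho>_def)
  let ?S = "cap_sector \<omega> (3 * \<rho>)"
  let ?T = "{y \<in> ?S. 1 - \<delta> \<le> norm y}"
  have T_eq: "?T = ?S - ball 0 (1 - \<delta>)"
    by auto
  have T: "?T \<in> lmeasurable"
    unfolding T_eq using cap_sector_lmeasurable by (intro fmeasurable.Diff) auto
  have "L \<subseteq> ?T"
  proof
    fix y assume y: "y \<in> L"
    have "dist (sgn y) \<omega> < 3 * \<rho>"
    proof (cases "r \<le> 1")
      case True
      then have \<rho>r: "\<rho> = r"
        by (simp add: \<rho>_def)
      have "1 - norm y \<le> dist \<omega> y"
        using norm_triangle_ineq2[of \<omega> y] \<omega> by (simp add: dist_norm)
      then have y1: "1 - norm y < \<rho>"
        using y L \<rho>r by auto
      then have "y \<noteq> 0"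
        using \<rho> by auto
      have "sgn y - y = (1 - norm y) *\<^sub>R sgn y"
        using \<open>y \<noteq> 0\<close> by (simp add: sgn_div_norm algebra_simps)
      then have "norm (sgn y - y) < \<rho>"
        using \<open>y \<noteq> 0\<close> y L y1 by (auto simp: norm_sgn)
      moreover have "dist \<omega> y < \<rho>"
        using y L \<rho>r by auto
      ultimately have "dist (sgn y) \<omega> < 2 * \<rho>"
        using dist_triangle[of "sgn y" \<omega> y] by (simp add: dist_norm norm_minus_commute)
      then show ?thesis
        using \<rho> by simp
    next
      case False
      have "dist (sgn y) \<omega> \<le> norm (sgn y) + norm \<omega>"
        by (simp add: dist_norm norm_triangle_ineq4)
      also have "\<dots> \<le> 2"
        using \<omega> by (simp add: norm_sgn)
      finally show ?thesis
        using False by (simp add: \<rho>_def)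
    qed
    then show "y \<in> ?T"
      using y L by (auto simp: cap_sector_def)
  qed
  then have "emeasure lebesgue L \<le> emeasure lebesgue ?T"
    by (rule emeasure_mono) (rule fmeasurableD[OF T])
  also have "\<dots> = ennreal (measure lebesgue ?T)"
    by (rule emeasure_eq_ennreal_measure[OF fmeasurableD2[OF T]])
  also have "measure lebesgue ?T = (1 - (1 - \<delta>) ^ CARD('n)) * measure lebesgue ?S"
    using \<delta> by (intro measure_cap_sector_shell) auto
  also have "ennreal \<dots> \<le> ennreal ((CARD('n) * \<delta>) *
      (4 ^ CARD('n) * measure lborel (ball (0 :: real^'n) 1) * \<rho> ^ (CARD('n) - 1)))"
  proof (intro ennreal_leI mult_mono measure_cap_sector_le \<omega> \<rho>)
    show "1 - (1 - \<delta>) ^ CARD('n) \<le> CARD('n) * \<delta>"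
      using Bernoulli_inequality[of "- \<delta>" "CARD('n)"] \<delta> by simp
  qed (use \<delta> in auto)
  finally show ?thesis
    by (simp add: mult_ac)
qed

section \<open>Multiplicity, growth and elementary estimates on a layer\<close>

lemma emeasure_count_space_inj_mono:
  assumes "inj_on g A" "g ` A \<subseteq> B"
  shows "emeasure (count_space UNIV) A \<le> emeasure (count_space UNIV) B"
proof -
  have "emeasure (count_space UNIV) A = emeasure (count_space UNIV) (g ` A)"
    using assms(1) by (cases "finite A") (auto simp: card_image finite_image_iff)
  also have "\<dots> \<le> emeasure (count_space UNIV) B"
    using assms(2) by (intro emeasure_mono) auto
  finally show ?thesis .
qed

text \<open>\<open>T\<^sub>x\<close> maps the fibre of \<open>f\<close> injectively into the fibre of \<open>f \<circ> T\<^sub>x^(-1)\<close>.\<close>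

lemma multiplicity_condition_moebius_ball:
  assumes M: "multiplicity_condition C a f" and x: "x \<in> ball 0 1" and s: "0 < s" "s < 1"
    and L: "L \<subseteq> ball 0 1" "\<And>y. y \<in> L \<Longrightarrow> norm (moebius x y) < s"
  shows "emeasure (count_space UNIV) {y \<in> L. f y = w} \<le> ennreal (C * (1 - s) powr (- a))"
proof -
  have "emeasure (count_space UNIV) {y \<in> L. f y = w}
      \<le> emeasure (count_space UNIV) {z \<in> ball 0 s. (f \<circ> moebius_inv x) z = w}"
  proof (rule emeasure_count_space_inj_mono)
    show "inj_on (moebius x) {y \<in> L. f y = w}"
      using L(1) by (intro inj_on_subset[OF inj_on_moebius[OF x]]) auto
    show "moebius x ` {y \<in> L. f y = w} \<subseteq> {z \<in> ball 0 s. (f \<circ> moebius_inv x) z = w}"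
    proof
      fix z assume "z \<in> moebius x ` {y \<in> L. f y = w}"
      then obtain y where y: "y \<in> L" "f y = w" "z = moebius x y"
        by blast
      moreover have "moebius_inv x z = y"
        unfolding y(3) using y(1) L(1) by (intro moebius_inv_moebius x) auto
      ultimately show "z \<in> {z \<in> ball 0 s. (f \<circ> moebius_inv x) z = w}"
        using L(2)[of y] by simp
    qed
  qed
  also have "\<dots> \<le> multiplicity_on (f \<circ> moebius_inv x) (ball 0 s)"
    unfolding multiplicity_on_def by (rule SUP_upper) simp
  also have "\<dots> \<le> (SUP x\<in>ball 0 1. multiplicity_on (f \<circ> moebius_inv x) (ball 0 s))"
    by (rule SUP_upper[OF x])
  also have "\<dots> \<le> ennreal (C * (1 - s) powr (- a))"
    using M s by (simp add: multiplicity_condition_def)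
  finally show ?thesis .
qed

lemma miniowitz_class_bounds:
  assumes f: "f \<in> miniowitz_class K C0 \<alpha>" and pos: "0 < C0" "0 < \<alpha>"
    and x: "x \<in> ball 0 1" and y: "y \<in> ball 0 1" and t: "0 < t" "norm (moebius x y) \<le> 1 - t"
  shows "norm (f x) / C0 * (t / 2) powr \<alpha> \<le> norm (f y)"
    and "norm (f y) \<le> norm (f x) * (C0 * (2 / t) powr \<alpha>)"
proof -
  let ?z = "norm (moebius x y)"
  have fx: "0 < norm (f x)"
    using f x by (simp add: miniowitz_class_def)
  have *: "1 / C0 * ((1 - ?z) / (1 + ?z)) powr \<alpha> \<le> norm (f y) / norm (f x)"
    "norm (f y) / norm (f x) \<le> C0 * ((1 + ?z) / (1 - ?z)) powr \<alpha>"
  proof -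
    have "\<forall>x\<in>ball 0 1. \<forall>y\<in>ball 0 1.
        1 / C0 * ((1 - norm y) / (1 + norm y)) powr \<alpha> \<le> norm (f (moebius_inv x y)) / norm (f (moebius_inv x 0)) \<and>
        norm (f (moebius_inv x y)) / norm (f (moebius_inv x 0)) \<le> C0 * ((1 + norm y) / (1 - norm y)) powr \<alpha>"
      using f unfolding miniowitz_class_def by (simp only: mem_Collect_eq Let_def o_apply) blast
    from this[THEN bspec, OF x, THEN bspec, OF moebius_in_ball[OF x y]]
    show "1 / C0 * ((1 - ?z) / (1 + ?z)) powr \<alpha> \<le> norm (f y) / norm (f x)"
      "norm (f y) / norm (f x) \<le> C0 * ((1 + ?z) / (1 - ?z)) powr \<alpha>"
      unfolding moebius_inv_moebius[OF x y] moebius_inv_0[OF x] by blast+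
  qed
  have z: "0 \<le> ?z" "?z < 1"
    using t norm_ge_zero[of "moebius x y"] by (auto simp del: norm_ge_zero)
  have z': "0 < 1 + ?z"
    by (rule add_pos_nonneg) auto
  have "(t / 2) powr \<alpha> \<le> ((1 - ?z) / (1 + ?z)) powr \<alpha>"
    using t z z' pos by (intro powr_mono2 frac_le) auto
  then have "1 / C0 * (t / 2) powr \<alpha> \<le> norm (f y) / norm (f x)"
    using *(1) pos by (meson divide_nonneg_nonneg less_imp_le mult_left_mono order_trans zero_le_one)
  then show "norm (f x) / C0 * (t / 2) powr \<alpha> \<le> norm (f y)"
    using fx by (simp add: field_simps)
  have "((1 + ?z) / (1 - ?z)) powr \<alpha> \<le> (2 / t) powr \<alpha>"
    using t z z' pos by (intro powr_mono2 frac_le) auto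
  then have "norm (f y) / norm (f x) \<le> C0 * (2 / t) powr \<alpha>"
    using *(2) pos by (meson less_imp_le mult_left_mono order_trans)
  then show "norm (f y) \<le> norm (f x) * (C0 * (2 / t) powr \<alpha>)"
    using fx by (simp add: field_simps)
qed

lemma opnorm_nonneg: "0 \<le> opnorm A"
  unfolding opnorm_def by (rule onorm_pos_le) (rule matrix_vector_mul_bounded_linear)

lemma continuous_on_opnorm: "continuous_on UNIV (opnorm :: real^'n^'n \<Rightarrow> real)"
proof -
  define B where "B = real CARD('n) * real CARD('n)"
  have le: "opnorm X \<le> opnorm Y + B * norm (X - Y)" for X Y :: "real^'n^'n"
  proof -
    have "\<bar>(X - Y) $ i $ j\<bar> \<le> norm (X - Y)" for i j
      by (metis Finite_Cartesian_Product.norm_nth_le order_trans real_norm_def)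
    then have "opnorm (X - Y) \<le> B * norm (X - Y)"
      unfolding opnorm_def B_def by (rule onorm_le_matrix_component)
    moreover have "opnorm X \<le> opnorm Y + opnorm (X - Y)"
      unfolding opnorm_def
      using onorm_triangle[OF matrix_vector_mul_bounded_linear[of Y] matrix_vector_mul_bounded_linear[of "X - Y"]]
      by (simp add: matrix_vector_mult_add_rdistrib[symmetric])
    ultimately show ?thesis by simp
  qed
  have "dist (opnorm X) (opnorm Y) \<le> B * dist X Y" for X Y :: "real^'n^'n"
    using le[of X Y] le[of Y X] by (simp add: dist_norm norm_minus_commute abs_le_iff)
  then have "B-lipschitz_on UNIV (opnorm :: real^'n^'n \<Rightarrow> real)"
    by (intro lipschitz_onI) (simp_all add: B_def)
  then show ?thesis
    by (rule lipschitz_on_continuous_on)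
qed

text \<open>It plays the role of Hoelder's inequality: the first term bounds \<open>D^q\<close> for \<open>D \<le> s\<close>, the
second one for \<open>D \<ge> s\<close>.\<close>

lemma powr_le_add_power:
  fixes D s q :: real
  assumes D: "0 \<le> D" and s: "0 < s" and q: "0 < q" "q < real n"
  shows "D powr q \<le> s powr q + s powr (q - real n) * D ^ n"
proof (cases "D \<le> s")
  case True
  then have "D powr q \<le> s powr q"
    using D q by (intro powr_mono2) auto
  then show ?thesis
    using D by (simp add: add_increasing2)
next
  case False
  then have "D powr q = D powr (q - real n) * D ^ n"
    using s by (simp add: powr_realpow[symmetric] powr_add[symmetric])
  also have "\<dots> \<le> s powr (q - real n) * D ^ n"
    using False s q D by (intro mult_right_mono powr_mono2') auto
  finally show ?thesis
    by (simp add: add_increasing)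
qed

lemma powr_dyadic_le:
  fixes d \<delta> q :: real
  assumes d: "\<delta> / 2 < d" "d \<le> \<delta>" and \<delta>: "0 < \<delta>" and q: "0 < q"
  shows "d powr (q - 1) \<le> 2 * \<delta> powr (q - 1)"
proof (cases "1 \<le> q")
  case True
  then have "d powr (q - 1) \<le> \<delta> powr (q - 1)"
    using d \<delta> by (intro powr_mono2) auto
  then show ?thesis
    by (smt (verit) powr_ge_zero)
next
  case False
  then have "d powr (q - 1) \<le> (\<delta> / 2) powr (q - 1)"
    using d \<delta> by (intro powr_mono2') auto
  also have "\<dots> = \<delta> powr (q - 1) * 2 powr (1 - q)"
    using \<delta> powr_minus_divide[of 2 "q - 1"] by (simp add: powr_divide)
  also have "\<dots> \<le> \<delta> powr (q - 1) * 2 powr 1"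
    using q by (intro mult_left_mono powr_mono) auto
  finally show ?thesis
    by simp
qed


text \<open>The bookkeeping for the layer at distance \<open>\<delta> = \<rho> / 2^j\<close> from the sphere, whose volume is of
order \<open>\<rho>^(n-1) \<delta>\<close> and on which \<open>\<integral> D^n\<close> is of order \<open>2^(j a)\<close> up to a factor linear in \<open>j\<close>.
The level \<open>s\<close> is the one for which both terms of the splitting have the same size.\<close>

lemma layer_exponents:
  fixes \<rho> q a :: real and j n :: nat
  assumes \<rho>: "0 < \<rho>" and n: "0 < n"
  defines "\<delta> \<equiv> \<rho> / 2 ^ j" and "s \<equiv> 2 powr (real j * (a + 1) / real n) / \<rho>"
    and "\<theta> \<equiv> 2 powr (- (q / real n) * (real n - 1 - a))"
  shows "\<delta> powr (q - 1) * s powr q * (\<rho> ^ (n - 1) * \<delta>) = \<rho> ^ (n - 1) * \<theta> ^ j"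
    and "\<delta> powr (q - 1) * s powr (q - real n) * 2 powr (real j * a) = \<rho> ^ (n - 1) * \<theta> ^ j"
proof -
  have \<delta>: "0 < \<delta>" "\<delta> = \<rho> * 2 powr (- real j)" and s: "0 < s"
    using \<rho> by (simp_all add: \<delta>_def s_def powr_minus_divide powr_realpow)
  have "\<delta> * s = 2 powr (real j * (a + 1) / real n - real j)"
    using \<rho> by (simp add: \<delta>(2) s_def powr_diff powr_minus_divide)
  then have "(\<delta> * s) powr q = 2 powr ((real j * (a + 1) / real n - real j) * q)"
    by (simp add: powr_powr)
  also have "(real j * (a + 1) / real n - real j) * q = (- (q / real n) * (real n - 1 - a)) * real j"
    using n by (simp add: field_simps)
  also have "2 powr ((- (q / real n) * (real n - 1 - a)) * real j) = \<theta> ^ j"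
    unfolding \<theta>_def powr_powr[symmetric] by (simp add: powr_realpow)
  finally have \<theta>: "\<delta> powr q * s powr q = \<theta> ^ j"
    using \<delta>(1) s by (simp add: powr_mult)
  have \<delta>q: "\<delta> powr (q - 1) = \<delta> powr q / \<delta>"
    using \<delta>(1) by (simp add: powr_diff)
  show "\<delta> powr (q - 1) * s powr q * (\<rho> ^ (n - 1) * \<delta>) = \<rho> ^ (n - 1) * \<theta> ^ j"
    using \<delta>(1) by (simp add: \<delta>q \<theta>[symmetric])
  have "s ^ n = 2 powr (real j * (a + 1)) / \<rho> ^ n"
    using n by (simp add: s_def power_divide powr_realpow[symmetric] powr_powr)
  then have "s ^ n * \<delta> * \<rho> ^ (n - 1) = 2 powr (real j * (a + 1)) * 2 powr (- real j) * (\<rho> * \<rho> ^ (n - 1) / \<rho> ^ n)"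
    by (simp add: \<delta>(2))
  also have "\<rho> * \<rho> ^ (n - 1) = \<rho> ^ n"
    using n by (cases n) auto
  also have "2 powr (real j * (a + 1)) * 2 powr (- real j) * (\<rho> ^ n / \<rho> ^ n) = 2 powr (real j * a)"
    using \<rho> by (simp add: powr_add[symmetric] algebra_simps)
  finally have "2 powr (real j * a) = s ^ n * \<delta> * \<rho> ^ (n - 1)" ..
  moreover have "s powr (q - real n) = s powr q / s ^ n"
    using s by (simp add: powr_diff powr_realpow)
  ultimately show "\<delta> powr (q - 1) * s powr (q - real n) * 2 powr (real j * a) = \<rho> ^ (n - 1) * \<theta> ^ j"
    using \<delta>(1) s by (simp add: \<delta>q \<theta>[symmetric])
qed

text \<open>Radii larger than 1 are truncated, as all points of the ball have distance at most 1 to the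
sphere.\<close>

definition box_layer :: "real^'n \<Rightarrow> real \<Rightarrow> nat \<Rightarrow> (real^'n) set" where
  "box_layer \<omega> r j = {y \<in> ball 0 1 \<inter> ball \<omega> r. min r 1 / 2 ^ j / 2 < 1 - norm y \<and> 1 - norm y \<le> min r 1 / 2 ^ j}"

lemma sets_box_layer: "box_layer \<omega> r j \<in> sets lebesgue"
proof -
  have "box_layer \<omega> r j = ball 0 1 \<inter> ball \<omega> r \<inter> {y. min r 1 / 2 ^ j / 2 < 1 - norm y \<and> 1 - norm y \<le> min r 1 / 2 ^ j}"
    by (auto simp: box_layer_def)
  also have "\<dots> \<in> sets borel"
    by measurable
  finally show ?thesis
    by simp
qed

lemma box_layer_subset_ball: "box_layer \<omega> r j \<subseteq> ball 0 1"
  by (auto simp: box_layer_def)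

lemma box_layer_width: "0 < r \<Longrightarrow> 0 < min r 1 / 2 ^ j \<and> min r 1 / 2 ^ j \<le> (1 :: real)"
  using order_trans[of "min r 1" 1 "2 ^ j"] by simp

lemma box_layer_cover:
  assumes \<omega>: "norm \<omega> = 1" and r: "0 < r"
  shows "ball 0 1 \<inter> ball \<omega> r \<subseteq> (\<Union>j. box_layer \<omega> r j)"
proof
  fix y assume y: "y \<in> ball 0 1 \<inter> ball \<omega> r"
  define d where "d = 1 - norm y"
  define \<rho> where "\<rho> = min r 1"
  have \<rho>: "0 < \<rho>"
    using r by (simp add: \<rho>_def)
  have "1 - norm y \<le> dist \<omega> y"
    using norm_triangle_ineq2[of \<omega> y] \<omega> by (simp add: dist_norm)
  then have d: "0 < d" "d \<le> \<rho>"
    using y by (auto simp: d_def \<rho>_def)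
  have ex: "\<exists>j. \<rho> / 2 ^ j / 2 < d"
  proof -
    obtain j where "(1/2 :: real) ^ j < d / \<rho>"
      using real_arch_pow_inv[of "d / \<rho>" "1/2"] d \<rho> by auto
    then have "\<rho> / 2 ^ j < d"
      using \<rho> by (simp add: field_simps power_divide)
    moreover have "e / 2 < d" if "e < d" for e
      using that d(1) by (cases "0 \<le> e") auto
    ultimately show ?thesis
      by blast
  qed
  define j where "j = (LEAST j. \<rho> / 2 ^ j / 2 < d)"
  have "\<rho> / 2 ^ j / 2 < d"
    unfolding j_def using ex by (rule LeastI_ex)
  moreover have "d \<le> \<rho> / 2 ^ j"
  proof (cases j)
    case (Suc i)
    then have "i < (LEAST j. \<rho> / 2 ^ j / 2 < d)"
      unfolding j_def[symmetric] by simp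
    then have "\<not> \<rho> / 2 ^ i / 2 < d"
      by (rule not_less_Least)
    then show ?thesis
      by (simp add: Suc mult.commute)
  qed (use d in simp)
  ultimately have "y \<in> box_layer \<omega> r j"
    using y by (simp add: box_layer_def \<rho>_def d_def)
  then show "y \<in> (\<Union>j. box_layer \<omega> r j)"
    by blast
qed

text \<open>\<open>C0^2 (2^(j+7))^(2 \<alpha>)\<close> will be the quotient of the radii of the ring containing the image
of the layer with number \<open>j\<close>, so the number of dyadic shells grows linearly in \<open>j\<close>.\<close>

lemma dyadic_shell_count:
  fixes C0 \<alpha> :: real and j :: nat
  assumes "0 < C0" "0 < \<alpha>"
  obtains m :: nat where "C0\<^sup>2 * (2 ^ (j + 7)) powr (2 * \<alpha>) < 2 ^ m"
    "real m \<le> (\<bar>log 2 (C0\<^sup>2)\<bar> + 14 * \<alpha> + 2) * real (Suc j)"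
proof -
  define P where "P = log 2 (C0\<^sup>2)"
  define m where "m = nat \<lceil>P + 2 * \<alpha> * real (j + 7)\<rceil> + 1"
  show thesis
  proof
    have "(2 :: real) ^ (j + 7) = 2 powr real (j + 7)"
      by (rule powr_realpow[symmetric]) simp
    moreover have "C0\<^sup>2 = 2 powr P"
      using assms by (simp add: P_def)
    ultimately have "C0\<^sup>2 * (2 ^ (j + 7)) powr (2 * \<alpha>) = 2 powr P * 2 powr (2 * \<alpha> * real (j + 7))"
      by (simp only: powr_powr mult.commute)
    also have "\<dots> = 2 powr (P + 2 * \<alpha> * real (j + 7))"
      by (simp add: powr_add)
    also have "\<dots> < 2 powr (real m)"
      unfolding m_def by (intro powr_less_mono) linarith+
    also have "\<dots> = 2 ^ m"
      by (simp add: powr_realpow)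
    finally show "C0\<^sup>2 * (2 ^ (j + 7)) powr (2 * \<alpha>) < 2 ^ m" .
    have "P + 2 * \<alpha> * real (j + 7) \<le> \<bar>P\<bar> + 2 * \<alpha> * real (j + 7)" "0 \<le> 2 * \<alpha> * real (j + 7)"
      using assms by auto
    then have "real m \<le> \<bar>P\<bar> + 2 * \<alpha> * real (j + 7) + 2"
      unfolding m_def by linarith
    also have "\<dots> \<le> (\<bar>P\<bar> + 14 * \<alpha> + 2) * real (Suc j)"
      using assms by (simp add: algebra_simps)
    finally show "real m \<le> (\<bar>log 2 (C0\<^sup>2)\<bar> + 14 * \<alpha> + 2) * real (Suc j)"
      by (simp add: P_def)
  qed
qed

section \<open>The Carleson estimate\<close>

lemma quasiregular_weak_derivative:
  assumes "quasiregular K f"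
  shows "continuous_on (ball 0 1) f"
    and "has_weak_derivative_on f (weak_derivative (ball 0 1) f) (ball 0 1)"
    and "AE x in lebesgue. x \<in> ball 0 1 \<longrightarrow>
      opnorm (weak_derivative (ball 0 1) f x) ^ CARD('n) \<le> K * det (weak_derivative (ball 0 1) f (x :: real^'n))"
proof -
  show "continuous_on (ball 0 1) f"
    using assms by (simp add: quasiregular_def)
  have "\<exists>G. has_weak_derivative_on f G (ball 0 1)"
    using assms by (simp add: quasiregular_def W1p_loc_def)
  then show "has_weak_derivative_on f (weak_derivative (ball 0 1) f) (ball 0 1)"
    unfolding weak_derivative_def by (rule someI_ex)
  show "AE x in lebesgue. x \<in> ball 0 1 \<longrightarrow>
      opnorm (weak_derivative (ball 0 1) f x) ^ CARD('n) \<le> K * det (weak_derivative (ball 0 1) f x)"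
    using assms by (simp add: quasiregular_def AE_restrict_space_iff)
qed

text \<open>On the layer with number \<open>j\<close> one has \<open>|T\<^sub>x y| < 1 - t\<close> for \<open>t = 2^(-(j+6))\<close>. So the
multiplicity is at most \<open>C t^(-a) = C 2^(6 a) 2^(j a)\<close>, and the image meets at most a
multiple of \<open>j + 1\<close> dyadic shells.\<close>

lemma layer_log_derivative_le:
  fixes f :: "real^'n \<Rightarrow> real^'n"
  assumes f: "f \<in> miniowitz_class K C0 \<alpha>" and M: "multiplicity_condition C a f"
    and pos: "1 \<le> K" "0 < C0" "0 < \<alpha>" "0 < C"
    and \<omega>: "norm \<omega> = 1" and r: "0 < r"
  shows "(\<integral>\<^sup>+y\<in>box_layer \<omega> r j. ennreal ((opnorm (weak_derivative (ball 0 1) f y) / norm (f y)) ^ CARD('n)) \<partial>lebesgue)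
    \<le> ennreal (K * (\<bar>log 2 (C0\<^sup>2)\<bar> + 14 * \<alpha> + 2) * C * 2 powr (6 * a) * (2 ^ CARD('n) * measure lborel (ball (0 :: real^'n) 1))
        * real (Suc j) * 2 powr (real j * a))"
proof -
  define G where "G = weak_derivative (ball 0 1) f"
  define L where "L = box_layer \<omega> r j"
  define \<rho> where "\<rho> = min r 1"
  define \<delta> where "\<delta> = \<rho> / 2 ^ j"
  define V where "V = measure lborel (ball (0 :: real^'n) 1)"
  have qr: "quasiregular K f" and f0: "\<And>x. x \<in> ball 0 1 \<Longrightarrow> f x \<noteq> 0"
    using f by (simp_all add: miniowitz_class_def)
  note cont = quasiregular_weak_derivative(1)[OF qr]
  have hG: "has_weak_derivative_on f G (ball 0 1)"
    unfolding G_def by (rule quasiregular_weak_derivative(2)[OF qr])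
  have \<rho>: "0 < \<rho>" "\<rho> \<le> 1"
    using r by (auto simp: \<rho>_def)
  have \<delta>: "0 < \<delta>" "\<delta> \<le> 1"
    using box_layer_width[OF r, of j] by (simp_all add: \<delta>_def \<rho>_def)
  have L_iff: "y \<in> L \<longleftrightarrow> y \<in> ball 0 1 \<and> y \<in> ball \<omega> r \<and> \<delta> / 2 < 1 - norm y \<and> 1 - norm y \<le> \<delta>" for y
    by (auto simp: L_def box_layer_def \<delta>_def \<rho>_def)
  note L_sets = sets_box_layer[of \<omega> r j, folded L_def]
  note L1 = box_layer_subset_ball[of \<omega> r j, folded L_def]
  have L_ball: "L \<subseteq> ball 0 (1 - \<delta> / 2)"
    by (auto simp: L_iff)
  define x where "x = (1 - \<rho>) *\<^sub>R \<omega>"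
  have x: "x \<in> ball 0 1"
    using \<rho> \<omega> by (simp add: x_def)
  \<comment> \<open>On the layer, \<open>1 - |y| > \<rho> / 2^(j+1)\<close>; dividing by \<open>16 \<rho>\<close> leaves \<open>2^(-(j+5)) = 2 t\<close>, and
    one factor 2 is given away for a strict inequality.\<close>
  define t :: real where "t = 1 / 2 ^ (j + 6)"
  have t: "0 < t" "t < 1"
    by (simp_all add: t_def)
  have Tx: "norm (moebius x y) < 1 - t" if "y \<in> L" for y
  proof -
    have "2 * t = \<delta> / 2 / (16 * \<rho>)"
      using \<rho> by (simp add: t_def \<delta>_def power_add)
    also have "\<dots> \<le> (1 - norm y) / (16 * \<rho>)"
      using that \<rho> by (intro divide_right_mono) (auto simp: L_iff)
    also have "\<dots> \<le> 1 - norm (moebius x y)"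
      unfolding x_def \<rho>_def using that by (intro one_minus_norm_moebius_ge \<omega> r) (auto simp: L_iff)
    finally show ?thesis
      using t by linarith
  qed
  define N where "N = C * t powr (- a)"
  have N: "0 \<le> N"
    using pos by (simp add: N_def)
  have mult: "emeasure (count_space UNIV) {y \<in> L. f y = w} \<le> ennreal N" for w
    using multiplicity_condition_moebius_ball[OF M x _ _ L1, of "1 - t" w] Tx t by (simp add: N_def)
  define c where "c = norm (f x) / C0 * (t / 2) powr \<alpha>"
  have c: "0 < c"
    using f0[OF x] pos t by (simp add: c_def)
  obtain m :: nat where m: "C0\<^sup>2 * (2 ^ (j + 7)) powr (2 * \<alpha>) < 2 ^ m"
    "real m \<le> (\<bar>log 2 (C0\<^sup>2)\<bar> + 14 * \<alpha> + 2) * real (Suc j)"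
    using dyadic_shell_count[OF pos(2,3)] by metis
  have range: "c \<le> norm (f y) \<and> norm (f y) < c * 2 ^ m" if y: "y \<in> L" for y
  proof
    have y1: "y \<in> ball 0 1"
      using y by (simp add: L_iff)
    have Ty: "norm (moebius x y) \<le> 1 - t"
      using Tx[OF y] by simp
    show "c \<le> norm (f y)"
      unfolding c_def by (rule miniowitz_class_bounds(1)[OF f pos(2,3) x y1 t(1) Ty])
    have "norm (f y) \<le> norm (f x) * (C0 * (2 / t) powr \<alpha>)"
      by (rule miniowitz_class_bounds(2)[OF f pos(2,3) x y1 t(1) Ty])
    also have "\<dots> = c * (C0\<^sup>2 * (2 / t) powr (2 * \<alpha>))"
    proof -
      have "(t / 2) powr \<alpha> * (2 / t) powr (2 * \<alpha>) = (2 / t) powr \<alpha>"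
      proof -
        have "(t / 2) powr \<alpha> * (2 / t) powr (2 * \<alpha>) = ((t / 2) powr \<alpha> * (2 / t) powr \<alpha>) * (2 / t) powr \<alpha>"
          unfolding mult_2[of \<alpha>] powr_add by (simp only: mult.assoc)
        also have "(t / 2) powr \<alpha> * (2 / t) powr \<alpha> = 1"
          using t powr_mult[of "t / 2" "2 / t" \<alpha>] by simp
        finally show ?thesis by simp
      qed
      then have "c * (C0\<^sup>2 * (2 / t) powr (2 * \<alpha>)) = norm (f x) / C0 * C0\<^sup>2 * (2 / t) powr \<alpha>"
        by (simp add: c_def mult_ac)
      then show ?thesis
        using pos by (simp add: power2_eq_square)
    qed
    also have "2 / t = 2 ^ (j + 7)"
      by (simp add: t_def power_add)
    also have "c * (C0\<^sup>2 * (2 ^ (j + 7)) powr (2 * \<alpha>)) < c * 2 ^ m"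
      using m(1) c by simp
    finally show "norm (f y) < c * 2 ^ m" .
  qed
  have log_det: "(\<integral>\<^sup>+y\<in>L. ennreal (\<bar>det (G y)\<bar> / norm (f y) ^ CARD('n)) \<partial>lebesgue)
      \<le> of_nat m * (ennreal N * ennreal (2 ^ CARD('n) * V))"
    unfolding V_def
    by (rule nn_integral_log_det_le[OF cont hG _ _ L_sets L_ball mult c range]) (use \<delta> in auto)
  have meas: "(\<lambda>y. ennreal (\<bar>det (G y)\<bar> / norm (f y) ^ CARD('n)) * indicator L y) \<in> borel_measurable lebesgue"
  proof (rule borel_measurable_indicator_lebesgue[OF _ L_sets])
    have "f \<in> borel_measurable (lebesgue_on L)"
      using continuous_on_subset[OF cont L1] L_sets by (rule continuous_imp_measurable_on_sets_lebesgue)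
    then show "(\<lambda>y. \<bar>det (G y)\<bar> / norm (f y) ^ CARD('n)) \<in> borel_measurable (lebesgue_on L)"
      using borel_measurable_det[OF has_weak_derivative_on_measurable[OF hG L1]] by measurable
  qed
  have "(\<integral>\<^sup>+y\<in>L. ennreal ((opnorm (G y) / norm (f y)) ^ CARD('n)) \<partial>lebesgue)
      \<le> (\<integral>\<^sup>+y. ennreal K * (ennreal (\<bar>det (G y)\<bar> / norm (f y) ^ CARD('n)) * indicator L y) \<partial>lebesgue)"
  proof (rule nn_integral_mono_AE)
    show "AE y in lebesgue. ennreal ((opnorm (G y) / norm (f y)) ^ CARD('n)) * indicator L y
        \<le> ennreal K * (ennreal (\<bar>det (G y)\<bar> / norm (f y) ^ CARD('n)) * indicator L y)"
      using quasiregular_weak_derivative(3)[OF qr]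
    proof eventually_elim
      fix y assume *: "y \<in> ball 0 1 \<longrightarrow>
        opnorm (weak_derivative (ball 0 1) f y) ^ CARD('n) \<le> K * det (weak_derivative (ball 0 1) f y)"
      show "ennreal ((opnorm (G y) / norm (f y)) ^ CARD('n)) * indicator L y
        \<le> ennreal K * (ennreal (\<bar>det (G y)\<bar> / norm (f y) ^ CARD('n)) * indicator L y)"
      proof (cases "y \<in> L")
        case True
        then have "opnorm (G y) ^ CARD('n) \<le> K * det (G y)"
          using * L1 by (auto simp: G_def)
        also have "\<dots> \<le> K * \<bar>det (G y)\<bar>"
          using pos by (intro mult_left_mono) auto
        finally have "(opnorm (G y) / norm (f y)) ^ CARD('n) \<le> K * (\<bar>det (G y)\<bar> / norm (f y) ^ CARD('n))"
          by (simp add: power_divide divide_right_mono)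
        then have "ennreal ((opnorm (G y) / norm (f y)) ^ CARD('n)) \<le> ennreal (K * (\<bar>det (G y)\<bar> / norm (f y) ^ CARD('n)))"
          by (rule ennreal_leI)
        also have "\<dots> = ennreal K * ennreal (\<bar>det (G y)\<bar> / norm (f y) ^ CARD('n))"
          using pos by (intro ennreal_mult) auto
        finally show ?thesis
          using True by simp
      qed simp
    qed
  qed
  also have "\<dots> = ennreal K * (\<integral>\<^sup>+y\<in>L. ennreal (\<bar>det (G y)\<bar> / norm (f y) ^ CARD('n)) \<partial>lebesgue)"
    by (rule nn_integral_cmult[OF meas])
  also have "\<dots> \<le> ennreal K * (of_nat m * (ennreal N * ennreal (2 ^ CARD('n) * V)))"
    using log_det by (rule mult_left_mono) simp
  also have "\<dots> = ennreal (K * (real m * (N * (2 ^ CARD('n) * V))))"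
    using pos N by (simp add: ennreal_mult V_def ennreal_of_nat_eq_real_of_nat)
  also have "\<dots> \<le> ennreal (K * (\<bar>log 2 (C0\<^sup>2)\<bar> + 14 * \<alpha> + 2) * C * 2 powr (6 * a) * (2 ^ CARD('n) * V)
        * real (Suc j) * 2 powr (real j * a))"
  proof (rule ennreal_leI)
    have "t = 2 powr (- real (j + 6))"
      unfolding t_def powr_minus_divide by (subst powr_realpow) simp_all
    then have "N = C * (2 powr (6 * a) * 2 powr (real j * a))"
      by (simp add: N_def powr_powr powr_add[symmetric] algebra_simps)
    moreover have "K * (real m * (N * (2 ^ CARD('n) * V)))
        \<le> K * ((\<bar>log 2 (C0\<^sup>2)\<bar> + 14 * \<alpha> + 2) * real (Suc j) * (N * (2 ^ CARD('n) * V)))"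
      using pos N by (intro mult_left_mono mult_right_mono m(2)) (auto simp: V_def)
    ultimately show "K * (real m * (N * (2 ^ CARD('n) * V)))
        \<le> K * (\<bar>log 2 (C0\<^sup>2)\<bar> + 14 * \<alpha> + 2) * C * 2 powr (6 * a) * (2 ^ CARD('n) * V)
          * real (Suc j) * 2 powr (real j * a)"
      by (simp only: mult_ac)
  qed
  finally show ?thesis
    unfolding G_def L_def V_def .
qed

text \<open>The density of \<open>log_derivative_measure q f\<close> with respect to Lebesgue measure.\<close>

definition carleson_density :: "real \<Rightarrow> (real^'n \<Rightarrow> real^'n) \<Rightarrow> real^'n \<Rightarrow> real" where
  "carleson_density q f y = opnorm (weak_derivative (ball 0 1) f y) powr q / norm (f y) powr q * (1 - norm y) powr (q - 1)"

lemma log_derivative_measurable: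
  fixes f :: "real^'n \<Rightarrow> real^'n"
  assumes qr: "quasiregular K f" and S: "S \<in> sets lebesgue" "S \<subseteq> ball 0 1"
  shows "(\<lambda>y. (opnorm (weak_derivative (ball 0 1) f y) / norm (f y)) ^ CARD('n)) \<in> borel_measurable (lebesgue_on S)"
    and "carleson_density q f \<in> borel_measurable (lebesgue_on S)"
proof -
  have [measurable]: "(\<lambda>y. opnorm (weak_derivative (ball 0 1) f y)) \<in> borel_measurable (lebesgue_on S)"
    using has_weak_derivative_on_measurable[OF quasiregular_weak_derivative(2)[OF qr] S(2)]
      borel_measurable_continuous_onI[OF continuous_on_opnorm] by (rule measurable_compose)
  have [measurable]: "f \<in> borel_measurable (lebesgue_on S)"
    using continuous_on_subset[OF quasiregular_weak_derivative(1)[OF qr] S(2)] S(1)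
    by (rule continuous_imp_measurable_on_sets_lebesgue)
  show "(\<lambda>y. (opnorm (weak_derivative (ball 0 1) f y) / norm (f y)) ^ CARD('n)) \<in> borel_measurable (lebesgue_on S)"
    by measurable
  have [measurable]: "(\<lambda>y. norm y) \<in> borel_measurable (lebesgue_on S)"
    by (intro measurable_restrict_space1 measurable_completion) simp
  show "carleson_density q f \<in> borel_measurable (lebesgue_on S)"
    unfolding carleson_density_def[abs_def] by measurable
qed

text \<open>On the layer the weight \<open>(1 - |y|)^(q-1)\<close> is \<open>\<delta>^(q-1)\<close> up to a factor 2, and
\<open>D^q \<le> s^q + s^(q-n) D^n\<close> reduces the claim to the volume of the layer, where \<open>W\<close> enters,
and to the assumed bound on \<open>\<integral> D^n\<close>.\<close>

lemma layer_density_le: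
  fixes f :: "real^'n \<Rightarrow> real^'n"
  assumes qr: "quasiregular K f" and A: "0 \<le> A"
    and log: "(\<integral>\<^sup>+y\<in>box_layer \<omega> r j. ennreal ((opnorm (weak_derivative (ball 0 1) f y) / norm (f y)) ^ CARD('n)) \<partial>lebesgue)
      \<le> ennreal (A * real (Suc j) * 2 powr (real j * a))"
    and \<omega>: "norm \<omega> = 1" and r: "0 < r" and q: "0 < q" "q < real CARD('n)"
  defines "W \<equiv> CARD('n) * 4 ^ CARD('n) * measure lborel (ball (0 :: real^'n) 1)"
    and "\<theta> \<equiv> 2 powr (- (q / CARD('n)) * (real CARD('n) - 1 - a))"
  shows "(\<integral>\<^sup>+y\<in>box_layer \<omega> r j. ennreal (carleson_density q f y) \<partial>lebesgue)
    \<le> ennreal (2 * (W + A) * min r 1 ^ (CARD('n) - 1) * (real (Suc j) * \<theta> ^ j))"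
proof -
  define L where "L = box_layer \<omega> r j"
  define \<rho> where "\<rho> = min r 1"
  define \<delta> where "\<delta> = \<rho> / 2 ^ j"
  define s where "s = 2 powr (real j * (a + 1) / real CARD('n)) / \<rho>"
  define D where "D y = opnorm (weak_derivative (ball 0 1) f y) / norm (f y)" for y
  have \<rho>: "0 < \<rho>" "\<rho> \<le> 1"
    using r by (auto simp: \<rho>_def)
  have s: "0 < s"
    using \<rho> by (simp add: s_def)
  have \<delta>: "0 < \<delta>" "\<delta> \<le> 1"
    using box_layer_width[OF r, of j] by (simp_all add: \<delta>_def \<rho>_def)
  have L_iff: "y \<in> L \<longleftrightarrow> y \<in> ball 0 1 \<and> y \<in> ball \<omega> r \<and> \<delta> / 2 < 1 - norm y \<and> 1 - norm y \<le> \<delta>" for y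
    by (auto simp: L_def box_layer_def \<delta>_def \<rho>_def)
  note L_sets = sets_box_layer[of \<omega> r j, folded L_def]
  have nonneg: "0 \<le> A" "0 \<le> W"
    using A by (simp_all add: W_def)
  have D0: "0 \<le> D y" for y
    by (simp add: D_def opnorm_nonneg)
  have D_meas: "(\<lambda>y. ennreal (D y ^ CARD('n)) * indicator L y) \<in> borel_measurable lebesgue"
    unfolding D_def L_def by (intro borel_measurable_indicator_lebesgue log_derivative_measurable(1)[OF qr]
        sets_box_layer box_layer_subset_ball)
  define k1 where "k1 = 2 * \<delta> powr (q - 1) * s powr q"
  define k2 where "k2 = 2 * \<delta> powr (q - 1) * s powr (q - real CARD('n))"
  have "(\<integral>\<^sup>+y\<in>L. ennreal (carleson_density q f y) \<partial>lebesgue)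
      \<le> (\<integral>\<^sup>+y. ennreal k1 * indicator L y + ennreal k2 * (ennreal (D y ^ CARD('n)) * indicator L y) \<partial>lebesgue)"
  proof (rule nn_integral_mono)
    fix y
    show "ennreal (carleson_density q f y) * indicator L y
        \<le> ennreal k1 * indicator L y + ennreal k2 * (ennreal (D y ^ CARD('n)) * indicator L y)"
    proof (cases "y \<in> L")
      case True
      have "carleson_density q f y = D y powr q * (1 - norm y) powr (q - 1)"
        by (simp add: carleson_density_def D_def powr_divide opnorm_nonneg)
      also have "\<dots> \<le> (s powr q + s powr (q - real CARD('n)) * D y ^ CARD('n)) * (2 * \<delta> powr (q - 1))"
        using True \<delta> q by (intro mult_mono powr_le_add_power powr_dyadic_le D0 s) (auto simp: L_iff D0)
      also have "\<dots> = k1 + k2 * D y ^ CARD('n)"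
        by (simp add: k1_def k2_def algebra_simps)
      finally have "ennreal (carleson_density q f y) \<le> ennreal (k1 + k2 * D y ^ CARD('n))"
        by (rule ennreal_leI)
      also have "\<dots> = ennreal k1 + ennreal k2 * ennreal (D y ^ CARD('n))"
        using D0[of y] by (subst ennreal_plus) (auto simp: k1_def k2_def ennreal_mult)
      finally show ?thesis
        using True by simp
    qed simp
  qed
  also have "\<dots> = (\<integral>\<^sup>+y. ennreal k1 * indicator L y \<partial>lebesgue) + (\<integral>\<^sup>+y. ennreal k2 * (ennreal (D y ^ CARD('n)) * indicator L y) \<partial>lebesgue)"
    by (intro nn_integral_add borel_measurable_times_ennreal borel_measurable_const borel_measurable_indicator L_sets D_meas)
  also have "\<dots> = ennreal k1 * emeasure lebesgue L + ennreal k2 * (\<integral>\<^sup>+y\<in>L. ennreal (D y ^ CARD('n)) \<partial>lebesgue)"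
    by (intro arg_cong2[where f = "(+)"] nn_integral_cmult_indicator nn_integral_cmult L_sets D_meas)
  also have "\<dots> \<le> ennreal k1 * ennreal (W * \<rho> ^ (CARD('n) - 1) * \<delta>)
      + ennreal k2 * ennreal (A * real (Suc j) * 2 powr (real j * a))"
  proof (intro add_mono mult_left_mono)
    show "emeasure lebesgue L \<le> ennreal (W * \<rho> ^ (CARD('n) - 1) * \<delta>)"
      unfolding W_def \<rho>_def by (rule emeasure_box_layer_le[OF \<omega> r \<delta>]) (auto simp: L_iff)
    show "(\<integral>\<^sup>+y\<in>L. ennreal (D y ^ CARD('n)) \<partial>lebesgue) \<le> ennreal (A * real (Suc j) * 2 powr (real j * a))"
      unfolding L_def D_def by (rule log)
  qed auto
  also have "\<dots> = ennreal (k1 * (W * \<rho> ^ (CARD('n) - 1) * \<delta>) + k2 * (A * real (Suc j) * 2 powr (real j * a)))"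
    using \<rho> \<delta> nonneg by (simp add: k1_def k2_def ennreal_mult)
  also have "\<dots> \<le> ennreal (2 * (W + A) * \<rho> ^ (CARD('n) - 1) * (real (Suc j) * \<theta> ^ j))"
  proof (rule ennreal_leI)
    note ex = layer_exponents[OF \<rho>(1), of "CARD('n)" j q a, folded \<delta>_def s_def \<theta>_def]
    have "k1 * (W * \<rho> ^ (CARD('n) - 1) * \<delta>) = 2 * W * (\<delta> powr (q - 1) * s powr q * (\<rho> ^ (CARD('n) - 1) * \<delta>))"
      by (simp add: k1_def)
    also have "\<dots> = 2 * W * (\<rho> ^ (CARD('n) - 1) * \<theta> ^ j)"
      using ex(1) by simp
    also have "\<dots> \<le> 2 * W * (\<rho> ^ (CARD('n) - 1) * \<theta> ^ j) * real (Suc j)"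
      using nonneg \<rho> mult_left_mono[of 1 "real (Suc j)" "2 * W * (\<rho> ^ (CARD('n) - 1) * \<theta> ^ j)"]
      by (simp add: \<theta>_def)
    finally have 1: "k1 * (W * \<rho> ^ (CARD('n) - 1) * \<delta>) \<le> 2 * W * (\<rho> ^ (CARD('n) - 1) * \<theta> ^ j) * real (Suc j)" .
    have "k2 * (A * real (Suc j) * 2 powr (real j * a))
        = 2 * A * real (Suc j) * (\<delta> powr (q - 1) * s powr (q - real CARD('n)) * 2 powr (real j * a))"
      by (simp add: k2_def)
    also have "\<dots> = 2 * A * real (Suc j) * (\<rho> ^ (CARD('n) - 1) * \<theta> ^ j)"
      using ex(2) by simp
    finally have 2: "k2 * (A * real (Suc j) * 2 powr (real j * a)) = 2 * A * real (Suc j) * (\<rho> ^ (CARD('n) - 1) * \<theta> ^ j)" .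
    show "k1 * (W * \<rho> ^ (CARD('n) - 1) * \<delta>) + k2 * (A * real (Suc j) * 2 powr (real j * a))
        \<le> 2 * (W + A) * \<rho> ^ (CARD('n) - 1) * (real (Suc j) * \<theta> ^ j)"
    proof -
      have "2 * (W + A) * \<rho> ^ (CARD('n) - 1) * (real (Suc j) * \<theta> ^ j)
          = 2 * W * (\<rho> ^ (CARD('n) - 1) * \<theta> ^ j) * real (Suc j) + 2 * A * real (Suc j) * (\<rho> ^ (CARD('n) - 1) * \<theta> ^ j)"
        by (simp only: distrib_left distrib_right mult_ac)
      then show ?thesis
        using 1 2 by linarith
    qed
  qed
  finally show ?thesis
    by (simp add: L_def \<rho>_def)
qed

text \<open>Sum over the layers, using \<open>\<Sum>\<^sub>j (j + 1) \<theta>^j = 1 / (1 - \<theta>)^2\<close>.\<close>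

lemma box_density_le:
  fixes f :: "real^'n \<Rightarrow> real^'n"
  assumes qr: "quasiregular K f" and A: "0 \<le> A"
    and log: "\<And>j. (\<integral>\<^sup>+y\<in>box_layer \<omega> r j. ennreal ((opnorm (weak_derivative (ball 0 1) f y) / norm (f y)) ^ CARD('n)) \<partial>lebesgue)
      \<le> ennreal (A * real (Suc j) * 2 powr (real j * a))"
    and a: "a < real CARD('n) - 1"
    and \<omega>: "norm \<omega> = 1" and r: "0 < r" and q: "0 < q" "q < real CARD('n)"
  defines "W \<equiv> CARD('n) * 4 ^ CARD('n) * measure lborel (ball (0 :: real^'n) 1)"
    and "\<theta> \<equiv> 2 powr (- (q / CARD('n)) * (real CARD('n) - 1 - a))"
  shows "(\<integral>\<^sup>+y\<in>ball 0 1 \<inter> ball \<omega> r. ennreal (carleson_density q f y) \<partial>lebesgue)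
    \<le> ennreal (2 * (W + A) / (1 - \<theta>)\<^sup>2 * r ^ (CARD('n) - 1))"
proof -
  have nonneg: "0 \<le> A" "0 \<le> W"
    using A by (simp_all add: W_def)
  have "- (q / CARD('n)) * (real CARD('n) - 1 - a) < 0"
    using q a by (simp add: mult_pos_pos)
  then have \<theta>: "0 < \<theta>" "\<theta> < 1"
    using powr_less_mono[of "- (q / CARD('n)) * (real CARD('n) - 1 - a)" 0 2] by (simp_all add: \<theta>_def)
  have "(\<integral>\<^sup>+y\<in>ball 0 1 \<inter> ball \<omega> r. ennreal (carleson_density q f y) \<partial>lebesgue)
      \<le> (\<integral>\<^sup>+y. (\<Sum>j. ennreal (carleson_density q f y) * indicator (box_layer \<omega> r j) y) \<partial>lebesgue)"
  proof (rule nn_integral_mono)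
    fix y
    show "ennreal (carleson_density q f y) * indicator (ball 0 1 \<inter> ball \<omega> r) y
        \<le> (\<Sum>j. ennreal (carleson_density q f y) * indicator (box_layer \<omega> r j) y)"
    proof (cases "y \<in> ball 0 1 \<inter> ball \<omega> r")
      case True
      then obtain j where "y \<in> box_layer \<omega> r j"
        using box_layer_cover[OF \<omega> r] by blast
      then show ?thesis
        using True sum_le_suminf[of "\<lambda>j. ennreal (carleson_density q f y) * indicator (box_layer \<omega> r j) y" "{j}"] by simp
    next
      case False
      then have "indicator (ball 0 1 \<inter> ball \<omega> r) y = (0 :: ennreal)"
        by (rule indicator_simps(2))
      then show ?thesis
        by (simp only: mult_zero_right zero_le)
    qed
  qed
  also have "\<dots> = (\<Sum>j. \<integral>\<^sup>+y\<in>box_layer \<omega> r j. ennreal (carleson_density q f y) \<partial>lebesgue)"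
    by (intro nn_integral_suminf borel_measurable_indicator_lebesgue log_derivative_measurable(2)[OF qr]
        sets_box_layer box_layer_subset_ball)
  also have "\<dots> \<le> (\<Sum>j. ennreal (2 * (W + A) * min r 1 ^ (CARD('n) - 1) * (real (Suc j) * \<theta> ^ j)))"
    unfolding W_def \<theta>_def by (intro suminf_le summableI layer_density_le[OF qr A log \<omega> r q])
  also have "\<dots> = ennreal (2 * (W + A) * min r 1 ^ (CARD('n) - 1) * (1 / (1 - \<theta>)\<^sup>2))"
  proof (rule suminf_ennreal_eq)
    show "(\<lambda>j. 2 * (W + A) * min r 1 ^ (CARD('n) - 1) * (real (Suc j) * \<theta> ^ j)) sums
        (2 * (W + A) * min r 1 ^ (CARD('n) - 1) * (1 / (1 - \<theta>)\<^sup>2))"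
      using \<theta> geometric_deriv_sums[of \<theta>] by (intro sums_mult) simp
    show "0 \<le> 2 * (W + A) * min r 1 ^ (CARD('n) - 1) * (real (Suc j) * \<theta> ^ j)" for j
      using nonneg r \<theta> by (intro mult_nonneg_nonneg zero_le_power) auto
  qed
  also have "\<dots> \<le> ennreal (2 * (W + A) / (1 - \<theta>)\<^sup>2 * r ^ (CARD('n) - 1))"
  proof (rule ennreal_leI)
    have "min r 1 ^ (CARD('n) - 1) \<le> r ^ (CARD('n) - 1)"
      using r by (intro power_mono) auto
    then have "2 * (W + A) / (1 - \<theta>)\<^sup>2 * min r 1 ^ (CARD('n) - 1) \<le> 2 * (W + A) / (1 - \<theta>)\<^sup>2 * r ^ (CARD('n) - 1)"
      using nonneg by (intro mult_left_mono) auto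
    then show "2 * (W + A) * min r 1 ^ (CARD('n) - 1) * (1 / (1 - \<theta>)\<^sup>2) \<le> 2 * (W + A) / (1 - \<theta>)\<^sup>2 * r ^ (CARD('n) - 1)"
      by (simp add: mult_ac)
  qed
  finally show ?thesis .
qed

text \<open>The passage to Borel sets in the definition of the measure does not affect its values on
them.\<close>

lemma emeasure_log_derivative_measure:
  fixes f :: "real^'n \<Rightarrow> real^'n"
  assumes qr: "quasiregular K f" and B: "B \<in> sets borel" "B \<subseteq> ball 0 1"
  shows "emeasure (log_derivative_measure q f) B = (\<integral>\<^sup>+y\<in>B. ennreal (carleson_density q f y) \<partial>lebesgue)"
proof -
  let ?U = "ball (0 :: real^'n) 1"
  let ?D = "density (lebesgue_on ?U) (\<lambda>y. ennreal (carleson_density q f y))"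
  have meas: "(\<lambda>y. ennreal (carleson_density q f y)) \<in> borel_measurable (lebesgue_on ?U)"
    using log_derivative_measurable(2)[OF qr _ order_refl, of q] by simp
  have id: "(\<lambda>x. x) \<in> ?D \<rightarrow>\<^sub>M restrict_space borel ?U"
  proof (rule measurable_restrict_space2)
    have "(\<lambda>x. x) \<in> lebesgue_on ?U \<rightarrow>\<^sub>M borel"
      by (intro measurable_restrict_space1 measurable_completion) simp
    then show "(\<lambda>x. x) \<in> ?D \<rightarrow>\<^sub>M borel"
      by simp
  qed (simp add: space_restrict_space)
  have BR: "B \<in> sets (restrict_space borel ?U)"
    using B by (simp add: sets_restrict_space_iff)
  have BL: "B \<in> sets (lebesgue_on ?U)"
    using B by (simp add: sets_restrict_space_iff)
  have "emeasure (log_derivative_measure q f) B = emeasure ?D ((\<lambda>x. x) -` B \<inter> space ?D)"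
    unfolding log_derivative_measure_def carleson_density_def[symmetric] by (rule emeasure_distr[OF id BR])
  also have "(\<lambda>x. x) -` B \<inter> space ?D = B"
    using B(2) by (auto simp: space_restrict_space)
  also have "emeasure ?D B = (\<integral>\<^sup>+y\<in>B. ennreal (carleson_density q f y) \<partial>lebesgue_on ?U)"
    by (rule emeasure_density[OF meas BL])
  also have "\<dots> = (\<integral>\<^sup>+y. ennreal (carleson_density q f y) * indicator B y * indicator ?U y \<partial>lebesgue)"
    by (rule nn_integral_restrict_space) simp
  also have "\<dots> = (\<integral>\<^sup>+y\<in>B. ennreal (carleson_density q f y) \<partial>lebesgue)"
    using B(2) by (intro nn_integral_cong) (auto simp: indicator_def)
  finally show ?thesis .
qed

theorem lemma3p6:
  fixes q K \<alpha> C0 a C :: real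
  assumes "CARD('n::finite) \<ge> 2"
    and "0 < q" and "q < real CARD('n)"
    and "K \<ge> 1" and "\<alpha> > 0" and "C0 > 0"
    and "0 \<le> a" and "a < real CARD('n) - 1" and "C > 0"
  shows "\<exists>M. \<forall>f :: real^'n \<Rightarrow> real^'n.
           f \<in> miniowitz_class K C0 \<alpha> \<and> multiplicity_condition C a f \<longrightarrow>
             carleson_measure (log_derivative_measure q f) \<and>
             carleson_constant (log_derivative_measure q f) \<le> M"
proof -
  define A where "A = K * (\<bar>log 2 (C0\<^sup>2)\<bar> + 14 * \<alpha> + 2) * C * 2 powr (6 * a) * (2 ^ CARD('n) * measure lborel (ball (0 :: real^'n) 1))"
  define W where "W = CARD('n) * 4 ^ CARD('n) * measure lborel (ball (0 :: real^'n) 1)"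
  define \<theta> where "\<theta> = 2 powr (- (q / CARD('n)) * (real CARD('n) - 1 - a))"
  define M where "M = 2 * (W + A) / (1 - \<theta>)\<^sup>2 + 1"
  have A: "0 \<le> A" and "0 \<le> W"
    using assms by (simp_all add: A_def W_def)
  then have M: "0 < M"
    unfolding M_def by (intro add_nonneg_pos divide_nonneg_nonneg) auto
  show ?thesis
  proof (intro exI[of _ M] allI impI, elim conjE)
    fix f :: "real^'n \<Rightarrow> real^'n"
    assume f: "f \<in> miniowitz_class K C0 \<alpha>" and mult: "multiplicity_condition C a f"
    have qr: "quasiregular K f"
      using f by (simp add: miniowitz_class_def)
    have bound: "carleson_bound (log_derivative_measure q f) M"
      unfolding carleson_bound_def
    proof (intro ballI allI impI)
      fix \<omega> :: "real^'n" and r :: real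
      assume \<omega>: "\<omega> \<in> sphere 0 1" and r: "0 < r"
      have "emeasure (log_derivative_measure q f) (ball 0 1 \<inter> ball \<omega> r)
          = (\<integral>\<^sup>+y\<in>ball 0 1 \<inter> ball \<omega> r. ennreal (carleson_density q f y) \<partial>lebesgue)"
        by (intro emeasure_log_derivative_measure[OF qr]) auto
      also have "\<dots> \<le> ennreal (2 * (W + A) / (1 - \<theta>)\<^sup>2 * r ^ (CARD('n) - 1))"
        unfolding W_def \<theta>_def
      proof (rule box_density_le[OF qr A])
        show "(\<integral>\<^sup>+y\<in>box_layer \<omega> r j. ennreal ((opnorm (weak_derivative (ball 0 1) f y) / norm (f y)) ^ CARD('n)) \<partial>lebesgue)
            \<le> ennreal (A * real (Suc j) * 2 powr (real j * a))" for j
          unfolding A_def using \<omega> by (intro layer_log_derivative_le[OF f mult] assms r) auto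
      qed (use \<omega> in \<open>auto intro: assms r\<close>)
      also have "\<dots> \<le> ennreal (M * r ^ (CARD('n) - 1))"
        using r by (intro ennreal_leI mult_right_mono) (auto simp: M_def)
      finally show "emeasure (log_derivative_measure q f) (ball 0 1 \<inter> ball \<omega> r) \<le> ennreal (M * r ^ (CARD('n) - 1))" .
    qed
    have "carleson_measure (log_derivative_measure q f)"
      unfolding carleson_measure_def using bound M by (auto simp: log_derivative_measure_def)
    moreover have "carleson_constant (log_derivative_measure q f) \<le> M"
      unfolding carleson_constant_def using bound M by (intro cInf_lower bdd_belowI[of _ 0]) auto
    ultimately show "carleson_measure (log_derivative_measure q f) \<and>
        carleson_constant (log_derivative_measure q f) \<le> M" ..
  qed
qed

end
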